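(* If $H$ is a maximal planar graph with at most eight vertices, then there exists a maximal planar graph $G$ such that $H$ is a subgraph of the center of $G$.
   Context: A maximal planar graph is a planar graph to which no edge can be added while preserving planarity. The eccentricity of a vertex $u$ in a connected graph $G$ is $\max_{x\in V(G)} d_G(u,x)$, and the center of $G$ is the subgraph induced by the vertices of minimum eccentricity. *)

theory Defs
  imports "HOL-Analysis.Analysis" "Graph_Theory.Graph_Theory"
begin

text \<open>
  Finite simple graphs are symmetric loop-free pair digraphs (\<^locale>\<open>pair_graph\<close>):
  an undirected edge between \<open>u\<close> and \<open>v\<close> is the pair of arcs \<open>(u, v)\<close>, \<open>(v, u)\<close>.
\<close>

definition edges :: "'a pair_pre_digraph \<Rightarrow> 'a set set" where
  "edges G = {{u, v} | u v. (u, v) \<in> parcs G}"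

definition add_edge :: "'a pair_pre_digraph \<Rightarrow> 'a \<Rightarrow> 'a \<Rightarrow> 'a pair_pre_digraph" where
  "add_edge G u v = G\<lparr>parcs := parcs G \<union> {(u, v), (v, u)}\<rparr>"

text \<open>
  Drawings in the plane, for which we take \<^typ>\<open>complex\<close>: vertices are distinct points, and
  each undirected edge is drawn once, as a simple arc joining its ends, in one of the two directions.
\<close>

definition plane_drawing ::
    "'a pair_pre_digraph \<Rightarrow> ('a \<Rightarrow> complex) \<Rightarrow> ('a set \<Rightarrow> real \<Rightarrow> complex) \<Rightarrow> bool" where
  "plane_drawing G p \<gamma> \<longleftrightarrow>
     inj_on p (pverts G) \<and>
     (\<forall>e \<in> edges G. arc (\<gamma> e) \<and> {pathstart (\<gamma> e), pathfinish (\<gamma> e)} = p ` e \<and>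
        path_image (\<gamma> e) \<inter> p ` pverts G = p ` e) \<and>
     (\<forall>e \<in> edges G. \<forall>f \<in> edges G. e \<noteq> f \<longrightarrow>
        path_image (\<gamma> e) \<inter> path_image (\<gamma> f) = p ` (e \<inter> f))"

definition planar :: "'a pair_pre_digraph \<Rightarrow> bool" where
  "planar G \<longleftrightarrow> (\<exists>p \<gamma>. plane_drawing G p \<gamma>)"

definition maximal_planar :: "'a pair_pre_digraph \<Rightarrow> bool" where
  "maximal_planar G \<longleftrightarrow> pair_graph G \<and> planar G \<and>
     (\<forall>u \<in> pverts G. \<forall>v \<in> pverts G. u \<noteq> v \<and> (u, v) \<notin> parcs G \<longrightarrow> \<not> planar (add_edge G u v))"

text \<open>Shortest-path distance with unit arc weights; it is \<open>\<infinity>\<close> between different components.\<close>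

definition graph_dist :: "'a pair_pre_digraph \<Rightarrow> 'a \<Rightarrow> 'a \<Rightarrow> ereal" where
  "graph_dist G u v = wf_digraph.\<mu> (with_proj G) (\<lambda>_. 1) u v"

definition eccentricity :: "'a pair_pre_digraph \<Rightarrow> 'a \<Rightarrow> ereal" where
  "eccentricity G u = Max (graph_dist G u ` pverts G)"

definition center :: "'a pair_pre_digraph \<Rightarrow> ('a, 'a \<times> 'a) pre_digraph" where
  "center G = with_proj G \<restriction>
     {u \<in> pverts G. \<forall>v \<in> pverts G. eccentricity G u \<le> eccentricity G v}"

end

theory Submission
  imports Defs
begin

text \<open>
  Stacking a new vertex on a face of a maximal planar graph gives a maximal planar graph, without
  changing the old distances; this reduces to the nonplanarity of \<open>K\<^sub>5\<close>, and Euler's formula is never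
  needed. So one looks for faces on which to stack. In a drawing, consecutive edges \<open>va\<close>, \<open>vb\<close> at a
  vertex lie on a common face, which touches all of \<open>v\<close>, \<open>a\<close>, \<open>b\<close>; by maximality \<open>vab\<close> is then a
  face on which one can stack, and all degrees are at least three as soon as there are four vertices.

  If \<open>H\<close> is complete, or has diameter two and no dominating vertex, then \<open>G = H\<close> works. If some vertex
  dominates, all vertices of \<open>H\<close> get eccentricity two by stacking, for each dominating \<open>x\<close>, on a
  dominating face that avoids \<open>x\<close>. With a second dominating vertex \<open>v\<close> such a face exists at \<open>v\<close>;
  otherwise \<open>H - x\<close> is a triangulated polygon with at most seven vertices and a centroid triangle of it
  is dominating. Finally, if \<open>u\<close>, \<open>t\<close> have distance at least three, then \<open>H\<close> consists of \<open>u\<close>, \<open>t\<close>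
  and their disjoint neighbourhoods, which are triangles. A face containing an edge \<open>ab\<close> between the
  triangles dominates \<open>H\<close>, and a tower of height two over faces of this kind that avoid any given
  vertex makes all eccentricities in \<open>H\<close> equal to three.
\<close>

text \<open>The bound eight enters twice: two disjoint neighbourhoods of at least three vertices
  together with \<open>u\<close> and \<open>t\<close> exhaust it, and the polygon around a unique
  dominating vertex has at most seven vertices. The obstacle is that faces belong to drawings while
  stacking has to be iterated. The proof never follows one drawing: \<open>face\<close> asks only
  that some drawing admits the new vertex, and after each stack the cyclic order at a vertex is read
  off a fresh drawing of the larger graph. It is not enough to give all of H the eccentricity r; no
  added vertex may have a smaller one. For r = 2 this comes for free, because a stacked vertex has
  only three neighbours. For r = 3 two vertices \<open>z1\<close>, \<open>z2\<close>, far from H and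
  from each other, are built beforehand; no vertex of a later tower is within distance two of both.
  On the topological side, arcs may spiral into a vertex, so the edges around it have no evident
  order until the arcs are replaced by radii near the vertices.\<close>

hide_const (open) Digraph_Component.connected

section \<open>Arcs\<close>

text \<open>Arcs are kept as point sets: joining, cutting and intersecting become set operations,
  and the direction of the parametrization disappears.\<close>

definition is_arc :: "complex set \<Rightarrow> complex \<Rightarrow> complex \<Rightarrow> bool" where
  "is_arc S a b \<longleftrightarrow> (\<exists>g. arc g \<and> path_image g = S \<and> pathstart g = a \<and> pathfinish g = b)"

lemma is_arc_sym: "is_arc S a b \<Longrightarrow> is_arc S b a"
  unfolding is_arc_def
  by (metis arc_reversepath path_image_reversepath pathfinish_reversepath pathstart_reversepath)

lemma is_arc_ends: "is_arc S a b \<Longrightarrow> a \<in> S \<and> b \<in> S \<and> a \<noteq> b"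
  unfolding is_arc_def using arc_distinct_ends pathstart_in_path_image pathfinish_in_path_image by metis

lemma is_arc_topology:
  assumes "is_arc S a b"
  shows "compact S" "closed S" "connected S" "connected (- S)"
  using assms unfolding is_arc_def
  by (auto intro: compact_arc_image connected_arc_image connected_arc_complement closed_arc_image)

lemma is_arc_join:
  assumes "is_arc S a b" "is_arc T b c" "S \<inter> T = {b}"
  shows "is_arc (S \<union> T) a c"
proof -
  obtain g h where g: "arc g" "path_image g = S" "pathstart g = a" "pathfinish g = b"
    and h: "arc h" "path_image h = T" "pathstart h = b" "pathfinish h = c"
    using assms by (auto simp: is_arc_def)
  have "arc (g +++ h)" using arc_join g h assms by (metis order_refl)
  moreover have "path_image (g +++ h) = S \<union> T" using g h by (simp add: path_image_join)
  ultimately show ?thesis unfolding is_arc_def using g h by (metis pathstart_join pathfinish_join)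
qed

lemma is_arc_segment: "a \<noteq> b \<Longrightarrow> is_arc (closed_segment a b) a b"
  unfolding is_arc_def by (metis arc_linepath path_image_linepath pathstart_linepath pathfinish_linepath)

lemma is_arc_subpath:
  assumes "arc g" "0 \<le> u" "u < v" "v \<le> 1"
  shows "is_arc (g ` {u..v}) (g u) (g v)"
proof -
  have "arc (subpath u v g)" using assms by (intro arc_subpath_arc) auto
  moreover have "path_image (subpath u v g) = g ` {u..v}" using assms by (simp add: path_image_subpath)
  ultimately show ?thesis unfolding is_arc_def
    using pathstart_subpath pathfinish_subpath by metis
qed

lemma is_arc_split:
  assumes "is_arc S a b" "c \<in> S" "c \<noteq> a" "c \<noteq> b"
  obtains P Q where "is_arc P a c" "is_arc Q c b" "S = P \<union> Q" "P \<inter> Q = {c}"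
proof -
  obtain g where g: "arc g" "path_image g = S" "pathstart g = a" "pathfinish g = b"
    using assms by (auto simp: is_arc_def)
  obtain t where t: "t \<in> {0..1}" "g t = c" using assms(2) g(2) by (auto simp: path_image_def)
  have "t \<noteq> 0" "t \<noteq> 1" using t g assms by (auto simp: pathstart_def pathfinish_def)
  have inj: "inj_on g {0..1}" using g(1) by (simp add: arc_def)
  have "is_arc (g ` {0..t}) a c"
    using is_arc_subpath[OF g(1), of 0 t] g(3) t \<open>t \<noteq> 0\<close> by (simp add: pathstart_def)
  moreover have "is_arc (g ` {t..1}) c b"
    using is_arc_subpath[OF g(1), of t 1] g(4) t \<open>t \<noteq> 1\<close> by (simp add: pathfinish_def)
  moreover have "S = g ` {0..t} \<union> g ` {t..1}"
    using g(2) t by (auto simp: path_image_def image_Un[symmetric] ivl_disj_un)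
  moreover have "g ` {0..t} \<inter> g ` {t..1} = {c}"
  proof -
    have "g ` {0..t} \<inter> g ` {t..1} = g ` ({0..t} \<inter> {t..1})"
      by (rule inj_on_image_Int[OF inj, symmetric]) (use t in auto)
    moreover have "{0..t} \<inter> {t..1} = {t}" using t by auto
    ultimately show ?thesis using t by simp
  qed
  ultimately show ?thesis using that by blast
qed

text \<open>The arc without its ends is the image of an open interval. The third claim makes the
  ends limit points of the rest, which is how a chord is later seen to approach the circle on which
  it ends.\<close>

lemma is_arc_interior:
  assumes "is_arc S a b"
  shows "connected (S - {a, b})" "S - {a, b} \<noteq> {}" "S \<subseteq> closure (S - {a, b})"
proof -
  obtain g where g: "arc g" "path_image g = S" "pathstart g = a" "pathfinish g = b"
    using assms by (auto simp: is_arc_def)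
  have inj: "inj_on g {0..1}" using g(1) by (simp add: arc_def)
  have cont: "continuous_on {0..1} g" using g(1) by (simp add: arc_def path_def)
  have ab: "{a, b} = g ` {0, 1}" using g by (auto simp: pathstart_def pathfinish_def)
  have "S - {a, b} = g ` ({0..1} - {0, 1})"
    unfolding ab using g(2) inj_on_image_set_diff[OF inj, of "{0..1}" "{0,1}"] by (auto simp: path_image_def)
  also have "{0..1} - {0, 1} = {0<..<1::real}" by auto
  finally have eq: "S - {a, b} = g ` {0<..<1}" .
  show "connected (S - {a, b})" unfolding eq
    by (rule connected_continuous_image) (auto intro: continuous_on_subset[OF cont])
  show "S - {a, b} \<noteq> {}" unfolding eq by auto
  have "g ` closure {0<..<1} \<subseteq> closure (g ` {0<..<1})"
    by (rule image_closure_subset[OF _ closed_closure closure_subset]) (use cont in auto)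
  then show "S \<subseteq> closure (S - {a, b})" unfolding eq using g(2) by (simp add: path_image_def)
qed

lemma path_contains_is_arc:
  assumes "path g" "pathstart g = a" "pathfinish g = b" "a \<noteq> b"
  obtains S where "is_arc S a b" "S \<subseteq> path_image g"
  using path_contains_arc[OF assms] unfolding is_arc_def by metis

text \<open>The parameters that are mapped into \<open>T\<close> form a compact set; the arc is cut
  at the least one.\<close>

lemma is_arc_first_hit:
  assumes "is_arc S a b" "closed T" "a \<notin> T" "b \<in> T"
  obtains P c where "is_arc P a c" "P \<subseteq> S" "P \<inter> T = {c}"
proof -
  obtain g where g: "arc g" "path_image g = S" "pathstart g = a" "pathfinish g = b"
    using assms by (auto simp: is_arc_def)
  have cont: "continuous_on {0..1} g" using g(1) by (simp add: arc_def path_def)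
  define Z where "Z = {0..1} \<inter> g -` T"
  have "closed Z" unfolding Z_def by (rule continuous_closed_preimage[OF cont]) (use \<open>closed T\<close> in auto)
  then have "compact Z" unfolding Z_def by (metis compact_Int_closed Int_absorb inf_assoc compact_Icc)
  moreover have "1 \<in> Z" using g assms by (auto simp: Z_def pathfinish_def)
  ultimately obtain t where t: "t \<in> Z" "\<And>s. s \<in> Z \<Longrightarrow> t \<le> s"
    using compact_attains_inf[of Z] by blast
  have t1: "t \<in> {0..1}" "g t \<in> T" using t by (auto simp: Z_def)
  have "t \<noteq> 0" using t1 g assms by (auto simp: pathstart_def)
  have "is_arc (g ` {0..t}) a (g t)"
    using is_arc_subpath[OF g(1), of 0 t] g(3) t1 \<open>t \<noteq> 0\<close> by (simp add: pathstart_def)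
  moreover have "g ` {0..t} \<subseteq> S" using g(2) t1 by (auto simp: path_image_def)
  moreover have "g ` {0..t} \<inter> T = {g t}"
  proof -
    have "s = t" if "s \<in> {0..t}" "g s \<in> T" for s
      using t(2)[of s] that t1 by (auto simp: Z_def)
    then show ?thesis using t1 by fastforce
  qed
  ultimately show ?thesis using that by blast
qed

lemma is_arc_Jordan:
  assumes "is_arc S a b" "is_arc T a b" "S \<inter> T = {a, b}"
  obtains U W where "open U" "open W" "connected U" "connected W" "U \<noteq> {}" "W \<noteq> {}" "U \<inter> W = {}"
    "U \<union> W = - (S \<union> T)" "frontier U = S \<union> T" "frontier W = S \<union> T"
proof -
  obtain g h where g: "arc g" "path_image g = S" "pathstart g = a" "pathfinish g = b"
    and h: "arc h" "path_image h = T" "pathstart h = b" "pathfinish h = a"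
    using assms is_arc_sym[OF assms(2)] by (auto simp: is_arc_def)
  have "simple_path (g +++ h)" by (rule simple_path_join_loop) (use g h assms in auto)
  moreover have "pathfinish (g +++ h) = pathstart (g +++ h)" using g h by simp
  moreover have "path_image (g +++ h) = S \<union> T" using g h by (simp add: path_image_join)
  ultimately show ?thesis using Jordan_curve[of "g +++ h"] that by metis
qed

section \<open>Theta graphs and the complete graph on five vertices\<close>

locale theta =
  fixes A B C :: "complex set" and a b :: complex
  assumes arcs: "is_arc A a b" "is_arc B a b" "is_arc C a b"
    and ints: "A \<inter> B = {a, b}" "A \<inter> C = {a, b}" "B \<inter> C = {a, b}"
begin

lemma rotate: "theta B C A a b"
  by unfold_locales (use arcs ints in auto)

text \<open>The side of the circle \<open>A \<union> B\<close> avoiding \<open>C\<close> is a whole face of the theta graph.\<close>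

lemma far_side:
  obtains U V where "open U" "connected U" "U \<noteq> {}" "frontier U = A \<union> B" "U \<inter> C = {}"
    "open V" "connected V" "U \<inter> V = {}" "U \<union> V = - (A \<union> B)" "C - {a, b} \<subseteq> V"
proof -
  obtain U W where J: "open U" "open W" "connected U" "connected W" "U \<noteq> {}" "W \<noteq> {}" "U \<inter> W = {}"
    "U \<union> W = - (A \<union> B)" "frontier U = A \<union> B" "frontier W = A \<union> B"
    using is_arc_Jordan[OF arcs(1,2) ints(1)] by metis
  have C: "connected (C - {a, b})" "C - {a, b} \<noteq> {}" using is_arc_interior[OF arcs(3)] by auto
  have sub: "C - {a, b} \<subseteq> U \<union> W" using J ints by auto
  have ab: "a \<in> A" "b \<in> A" using is_arc_ends[OF arcs(1)] by auto
  then have nab: "a \<notin> U" "b \<notin> U" "a \<notin> W" "b \<notin> W" using J by blast+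
  show ?thesis
  proof (cases "(C - {a, b}) \<inter> U = {}")
    case True
    then have "U \<inter> C = {}" "C - {a, b} \<subseteq> W" using nab sub by auto
    then show ?thesis using J that[of U W] by auto
  next
    case False
    have "(C - {a, b}) \<inter> W = {}"
    proof (rule ccontr)
      assume "(C - {a, b}) \<inter> W \<noteq> {}"
      then show False using connectedD[OF C(1) J(1,2)] False sub J(7) by blast
    qed
    then have "W \<inter> C = {}" "C - {a, b} \<subseteq> U" using nab sub by auto
    then show ?thesis using J that[of W U] by (auto simp: Un_commute Int_commute)
  qed
qed

end

text \<open>Kuratowski's argument that a theta graph has no fourth face: on the circle \<open>B \<union> C\<close> and on
  the circle \<open>C \<union> A\<close>, the face \<open>F\<close> would lie on the same side as the far side of \<open>A \<union> B\<close>, and these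
  circles meet in the connected set \<open>C\<close>.\<close>

lemma theta_face_far:
  assumes "theta A B C a b" and F: "connected F" "F \<inter> (A \<union> B \<union> C) = {}"
    and adh: "closure F \<inter> (A - {a, b}) \<noteq> {}" "closure F \<inter> (B - {a, b}) \<noteq> {}"
  obtains U V where "open U" "open V" "U \<inter> V = {}" "U \<union> V = - (A \<union> B)" "C - {a, b} \<subseteq> V" "F \<subseteq> U"
proof -
  interpret theta A B C a b by fact
  obtain U V where U: "open U" "connected U" "U \<noteq> {}" "frontier U = A \<union> B" "U \<inter> C = {}"
    "open V" "connected V" "U \<inter> V = {}" "U \<union> V = - (A \<union> B)" "C - {a, b} \<subseteq> V"
    using theta.far_side[OF assms(1)] by metis
  obtain U1 V1 where U1: "open U1" "connected U1" "U1 \<noteq> {}" "frontier U1 = B \<union> C" "U1 \<inter> A = {}"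
    "open V1" "connected V1" "U1 \<inter> V1 = {}" "U1 \<union> V1 = - (B \<union> C)" "A - {a, b} \<subseteq> V1"
    using theta.far_side[OF rotate] by metis
  obtain U2 V2 where U2: "open U2" "connected U2" "U2 \<noteq> {}" "frontier U2 = C \<union> A" "U2 \<inter> B = {}"
    "open V2" "connected V2" "U2 \<inter> V2 = {}" "U2 \<union> V2 = - (C \<union> A)" "B - {a, b} \<subseteq> V2"
    using theta.far_side[OF theta.rotate[OF rotate]] by metis
  have clU: "closure X \<inter> Y = {}" if "frontier X \<inter> Y = {}" "X \<inter> Y = {}" for X Y :: "complex set"
    using that closure_Un_frontier by blast
  \<comment> \<open>\<open>F\<close> is connected and off the circle, hence on one side of it. That
    side is not \<open>U'\<close>, whose closure misses the open arc \<open>Y\<close> that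
    \<open>F\<close> approaches.\<close>
  have side: "F \<subseteq> V'" if "open U'" "open V'" "U' \<inter> V' = {}" "F \<subseteq> U' \<union> V'" "closure U' \<inter> (Y - {a, b}) = {}"
      "closure F \<inter> (Y - {a, b}) \<noteq> {}" for U' V' Y
  proof -
    have "F \<inter> V' \<noteq> {}"
    proof
      assume "F \<inter> V' = {}"
      then have "F \<subseteq> U'" using that by auto
      then show False using that closure_mono by blast
    qed
    then have "F \<inter> U' = {}"
      using connectedD[OF F(1) that(1,2)] that(3,4) by blast
    then show ?thesis using that by auto
  qed
  have FV1: "F \<subseteq> V1"
    by (rule side[OF U1(1,6,8)]) (use F U1 adh(1) ints in \<open>auto intro!: clU\<close>)
  have FV2: "F \<subseteq> V2"
    by (rule side[OF U2(1,6,8)]) (use F U2 adh(2) ints in \<open>auto intro!: clU\<close>)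
  obtain y where y: "y \<in> U" using U by auto
  \<comment> \<open>The frontier of \<open>U\<close> is all of \<open>A \<union> B\<close>, so
    \<open>U\<close> comes arbitrarily close to interior points of \<open>Y\<close>. This decides on
    which side of the other two circles \<open>U\<close> lies.\<close>
  have meets: "U \<inter> W \<noteq> {}" if "open W" "Y - {a, b} \<subseteq> W" "Y \<subseteq> A \<union> B" "is_arc Y a b" for W Y
  proof -
    have "Y - {a, b} \<noteq> {}" using is_arc_interior(2)[OF that(4)] .
    then obtain x where x: "x \<in> Y - {a, b}" by auto
    then have "x \<in> closure U" using U(4) that(3) by (auto simp: frontier_def)
    moreover have "x \<in> W" using x that by auto
    ultimately show ?thesis using that(1) open_Int_closure_eq_empty[of W U] by blast
  qed
  have UA: "U \<subseteq> V1"
  proof -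
    have "U \<subseteq> U1 \<union> V1" using U(9) U(5) U1(9) by blast
    then show ?thesis using meets[OF U1(6,10) _ arcs(1)] connectedD[OF U(2) U1(1,6)] U1(8) by blast
  qed
  have UB: "U \<subseteq> V2"
  proof -
    have "U \<subseteq> U2 \<union> V2" using U(9) U(5) U2(9) by blast
    then show ?thesis using meets[OF U2(6,10) _ arcs(2)] connectedD[OF U(2) U2(1,6)] U2(8) by blast
  qed
  have "F \<subseteq> U"
  proof
    fix z assume z: "z \<in> F"
    have "connected_component (- ((B \<union> C) \<union> (C \<union> A))) y z"
    proof (rule Janiszewski)
      show "compact (B \<union> C)" "closed (C \<union> A)" using is_arc_topology arcs by blast+
      have "(B \<union> C) \<inter> (C \<union> A) = C" using ints is_arc_ends[OF arcs(3)] by auto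
      then show "connected ((B \<union> C) \<inter> (C \<union> A))" using is_arc_topology arcs by metis
      show "connected_component (- (B \<union> C)) y z"
        unfolding connected_component_def using U1 UA FV1 y z by (intro exI[of _ V1]) auto
      show "connected_component (- (C \<union> A)) y z"
        unfolding connected_component_def using U2 UB FV2 y z by (intro exI[of _ V2]) auto
    qed
    then obtain T where T: "connected T" "T \<subseteq> - (A \<union> B \<union> C)" "y \<in> T" "z \<in> T"
      unfolding connected_component_def by blast
    have "T \<subseteq> U \<union> V" using T U by auto
    then show "z \<in> U" using connectedD[OF T(1) U(1,6)] U(8) T(3,4) y by blast
  qed
  then show ?thesis using that U by blast
qed

text \<open>With the circle, \<open>P\<close> forms a theta graph, and the open chord
  \<open>Q\<close> approaches the interiors of both \<open>A\<close> and \<open>B\<close>. By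
  \<open>theta_face_far\<close> the circle separates it from \<open>P\<close>, although both run in
  the connected set \<open>I\<close> off the circle.\<close>

lemma crossing_chords:
  assumes circle: "is_arc A a b" "is_arc B a b" "A \<inter> B = {a, b}"
    and zs: "z \<in> A - {a, b}" "s \<in> B - {a, b}"
    and P: "is_arc P a b" "P \<inter> (A \<union> B) = {a, b}"
    and Q: "is_arc Q z s" "Q \<inter> (A \<union> B) = {z, s}"
    and PQ: "P \<inter> Q = {}"
    and I: "connected I" "I \<inter> (A \<union> B) = {}" "P - {a, b} \<subseteq> I" "Q - {z, s} \<subseteq> I"
  shows False
proof -
  have ends: "a \<in> A" "b \<in> A" "a \<in> B" "b \<in> B" using is_arc_ends circle by blast+
  have th: "theta A B P a b"
    by unfold_locales (use circle P ends in auto)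
  have "z \<in> closure (Q - {z, s})" "s \<in> closure (Q - {z, s})"
    using is_arc_interior(3)[OF Q(1)] is_arc_ends[OF Q(1)] by blast+
  then have "closure (Q - {z, s}) \<inter> (A - {a, b}) \<noteq> {}" "closure (Q - {z, s}) \<inter> (B - {a, b}) \<noteq> {}"
    using zs by blast+
  moreover have "(Q - {z, s}) \<inter> (A \<union> B \<union> P) = {}" using Q PQ by blast
  ultimately obtain U V where U: "open U" "open V" "U \<inter> V = {}" "U \<union> V = - (A \<union> B)" "P - {a, b} \<subseteq> V"
    "Q - {z, s} \<subseteq> U"
    using theta_face_far[OF th is_arc_interior(1)[OF Q(1)]] by metis
  obtain p q where "p \<in> P - {a, b}" "q \<in> Q - {z, s}"
    using is_arc_interior(2)[OF Q(1)] is_arc_interior(2)[OF P(1)] by auto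
  then have "q \<in> I \<inter> U" "p \<in> I \<inter> V" using U(5,6) I(3,4) by auto
  moreover have "I \<subseteq> U \<union> V" unfolding U(4) using I(2) by auto
  ultimately show False using connectedD[OF I(1) U(1,2)] U(3) by auto
qed

text \<open>On the circle \<open>a z b s\<close>, the chord \<open>ab\<close> interleaves with
  \<open>zs\<close> and with \<open>S\<close>, which runs through \<open>z\<close>,
  \<open>w\<close>, \<open>s\<close>; and \<open>R\<close> through \<open>a\<close>,
  \<open>w\<close>, \<open>b\<close> interleaves with \<open>zs\<close>. \<open>R\<close> and
  \<open>S\<close> share the point \<open>w\<close>, so they lie on one side. With two sides only,
  some disjoint interleaving pair ends up on the same side.\<close>

lemma not_plane_K5:
  assumes arcs: "is_arc ab a b" "is_arc az a z" "is_arc zb z b" "is_arc as a s" "is_arc sb s b" "is_arc zs z s"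
      "is_arc wa w a" "is_arc wb w b" "is_arc wz w z" "is_arc ws w s"
    and d: "distinct [a, b, z, s, w]"
    and i: "ab \<inter> az = {a}" "ab \<inter> zb = {b}" "ab \<inter> as = {a}" "ab \<inter> sb = {b}" "ab \<inter> zs = {}"
      "ab \<inter> wa = {a}" "ab \<inter> wb = {b}" "ab \<inter> wz = {}" "ab \<inter> ws = {}"
      "az \<inter> zb = {z}" "az \<inter> as = {a}" "az \<inter> sb = {}" "az \<inter> zs = {z}"
      "az \<inter> wa = {a}" "az \<inter> wb = {}" "az \<inter> wz = {z}" "az \<inter> ws = {}"
      "zb \<inter> as = {}" "zb \<inter> sb = {b}" "zb \<inter> zs = {z}"
      "zb \<inter> wa = {}" "zb \<inter> wb = {b}" "zb \<inter> wz = {z}" "zb \<inter> ws = {}"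
      "as \<inter> sb = {s}" "as \<inter> zs = {s}"
      "as \<inter> wa = {a}" "as \<inter> wb = {}" "as \<inter> wz = {}" "as \<inter> ws = {s}"
      "sb \<inter> zs = {s}"
      "sb \<inter> wa = {}" "sb \<inter> wb = {b}" "sb \<inter> wz = {}" "sb \<inter> ws = {s}"
      "zs \<inter> wa = {}" "zs \<inter> wb = {}" "zs \<inter> wz = {z}" "zs \<inter> ws = {s}"
      "wa \<inter> wb = {w}" "wa \<inter> wz = {w}" "wa \<inter> ws = {w}" "wb \<inter> wz = {w}" "wb \<inter> ws = {w}" "wz \<inter> ws = {w}"
  shows False
proof -
  note e = arcs[THEN is_arc_ends]
  define A where "A = az \<union> zb"
  define B where "B = as \<union> sb"
  have A: "is_arc A a b" unfolding A_def by (rule is_arc_join[OF arcs(2,3)]) (rule i)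
  have B: "is_arc B a b" unfolding B_def by (rule is_arc_join[OF arcs(4,5)]) (rule i)
  note dist = Int_Un_distrib Int_Un_distrib2
  have AB: "A \<inter> B = {a, b}" unfolding A_def B_def dist i by auto
  have za: "z \<in> A - {a, b}" "s \<in> B - {a, b}" using e(2,4) d unfolding A_def B_def by auto
  define R where "R = wa \<union> wb"
  define S where "S = wz \<union> ws"
  have R: "is_arc R a b" unfolding R_def by (rule is_arc_join[OF is_arc_sym[OF arcs(7)] arcs(8)]) (use i in simp)
  have S: "is_arc S z s" unfolding S_def by (rule is_arc_join[OF is_arc_sym[OF arcs(9)] arcs(10)]) (use i in simp)
  have "(A \<union> B) \<inter> R = {a, b}" unfolding R_def A_def B_def dist i by auto
  then have RAB: "R \<inter> (A \<union> B) = {a, b}" by (simp add: Int_commute)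
  have "(A \<union> B) \<inter> S = {z, s}" unfolding S_def A_def B_def dist i by auto
  then have SAB: "S \<inter> (A \<union> B) = {z, s}" by (simp add: Int_commute)
  have PAB: "ab \<inter> (A \<union> B) = {a, b}" unfolding A_def B_def dist i by auto
  have "(A \<union> B) \<inter> zs = {z, s}" unfolding A_def B_def dist i Int_commute[of sb zs] by (auto simp: i)
  then have QAB: "zs \<inter> (A \<union> B) = {z, s}" by (simp add: Int_commute)
  have "zs \<inter> R = {}" unfolding R_def dist i by auto
  then have PS: "ab \<inter> S = {}" "R \<inter> zs = {}" "ab \<inter> zs = {}" unfolding S_def dist i by auto
  have wR: "w \<in> R - {a, b}" "w \<in> S - {z, s}" using e(7,9) d unfolding R_def S_def by auto
  obtain I J where J: "open I" "open J" "connected I" "connected J" "I \<inter> J = {}" "I \<union> J = - (A \<union> B)"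
    using is_arc_Jordan[OF A B AB] by metis
  have IJ: "I \<inter> (A \<union> B) = {}" "J \<inter> (A \<union> B) = {}" using J by blast+
  have cases: "X \<subseteq> I \<or> X \<subseteq> J" if "connected X" "X \<inter> (A \<union> B) = {}" for X
    using connectedD[OF that(1) J(1,2)] that(2) J(5,6) by blast
  have X: "ab - {a, b} \<subseteq> I \<or> ab - {a, b} \<subseteq> J" "zs - {z, s} \<subseteq> I \<or> zs - {z, s} \<subseteq> J"
    "R - {a, b} \<subseteq> I \<or> R - {a, b} \<subseteq> J" "S - {z, s} \<subseteq> I \<or> S - {z, s} \<subseteq> J"
    by ((rule cases, rule is_arc_interior, fact), use PAB QAB RAB SAB in blast)+
  note c1 = crossing_chords[OF A B AB za arcs(1) PAB arcs(6) QAB PS(3)]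
  note c2 = crossing_chords[OF A B AB za arcs(1) PAB S SAB PS(1)]
  note c3 = crossing_chords[OF A B AB za R RAB arcs(6) QAB PS(2)]
  have same: "R - {a, b} \<subseteq> I \<and> S - {z, s} \<subseteq> I \<or> R - {a, b} \<subseteq> J \<and> S - {z, s} \<subseteq> J"
    using X(3,4) wR J(5) by blast
  show False
    using X(1,2) same c1[OF J(3) IJ(1)] c1[OF J(4) IJ(2)] c2[OF J(3) IJ(1)] c2[OF J(4) IJ(2)]
      c3[OF J(3) IJ(1)] c3[OF J(4) IJ(2)] by blast
qed

section \<open>Plane graphs\<close>

text \<open>A drawing whose vertices are points of the plane; \<open>A e\<close> is the arc drawn for the edge \<open>e\<close>.\<close>

locale plane_graph =
  fixes V :: "complex set" and E :: "complex set set" and A :: "complex set \<Rightarrow> complex set"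
  assumes fin: "finite V"
    and edge: "e \<in> E \<Longrightarrow> \<exists>a b. e = {a, b} \<and> a \<in> V \<and> b \<in> V \<and> is_arc (A e) a b"
    and vert: "e \<in> E \<Longrightarrow> A e \<inter> V = e"
    and cross: "e \<in> E \<Longrightarrow> f \<in> E \<Longrightarrow> e \<noteq> f \<Longrightarrow> A e \<inter> A f = e \<inter> f"
begin

definition K :: "complex set" where "K = V \<union> (\<Union>e\<in>E. A e)"

lemma edge_sub: "e \<in> E \<Longrightarrow> e \<subseteq> V"
  using edge by auto

lemma edge_arc: "{a, b} \<in> E \<Longrightarrow> is_arc (A {a, b}) a b"
  using edge[of "{a, b}"] is_arc_sym by (metis doubleton_eq_iff)

lemma edge_in: "{a, b} \<in> E \<Longrightarrow> a \<in> V \<and> b \<in> V \<and> a \<noteq> b"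
  using edge_sub edge_arc is_arc_ends by blast

lemma ends_in_arc: "e \<in> E \<Longrightarrow> e \<subseteq> A e"
  using vert by blast

lemma fin_E: "finite E"
  by (rule finite_subset[of _ "Pow V"]) (use fin edge_sub in auto)

lemma arc_closed: "e \<in> E \<Longrightarrow> closed (A e)"
  using edge is_arc_topology by metis

lemma K_closed: "closed K"
  unfolding K_def using fin_E fin arc_closed by (intro closed_Un closed_UN finite_imp_closed) auto

lemma subgraph_plane:
  assumes "V' \<subseteq> V" "E' \<subseteq> E" "\<And>e. e \<in> E' \<Longrightarrow> e \<subseteq> V'"
  shows "plane_graph V' E' A"
proof
  show "finite V'" by (rule finite_subset[OF assms(1) fin])
  show "\<exists>a b. e = {a, b} \<and> a \<in> V' \<and> b \<in> V' \<and> is_arc (A e) a b" if e: "e \<in> E'" for e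
  proof -
    have "e \<in> E" "e \<subseteq> V'" using e assms by auto
    then show ?thesis using edge[of e] by auto
  qed
  show "A e \<inter> V' = e" if "e \<in> E'" for e
  proof -
    have "A e \<inter> V = e" "e \<subseteq> V'" using vert[of e] assms(2,3) that by blast+
    then show ?thesis using assms(1) by auto
  qed
  show "A e \<inter> A f = e \<inter> f" if "e \<in> E'" "f \<in> E'" "e \<noteq> f" for e f
    using cross that assms by auto
qed

lemma add_arc:
  assumes "{a, b} \<notin> E" "a \<in> V" "b \<in> V" "is_arc S a b" "S \<inter> K = {a, b}"
  shows "plane_graph V (insert {a, b} E) (A({a, b} := S))"
proof
  have SV: "S \<inter> V = {a, b}" using assms unfolding K_def by auto
  have SA: "S \<inter> A e = {a, b} \<inter> e" if "e \<in> E" for e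
  proof -
    have "S \<inter> A e = {a, b} \<inter> A e" using assms(5) that unfolding K_def by auto
    also have "\<dots> = {a, b} \<inter> e" using vert[OF that] assms by auto
    finally show ?thesis .
  qed
  show "finite V" by (rule fin)
  show "\<exists>c d. e = {c, d} \<and> c \<in> V \<and> d \<in> V \<and> is_arc ((A({a, b} := S)) e) c d" if "e \<in> insert {a, b} E" for e
  proof (cases "e = {a, b}")
    case True
    then show ?thesis using assms by (intro exI[of _ a] exI[of _ b]) auto
  next
    case False
    then show ?thesis using that edge by auto
  qed
  show "(A({a, b} := S)) e \<inter> V = e" if "e \<in> insert {a, b} E" for e
    using SV vert that by (cases "e = {a, b}") auto
  show "(A({a, b} := S)) e \<inter> (A({a, b} := S)) f = e \<inter> f"
    if "e \<in> insert {a, b} E" "f \<in> insert {a, b} E" "e \<noteq> f" for e f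
  proof (cases "e = {a, b}")
    case True
    then show ?thesis using SA[of f] that by simp
  next
    case False
    then have "e \<in> E" using that by simp
    then show ?thesis using SA[of e] cross[of e f] that False by (cases "f = {a, b}") (auto simp: Int_commute)
  qed
qed

lemma add_point:
  assumes "w \<notin> K"
  shows "plane_graph (insert w V) E A"
proof
  show "finite (insert w V)" using fin by simp
  show "\<exists>a b. e = {a, b} \<and> a \<in> insert w V \<and> b \<in> insert w V \<and> is_arc (A e) a b" if "e \<in> E" for e
    using edge[OF that] by auto
  show "A e \<inter> insert w V = e" if "e \<in> E" for e
    using vert[OF that] that assms unfolding K_def by auto
qed (rule cross)

text \<open>The arcs of \<open>pa\<close> and \<open>pb\<close> merge into an arc from
  \<open>a\<close> to \<open>b\<close>; once \<open>p\<close> and its edges are deleted, nothing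
  else meets the interior of that arc. Repeated suppression reduces subdivisions of
  \<open>K\<^sub>5\<close> to \<open>K\<^sub>5\<close> itself.\<close>

lemma suppress:
  assumes "{p, a} \<in> E" "{p, b} \<in> E" "a \<noteq> b"
  shows "\<exists>A'. plane_graph (V - {p}) (insert {a, b} {e \<in> E. p \<notin> e}) A'"
proof -
  let ?E = "{e \<in> E. p \<notin> e}"
  have sub: "plane_graph (V - {p}) ?E A"
    by (rule subgraph_plane) (use edge_sub in auto)
  interpret S: plane_graph "V - {p}" ?E A by (rule sub)
  show ?thesis
  proof (cases "{a, b} \<in> ?E")
    case True
    then show ?thesis using sub by (auto simp: insert_absorb)
  next
    case False
    have ab: "a \<in> V - {p}" "b \<in> V - {p}" using edge_in assms by blast+
    have ne: "{p, a} \<noteq> {p, b}" using ab assms by (auto simp: doubleton_eq_iff)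
    have ip: "{p, a} \<inter> {p, b} = {p}" using assms(3) ab by auto
    have arc: "is_arc (A {p, a} \<union> A {p, b}) a b"
      by (rule is_arc_join[OF is_arc_sym[OF edge_arc[OF assms(1)]] edge_arc[OF assms(2)]])
        (use cross[OF assms(1,2) ne] ip in simp)
    have 1: "A {p, c} \<inter> S.K \<subseteq> {a, b}" if c: "{p, c} \<in> E" "c = a \<or> c = b" for c
    proof
      fix x assume x: "x \<in> A {p, c} \<inter> S.K"
      then consider "x \<in> V - {p}" | f where "f \<in> E" "p \<notin> f" "x \<in> A f" unfolding S.K_def by auto
      then show "x \<in> {a, b}"
      proof cases
        case 1
        then show ?thesis using vert[OF c(1)] x c(2) by auto
      next
        case 2
        then have "{p, c} \<noteq> f" by auto
        then have "x \<in> {p, c} \<inter> f" using cross[OF c(1) 2(1)] 2 x by auto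
        then show ?thesis using 2 c(2) by auto
      qed
    qed
    have "{a, b} \<subseteq> A {p, a} \<union> A {p, b}" using is_arc_ends[OF arc] by auto
    moreover have "{a, b} \<subseteq> S.K" using ab unfolding S.K_def by auto
    ultimately have "(A {p, a} \<union> A {p, b}) \<inter> S.K = {a, b}"
      using 1[OF assms(1) disjI1[OF refl]] 1[OF assms(2) disjI2[OF refl]] by blast
    then show ?thesis using S.add_arc[OF False ab arc] by blast
  qed
qed

lemma no_K5:
  assumes "distinct [a, b, z, s, w]" "{a, b} \<in> E" "{a, z} \<in> E" "{z, b} \<in> E" "{a, s} \<in> E" "{s, b} \<in> E"
    "{z, s} \<in> E" "{w, a} \<in> E" "{w, b} \<in> E" "{w, z} \<in> E" "{w, s} \<in> E"
  shows False
proof -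
  note d = assms(1) and es = assms(2-)
  show False
    by (rule not_plane_K5[of "A {a, b}" a b "A {a, z}" z "A {z, b}" "A {a, s}" s "A {s, b}" "A {z, s}"
          "A {w, a}" w "A {w, b}" "A {w, z}" "A {w, s}"];
        (rule edge_arc, fact | fact d | subst cross; (fact | use d in \<open>auto simp: doubleton_eq_iff\<close>)))
qed

text \<open>If a face touched only part of the arc \<open>A e\<close>, then the first untouched piece \<open>M\<close> of the arc could
  be reached from the face around the tip of the pendant arc \<open>N\<close> before \<open>M\<close>, because a pendant arc
  does not separate (Janiszewski).\<close>

lemma face_touches_whole_edge:
  assumes F: "F \<in> components (- K)" and e: "e \<in> E" and p: "p \<in> closure F" "p \<in> A e" "p \<notin> e"
  shows "A e \<subseteq> closure F"
proof (rule ccontr)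
  assume "\<not> A e \<subseteq> closure F"
  then obtain q0 where q0: "q0 \<in> A e" "q0 \<notin> closure F" by blast
  obtain a b where ab: "e = {a, b}" "is_arc (A e) a b" using edge[OF e] by auto
  obtain g0 where "arc g0" "path_image g0 = A e" "pathstart g0 = a" "pathfinish g0 = b"
    using ab(2) unfolding is_arc_def by auto
  then have g0: "arc g0" "path_image g0 = A e" "e = {pathstart g0, pathfinish g0}" using ab(1) by simp_all
  have gim0: "A e = g0 ` {0..1}" using g0(2) by (simp add: path_image_def)
  obtain s0 where s0: "s0 \<in> {0..1}" "g0 s0 = p" using p(2) unfolding gim0 by (elim imageE) simp
  obtain t0 where t0: "t0 \<in> {0..1}" "g0 t0 = q0" using q0(1) unfolding gim0 by (elim imageE) simp
  note st0 = s0(1) t0(1) s0(2) t0(2)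
  have "s0 \<noteq> t0" using st0(3,4) p(1) q0(2) by metis
  \<comment> \<open>Reverse the arc if necessary, so that the untouched point comes after the
    touched one.\<close>
  obtain g s t1 where g: "arc g" "path_image g = A e" "e = {g 0, g 1}"
    and st1: "0 \<le> s" "s < t1" "t1 \<le> 1" "g s = p" "g t1 = q0"
  proof (cases "s0 < t0")
    case True
    have "e = {g0 0, g0 1}" using g0(3) by (simp only: pathstart_def pathfinish_def)
    moreover have "0 \<le> s0" "t0 \<le> 1" using st0(1,2) by simp_all
    ultimately show ?thesis using that[OF g0(1,2) _ _ True _ st0(3,4)] by metis
  next
    case False
    let ?g = "reversepath g0"
    have "e = {?g 0, ?g 1}"
      using g0(3) by (simp add: pathstart_def pathfinish_def reversepath_def insert_commute)
    moreover have "arc ?g" "path_image ?g = A e" using g0(1,2) by (simp_all add: arc_reversepath)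
    moreover have "?g (1 - s0) = p" "?g (1 - t0) = q0" using st0(3,4) by (simp_all add: reversepath_def)
    moreover have "0 \<le> 1 - s0" "1 - s0 < 1 - t0" "1 - t0 \<le> 1"
      using st0(1,2) False \<open>s0 \<noteq> t0\<close> by simp_all
    ultimately show ?thesis using that[of ?g "1 - s0" "1 - t0"] by metis
  qed
  have inj: "inj_on g {0..1}" and cont: "continuous_on {0..1} g" using g(1) by (auto simp: arc_def path_def)
  have s0: "0 < s" using st1 p g by (cases "s = 0") auto
  \<comment> \<open>If the untouched point is the end of the arc, the complement of
    \<open>closure F\<close>, being open, contains an earlier one; then the tail \<open>R\<close>
    below is a proper arc.\<close>
  have "\<exists>t. s < t \<and> t < 1 \<and> g t \<notin> closure F"
  proof (cases "t1 < 1")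
    case False
    have "open (- closure F)" by auto
    then have o: "openin (top_of_set {0..1}) ({0..1} \<inter> g -` (- closure F))"
      by (intro continuous_openin_preimage_gen cont)
    have one: "1 \<in> {0..1} \<inter> g -` (- closure F)" using False st1(3,5) q0(2) by auto
    obtain d where d: "0 < d" "\<forall>x\<in>{0..1}. dist x 1 < d \<longrightarrow> x \<in> {0..1} \<inter> g -` (- closure F)"
      using bspec[OF conjunct2[OF o[unfolded openin_euclidean_subtopology_iff]] one] by (elim exE conjE)
    have "max s (1 - d) < 1" using st1(2,3) d(1) by auto
    then obtain x where x: "max s (1 - d) < x" "x < 1" using dense by blast
    then have "s < x" "x < 1" "x \<in> {0..1}" "dist x 1 < d" using s0 by (auto simp: dist_real_def)
    moreover have "g x \<notin> closure F" using bspec[OF d(2) \<open>x \<in> {0..1}\<close>] \<open>dist x 1 < d\<close> by simp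
    ultimately show ?thesis by (intro exI[of _ x] conjI)
  qed (use st1 q0 in auto)
  then obtain t where t: "s < t" "t < 1" "g t \<notin> closure F" by blast
  \<comment> \<open>\<open>u\<close> will be the last touched parameter up to \<open>t\<close>, so
    the piece strictly between \<open>u\<close> and \<open>t\<close> is the untouched
    \<open>M\<close>.\<close>
  define Z where "Z = {s..t} \<inter> g -` closure F"
  have "closed Z" unfolding Z_def
    by (rule continuous_closed_preimage) (use s0 t in \<open>auto intro: continuous_on_subset[OF cont]\<close>)
  then have "compact Z" unfolding Z_def by (metis compact_Int_closed Int_absorb inf_assoc compact_Icc)
  moreover have "s \<in> Z" using st1 p t by (auto simp: Z_def)
  ultimately obtain u where u: "u \<in> Z" "\<And>x. x \<in> Z \<Longrightarrow> x \<le> u" using compact_attains_sup[of Z] by blast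
  have u1: "s \<le> u" "u < t" "g u \<in> closure F" using u(1) t by (auto simp: Z_def less_le)
  have after: "g x \<notin> closure F" if "u < x" "x \<le> t" for x
    using u(2)[of x] that u1 by (auto simp: Z_def)
  define K' where "K' = V \<union> (\<Union>f\<in>E - {e}. A f)"
  have KK: "K = K' \<union> A e" unfolding K_def K'_def using e by auto
  have K'e: "K' \<inter> A e = e"
  proof -
    have "A f \<inter> A e \<subseteq> e" if "f \<in> E - {e}" for f using cross[of f e] that e by auto
    then show ?thesis unfolding K'_def using vert[OF e] by auto
  qed
  have K'cl: "closed K'"
    unfolding K'_def using fin_E fin arc_closed by (intro closed_Un closed_UN finite_imp_closed) auto
  \<comment> \<open>\<open>N\<close> ends in the tip \<open>g u\<close> and hangs on
    \<open>T\<close>, the drawing without \<open>N\<close> and \<open>M\<close>, at the single point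
    \<open>g 0\<close>.\<close>
  define N where "N = g ` {0..u}"
  define R where "R = g ` {t..1}"
  define T where "T = K' \<union> R"
  have gim: "A e = g ` {0..1}" using g(2) by (simp add: path_image_def)
  have arcN: "is_arc N (g 0) (g u)" and arcR: "is_arc R (g t) (g 1)"
    unfolding N_def R_def using is_arc_subpath[OF g(1)] s0 u1 t by auto
  have notK': "g x \<notin> K'" if "0 < x" "x < 1" for x
  proof
    assume "g x \<in> K'"
    then have "g x \<in> e" using K'e gim that by auto
    then have "x = 0 \<or> x = 1" using g(3) inj_onD[OF inj, of x 0] inj_onD[OF inj, of x 1] that by auto
    then show False using that by auto
  qed
  have notR: "g x \<notin> R" if "0 \<le> x" "x < t" for x
  proof
    assume "g x \<in> R"
    then obtain y where "y \<in> {t..1}" "g x = g y" unfolding R_def by auto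
    then show False using inj_onD[OF inj, of x y] that t s0 by auto
  qed
  have notN: "g x \<notin> N" if "u < x" "x \<le> 1" for x
  proof
    assume "g x \<in> N"
    then obtain y where "y \<in> {0..u}" "g x = g y" unfolding N_def by auto
    then show False using inj_onD[OF inj, of x y] that u1 s0 by auto
  qed
  have NT: "N \<inter> T = {g 0}"
  proof -
    have 0: "g 0 \<in> K'" using K'e g(3) by auto
    have only0: "x = 0" if "x \<in> {0..u}" "g x \<in> K' \<union> R" for x
      using notK'[of x] notR[of x] that u1 t by (cases "x = 0") auto
    have 1: "g 0 \<in> N" unfolding N_def using u1 s0 by simp
    have 2: "y = g 0" if yN: "y \<in> N" "y \<in> K' \<union> R" for y
    proof -
      obtain x where x: "x \<in> {0..u}" "y = g x" using yN(1) unfolding N_def by (elim imageE) simp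
      then show ?thesis using only0[of x] yN(2) by simp
    qed
    have "g 0 \<in> N \<inter> T" using 0 1 unfolding T_def by simp
    moreover have "N \<inter> T \<subseteq> {g 0}"
    proof
      fix y assume "y \<in> N \<inter> T"
      then have "y \<in> N" "y \<in> K' \<union> R" unfolding T_def by (rule IntD1, elim IntD2)
      then show "y \<in> {g 0}" using 2 by simp
    qed
    ultimately show ?thesis by (intro equalityI) simp_all
  qed
  have Fo: "open F" using F K_closed open_components by (metis open_Compl)
  have Fc: "connected F" and FK: "F \<inter> K = {}" "F \<noteq> {}"
    using F in_components_connected in_components_subset in_components_nonempty by blast+
  obtain z where z: "z \<in> F" using FK by auto
  define y where "y = g ((u + t) / 2)"
  have y: "y \<notin> closure F" "y \<notin> T" "y \<notin> N"
    unfolding y_def T_def using after[of "(u+t)/2"] notK'[of "(u+t)/2"] notR[of "(u+t)/2"] notN[of "(u+t)/2"] u1 s0 t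
    by auto
  \<comment> \<open>Neither \<open>N\<close> nor \<open>T\<close> separates \<open>z\<close> in the
    face from \<open>y\<close> in the middle of \<open>M\<close>: an arc does not separate the
    plane, and off \<open>T\<close> one passes through \<open>F\<close> to \<open>g u\<close> and
    along \<open>M\<close>.\<close>
  have "connected_component (- (N \<union> T)) z y"
  proof (rule Janiszewski)
    show "compact N" using arcN is_arc_topology by blast
    show "closed T" unfolding T_def using K'cl arcR is_arc_topology by blast
    show "connected (N \<inter> T)" unfolding NT by simp
    have "N \<subseteq> K" unfolding KK gim N_def using u1 t by auto
    then have "z \<in> - N" "y \<in> - N" using z FK y by auto
    then show "connected_component (- N) z y"
      using is_arc_topology(4)[OF arcN] unfolding connected_component_def by blast
    have "connected (insert (g u) F)"
      by (rule connected_intermediate_closure[OF Fc]) (use u1 closure_subset in auto)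
    moreover have "connected (g ` {u..(u+t)/2})"
      by (rule connected_continuous_image) (use s0 u1 t in \<open>auto intro: continuous_on_subset[OF cont]\<close>)
    moreover have "g u \<in> insert (g u) F \<inter> g ` {u..(u+t)/2}" using u1 by auto
    ultimately have "connected (insert (g u) F \<union> g ` {u..(u+t)/2})"
      by (intro connected_Un) blast+
    moreover have "insert (g u) F \<union> g ` {u..(u+t)/2} \<subseteq> - T"
    proof -
      have "F \<inter> T = {}" using FK unfolding KK T_def R_def gim using t s0 by auto
      moreover have "g x \<notin> T" if "u \<le> x" "x < t" for x
        unfolding T_def using notK'[of x] notR[of x] that s0 u1 t by auto
      ultimately show ?thesis using u1 by auto
    qed
    moreover have "y \<in> g ` {u..(u+t)/2}" unfolding y_def using u1 by auto
    ultimately show "connected_component (- T) z y" using z unfolding connected_component_def by blast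
  qed
  then obtain C where C: "connected C" "C \<subseteq> - (N \<union> T)" "z \<in> C" "y \<in> C" unfolding connected_component_def by blast
  \<comment> \<open>To leave \<open>F\<close>, the set \<open>C\<close> would have to cross a
    frontier point on \<open>K\<close>; only points of \<open>M\<close> are left, and they are not
    in \<open>closure F\<close>.\<close>
  have "C \<subseteq> F \<union> - closure F"
  proof
    fix x assume x: "x \<in> C"
    show "x \<in> F \<union> - closure F"
    proof (rule ccontr)
      assume "x \<notin> F \<union> - closure F"
      then have "x \<in> frontier F" by (simp add: Fo frontier_def interior_open)
      then have "x \<in> K" using frontier_of_components_closed_complement[OF K_closed F] by auto
      then have "x \<in> A e" using x C unfolding KK T_def by auto
      then obtain h where h: "h \<in> {0..1}" "x = g h" unfolding gim by auto
      have "u < h" "h < t" using h x C unfolding N_def T_def R_def by force+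
      then show False using after[of h] h \<open>x \<notin> F \<union> - closure F\<close> by auto
    qed
  qed
  moreover have "open (- closure F)" by auto
  ultimately show False
    using connectedD[OF C(1) Fo, of "- closure F"] C z y closure_subset[of F] by blast
qed

end

text \<open>Near each vertex the drawing consists of radii only. This gives the edges at a vertex
  angles, and it makes every vertex on the boundary of a face accessible by a segment.\<close>

locale spoked_graph = plane_graph +
  fixes r :: real
  assumes r: "0 < r"
    and discs: "v \<in> V \<Longrightarrow> w \<in> V \<Longrightarrow> v \<noteq> w \<Longrightarrow> cball v r \<inter> cball w r = {}"
    and far: "e \<in> E \<Longrightarrow> v \<in> V \<Longrightarrow> v \<notin> e \<Longrightarrow> A e \<inter> cball v r = {}"
    and spoke: "e \<in> E \<Longrightarrow> v \<in> e \<Longrightarrow> \<exists>c. dist v c = r \<and> A e \<inter> cball v r = closed_segment v c"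

text \<open>The hit lies on the circle of radius \<open>r\<close>, because it is a limit of points
  outside the disc.\<close>

lemma first_hit_cball:
  fixes a b :: complex
  assumes "is_arc S b a" "b \<notin> cball a r" "0 < r"
  obtains P c where "is_arc P b c" "P \<subseteq> S" "P \<inter> cball a r = {c}" "dist a c = r"
proof -
  have "a \<in> cball a r" using assms(3) by simp
  then obtain P c where P: "is_arc P b c" "P \<subseteq> S" "P \<inter> cball a r = {c}"
    by (rule is_arc_first_hit[OF assms(1) closed_cball assms(2)])
  have "P - {b, c} \<subseteq> - cball a r" using P(3) by blast
  then have "P - {b, c} \<subseteq> - ball a r" using ball_subset_cball by blast
  then have "closure (P - {b, c}) \<subseteq> - ball a r" by (rule closure_minimal) auto
  moreover have "c \<in> closure (P - {b, c})"
    using is_arc_interior(3)[OF P(1)] is_arc_ends[OF P(1)] by (simp add: subsetD)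
  ultimately have "c \<in> - ball a r" by (rule subsetD)
  moreover have "c \<in> cball a r" using P(3) by blast
  ultimately have "dist a c = r" by simp
  then show ?thesis using that P by simp
qed

text \<open>An arc may enter a disc several times. Walk from \<open>b\<close> to the first point on
  the disc of \<open>a\<close>, then back from there to the first point on the disc of
  \<open>b\<close>: the piece in between meets both discs only in its ends, and two radii complete
  it.\<close>

lemma straighten_arc:
  fixes a b :: complex
  assumes S: "is_arc S a b" and r: "0 < r" and d: "cball a r \<inter> cball b r = {}"
  obtains S' ca cb where "is_arc S' a b" "ca \<in> S" "cb \<in> S" "dist a ca = r" "dist b cb = r"
    "S' \<inter> cball a r = closed_segment a ca" "S' \<inter> cball b r = closed_segment b cb"
    "S' \<subseteq> S \<union> cball a r \<union> cball b r"
proof -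
  have "b \<in> cball b r" using r by simp
  then have "b \<notin> cball a r" using d by blast
  then obtain P c where P: "is_arc P b c" "P \<subseteq> S" "P \<inter> cball a r = {c}" "dist a c = r"
    by (rule first_hit_cball[OF is_arc_sym[OF S] _ r])
  have "c \<notin> cball b r" using P(3) d by blast
  then obtain Q e where Q: "is_arc Q c e" "Q \<subseteq> P" "Q \<inter> cball b r = {e}" "dist b e = r"
    by (rule first_hit_cball[OF is_arc_sym[OF P(1)] _ r])
  have ce: "c \<in> Q" "e \<in> Q" using is_arc_ends[OF Q(1)] by blast+
  have Qa: "Q \<inter> cball a r = {c}" using P(3) Q(2) ce(1) by blast
  define X where "X = closed_segment a c"
  define Y where "Y = closed_segment b e"
  have "a \<in> cball a r" "c \<in> cball a r" "b \<in> cball b r" "e \<in> cball b r" using P(4) Q(4) r by simp_all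
  then have seg: "X \<subseteq> cball a r" "Y \<subseteq> cball b r" unfolding X_def Y_def
    by (simp_all only: closed_segment_subset convex_cball)
  have ends: "c \<in> X" "e \<in> Y" unfolding X_def Y_def by simp_all
  have ne: "a \<noteq> c" "b \<noteq> e" using P(4) Q(4) r by auto
  have XQ: "X \<inter> Q = {c}" using Qa seg(1) ends(1) by blast
  have YQ: "(X \<union> Q) \<inter> Y = {e}" using Q(3) seg ends(2) d by blast
  have arc1: "is_arc (X \<union> Q) a e"
    unfolding X_def by (rule is_arc_join[OF is_arc_segment[OF ne(1)] Q(1) XQ[unfolded X_def]])
  have arc2: "is_arc ((X \<union> Q) \<union> Y) a b"
    unfolding Y_def by (rule is_arc_join[OF arc1 is_arc_sym[OF is_arc_segment[OF ne(2)]] YQ[unfolded Y_def]])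
  have Xa: "X \<inter> cball a r = X" "Y \<inter> cball b r = Y" using seg by (simp_all add: Int_absorb2)
  have Xb: "Y \<inter> cball a r = {}" "X \<inter> cball b r = {}" using seg d by blast+
  show ?thesis
  proof (rule that[OF arc2])
    show "(X \<union> Q \<union> Y) \<inter> cball a r = closed_segment a c"
      unfolding X_def[symmetric] Int_Un_distrib2 Xa Xb Qa using ends by (simp add: insert_absorb)
    show "(X \<union> Q \<union> Y) \<inter> cball b r = closed_segment b e"
      unfolding Y_def[symmetric] Int_Un_distrib2 Xa Xb Q(3) using ends by (simp add: insert_absorb)
    show "X \<union> Q \<union> Y \<subseteq> S \<union> cball a r \<union> cball b r"
      using seg P(2) Q(2) by blast
    show "c \<in> S" "e \<in> S" using ce P(2) Q(2) by blast+
  qed (fact P(4) Q(4))+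
qed

lemma radii_meet:
  fixes v :: complex
  assumes "dist v c = r" "dist v d = r" "0 < r" "x \<in> closed_segment v c" "x \<in> closed_segment v d" "x \<noteq> v"
  shows "c = d"
proof -
  obtain s t where s: "x = (1 - s) *\<^sub>R v + s *\<^sub>R c" "0 \<le> s" and t: "x = (1 - t) *\<^sub>R v + t *\<^sub>R d" "0 \<le> t"
    using assms(4,5) unfolding closed_segment_def by blast
  have xs: "x - v = s *\<^sub>R (c - v)" unfolding s(1) by (simp add: algebra_simps)
  have xt: "x - v = t *\<^sub>R (d - v)" unfolding t(1) by (simp add: algebra_simps)
  have "norm (x - v) = s * r"
    unfolding xs norm_scaleR using s(2) assms(1) by (simp add: dist_norm norm_minus_commute)
  moreover have "norm (x - v) = t * r"
    unfolding xt norm_scaleR using t(2) assms(2) by (simp add: dist_norm norm_minus_commute)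
  ultimately have "s * r = t * r" by metis
  then have "s = t" using assms(3) by simp
  moreover have "s \<noteq> 0" using xs assms(6) by auto
  moreover have "s *\<^sub>R (c - v) = s *\<^sub>R (d - v)" using xs xt \<open>s = t\<close> by metis
  ultimately have "c - v = d - v" using scaleR_cancel_left by metis
  then show ?thesis by simp
qed

text \<open>For small \<open>r\<close> each arc can be straightened by itself. Outside the discs no
  arc gains points. In the disc of \<open>v\<close> two straightened arcs are radii to points of the
  old arcs, and these points differ since old arcs share only vertices.\<close>

lemma (in plane_graph) spoked:
  obtains A' r where "spoked_graph V E A' r"
proof -
  have ev: "\<forall>\<^sub>F r in at_right 0. (\<forall>v\<in>V. \<forall>w\<in>V. v \<noteq> w \<longrightarrow> cball v r \<inter> cball w r = {}) \<and>
      (\<forall>e\<in>E. \<forall>v\<in>V. v \<notin> e \<longrightarrow> A e \<inter> cball v r = {}) \<and> 0 < r"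
  proof (intro eventually_conj eventually_ball_finite ballI fin fin_E)
    fix v w assume "v \<in> V" "w \<in> V"
    show "\<forall>\<^sub>F r in at_right 0. v \<noteq> w \<longrightarrow> cball v r \<inter> cball w r = {}"
    proof (cases "v = w")
      case False
      have "cball v r \<inter> cball w r = {}" if "r < dist v w / 2" for r
      proof (rule ccontr)
        assume "cball v r \<inter> cball w r \<noteq> {}"
        then obtain x where "dist v x \<le> r" "dist w x \<le> r" by auto
        then show False using that dist_triangle2[of v w x] by auto
      qed
      moreover have "\<forall>\<^sub>F r in at_right 0. r < dist v w / 2" using False by (intro eventually_at_rightI[of 0 "dist v w / 2"]) auto
      ultimately show ?thesis by (metis (mono_tags, lifting) eventually_mono)
    qed simp
  next
    fix e v assume e: "e \<in> E" "v \<in> V"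
    show "\<forall>\<^sub>F r in at_right 0. v \<notin> e \<longrightarrow> A e \<inter> cball v r = {}"
    proof (cases "v \<in> e")
      case False
      then have "v \<in> - A e" using vert[OF e(1)] e by auto
      moreover have "open (- A e)" using arc_closed[OF e(1)] by auto
      ultimately obtain d where d: "0 < d" "ball v d \<subseteq> - A e" using openE by metis
      have "A e \<inter> cball v r = {}" if "r < d" for r
        using d(2) that by force
      moreover have "\<forall>\<^sub>F r in at_right 0. r < d" using d by (intro eventually_at_rightI[of 0 d]) auto
      ultimately show ?thesis by (metis (mono_tags, lifting) eventually_mono)
    qed simp
  next
    show "\<forall>\<^sub>F r in at_right 0. (0::real) < r" by (rule eventually_at_right_less)
  qed
  obtain r where rr: "\<forall>v\<in>V. \<forall>w\<in>V. v \<noteq> w \<longrightarrow> cball v r \<inter> cball w r = {}"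
     "\<forall>e\<in>E. \<forall>v\<in>V. v \<notin> e \<longrightarrow> A e \<inter> cball v r = {}" "0 < r"
    using eventually_happens'[OF trivial_limit_at_right_real ev] by metis
  have "\<exists>S. (\<exists>a b. e = {a, b} \<and> a \<in> V \<and> b \<in> V \<and> is_arc S a b) \<and> S \<subseteq> A e \<union> (\<Union>v\<in>e. cball v r) \<and>
     (\<forall>v\<in>e. \<exists>c\<in>A e. dist v c = r \<and> S \<inter> cball v r = closed_segment v c)" if e: "e \<in> E" for e
  proof -
    obtain a b where ab: "e = {a, b}" "a \<in> V" "b \<in> V" "is_arc (A e) a b" using edge[OF e] by auto
    have dj: "cball a r \<inter> cball b r = {}" using rr(1) ab(2,3) is_arc_ends[OF ab(4)] by metis
    obtain S' ca cb where S': "is_arc S' a b" "ca \<in> A e" "cb \<in> A e" "dist a ca = r" "dist b cb = r"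
      "S' \<inter> cball a r = closed_segment a ca" "S' \<inter> cball b r = closed_segment b cb"
      "S' \<subseteq> A e \<union> cball a r \<union> cball b r"
      by (rule straighten_arc[OF ab(4) rr(3) dj])
    have "\<exists>a b. e = {a, b} \<and> a \<in> V \<and> b \<in> V \<and> is_arc S' a b" using ab S'(1) by metis
    moreover have "S' \<subseteq> A e \<union> (\<Union>v\<in>e. cball v r)" using S'(8) unfolding ab(1) by (simp add: Un_assoc)
    moreover have "\<forall>v\<in>e. \<exists>c\<in>A e. dist v c = r \<and> S' \<inter> cball v r = closed_segment v c"
      using S'(2-7) ab(1) by (metis empty_iff insert_iff)
    ultimately show ?thesis by metis
  qed
  then obtain A' where A': "\<And>e. e \<in> E \<Longrightarrow> \<exists>a b. e = {a, b} \<and> a \<in> V \<and> b \<in> V \<and> is_arc (A' e) a b"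
    "\<And>e. e \<in> E \<Longrightarrow> A' e \<subseteq> A e \<union> (\<Union>v\<in>e. cball v r)"
    "\<And>e v. e \<in> E \<Longrightarrow> v \<in> e \<Longrightarrow> \<exists>c\<in>A e. dist v c = r \<and> A' e \<inter> cball v r = closed_segment v c"
    by metis
  have same: "x = v" if xv: "x \<in> V" "v \<in> V" "x \<in> cball v r" for x v
  proof (rule ccontr)
    assume "x \<noteq> v"
    then have "cball x r \<inter> cball v r = {}" using rr(1) xv(1,2) by metis
    moreover have "x \<in> cball x r" using rr(3) by simp
    ultimately show False using xv(3) by (metis IntI emptyE)
  qed
  have A'D: "x \<in> A e \<or> (\<exists>v\<in>e. x \<in> cball v r)" if "e \<in> E" "x \<in> A' e" for e x
    using A'(2)[OF that(1)] that(2) by (metis (no_types, lifting) UN_E UnE subsetD)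
  have far: "A' e \<inter> cball v r = {}" if e: "e \<in> E" "v \<in> V" "v \<notin> e" for e v
  proof -
    have False if x: "x \<in> A' e" "x \<in> cball v r" for x
    proof -
      consider "x \<in> A e" | w where "w \<in> e" "x \<in> cball w r" using A'D[OF e(1) x(1)] by metis
      then show False
      proof cases
        case 1
        then show False using rr(2) e x(2) by (metis IntI emptyE)
      next
        case 2
        then have "w \<in> V" "w \<noteq> v" using edge_sub[OF e(1)] e(3) by (auto simp del: mem_cball)
        then show False using rr(1) e(2) 2(2) x(2) by (metis IntI emptyE)
      qed
    qed
    then show ?thesis by (metis IntE equals0I)
  qed
  have e_in: "e \<subseteq> A' e" if "e \<in> E" for e
  proof -
    obtain a b where "e = {a, b}" "is_arc (A' e) a b" using A'(1)[OF \<open>e \<in> E\<close>] by metis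
    then show ?thesis using is_arc_ends by (metis empty_subsetI insert_subset)
  qed
  have "spoked_graph V E A' r"
  proof
    show "finite V" by (rule fin)
    show "A' e \<inter> V = e" if e: "e \<in> E" for e
    proof
      show "A' e \<inter> V \<subseteq> e"
      proof
        fix x assume x: "x \<in> A' e \<inter> V"
        then consider "x \<in> A e" | w where "w \<in> e" "x \<in> cball w r" using A'D[OF e] by (metis IntD1)
        then show "x \<in> e"
        proof cases
          case 1
          then show ?thesis using vert[OF e] x by (metis IntI IntD2)
        next
          case 2
          then show ?thesis using same x edge_sub[OF e] by (metis IntD2 subsetD)
        qed
      qed
      show "e \<subseteq> A' e \<inter> V" using e_in[OF e] edge_sub[OF e] by (rule Int_greatest)
    qed
    show "A' e \<inter> A' f = e \<inter> f" if e: "e \<in> E" and f: "f \<in> E" and "e \<noteq> f" for e f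
    proof
      show "e \<inter> f \<subseteq> A' e \<inter> A' f" using e_in[OF e] e_in[OF f] by (rule Int_mono)
      show "A' e \<inter> A' f \<subseteq> e \<inter> f"
      proof
        fix x assume "x \<in> A' e \<inter> A' f"
        then have x: "x \<in> A' e" "x \<in> A' f" by (rule IntD1, elim IntD2)
        show "x \<in> e \<inter> f"
        proof (cases "\<exists>v\<in>V. x \<in> cball v r")
          case True
          then obtain v where v: "v \<in> V" "x \<in> cball v r" by metis
          then have ve: "v \<in> e" "v \<in> f" using far[OF e] far[OF f] x by (metis IntI emptyE)+
          obtain c where c: "c \<in> A e" "dist v c = r" "A' e \<inter> cball v r = closed_segment v c"
            using A'(3)[OF e ve(1)] by metis
          obtain d where d: "d \<in> A f" "dist v d = r" "A' f \<inter> cball v r = closed_segment v d"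
            using A'(3)[OF f ve(2)] by metis
          have "c \<noteq> d"
          proof
            assume "c = d"
            then have "c \<in> V" using c(1) d(1) cross[OF e f \<open>e \<noteq> f\<close>] edge_sub[OF e] by (metis IntI IntD1 subsetD)
            moreover have "c \<in> cball v r" using c(2) by simp
            ultimately have "c = v" using same v(1) by metis
            then show False using c(2) rr(3) by simp
          qed
          moreover have "x \<in> closed_segment v c" "x \<in> closed_segment v d"
            using x v(2) c(3) d(3) by (metis IntI)+
          ultimately have "x = v" using radii_meet[OF c(2) d(2) rr(3)] by metis
          then show ?thesis using ve by simp
        next
          case False
          then have "x \<in> A e" "x \<in> A f" using A'D e f x edge_sub[OF e] edge_sub[OF f] by (metis subsetD)+
          then show ?thesis using cross[OF e f \<open>e \<noteq> f\<close>] by (metis IntI)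
        qed
      qed
    qed
    show "\<exists>a b. e = {a, b} \<and> a \<in> V \<and> b \<in> V \<and> is_arc (A' e) a b" if "e \<in> E" for e
      by (rule A'(1)[OF that])
    show "\<exists>c. dist v c = r \<and> A' e \<inter> cball v r = closed_segment v c" if "e \<in> E" "v \<in> e" for e v
      using A'(3)[OF that] by metis
    show "0 < r" by (rule rr(3))
    show "A' e \<inter> cball v r = {}" if "e \<in> E" "v \<in> V" "v \<notin> e" for e v by (rule far[OF that])
    show "cball v r \<inter> cball w r = {}" if "v \<in> V" "w \<in> V" "v \<noteq> w" for v w using rr(1) that by metis
  qed
  then show ?thesis by (rule that)
qed

section \<open>Drawing new edges and vertices in a face\<close>

context spoked_graph
begin

lemma face_props:
  assumes "F \<in> components (- K)"
  shows "open F" "connected F" "path_connected F" "F \<inter> K = {}" "F \<noteq> {}"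
proof -
  show "open F" using assms K_closed open_components by (metis open_Compl)
  show "connected F" using assms in_components_connected by blast
  then show "path_connected F" using \<open>open F\<close> connected_open_path_connected by blast
  show "F \<inter> K = {}" "F \<noteq> {}" using assms in_components_subset in_components_nonempty by blast+
qed

lemma VK: "V \<subseteq> K" unfolding K_def by simp

lemma AK: "e \<in> E \<Longrightarrow> A e \<subseteq> K" unfolding K_def by auto

lemma near_vertex:
  assumes v: "v \<in> V" and x: "x \<in> K" "x \<in> cball v r" "x \<noteq> v"
  obtains e c where "e \<in> E" "v \<in> e" "dist v c = r" "A e \<inter> cball v r = closed_segment v c" "x \<in> closed_segment v c"
proof -
  have "x \<notin> V"
  proof
    assume "x \<in> V"
    then have "cball x r \<inter> cball v r = {}" using discs v x(3) by metis
    moreover have "x \<in> cball x r" using r by simp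
    ultimately show False using x(2) by (metis IntI emptyE)
  qed
  then obtain e where e: "e \<in> E" "x \<in> A e" using x(1) unfolding K_def by (metis UN_E UnE)
  have ve: "v \<in> e" using far[OF e(1) v] e(2) x(2) by (metis IntI emptyE)
  obtain c where "dist v c = r" "A e \<inter> cball v r = closed_segment v c" using spoke[OF e(1) ve] by metis
  then show ?thesis using that e ve x(2) by (metis IntI)
qed

text \<open>Take \<open>z\<close> in \<open>F\<close> inside the disc of \<open>v\<close>. If the
  segment to \<open>v\<close> met the drawing outside \<open>v\<close>, it would run along a spoke,
  and as \<open>z\<close> is closer than \<open>r\<close> to \<open>v\<close>, the point
  \<open>z\<close> would lie on that spoke as well.\<close>

lemma accessible:
  assumes F: "F \<in> components (- K)" and v: "v \<in> V" "v \<in> closure F"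
  obtains z where "z \<in> F" "closed_segment v z \<subseteq> insert v F"
proof -
  have "ball v r \<inter> F \<noteq> {}" using v(2) r by (metis centre_in_ball closure_iff_nhds_not_empty open_ball order_refl Int_commute)
  then obtain z where z: "z \<in> F" "dist v z < r" by (metis IntE ex_in_conv mem_ball)
  have zK: "z \<notin> K" using face_props(4)[OF F] z(1) by (metis IntI emptyE)
  have zv: "z \<noteq> v" using zK VK v by blast
  define D where "D = closed_segment v z - {v}"
  have D_eq: "D = insert z (open_segment v z)" unfolding D_def open_segment_def using zv by auto
  have "open_segment v z \<subseteq> D" "D \<subseteq> closure (open_segment v z)"
    unfolding D_eq using zv closure_open_segment[of v z] segment_open_subset_closed[of v z] by auto
  then have Dc: "connected D" using connected_intermediate_closure[OF convex_connected[OF convex_open_segment]] by metis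
  have DK: "D \<inter> K = {}"
  proof -
    have False if x: "x \<in> closed_segment v z" "x \<noteq> v" "x \<in> K" for x
    proof -
      have "x \<in> cball v r"
      proof -
        have "closed_segment v z \<subseteq> cball v r"
          by (rule closed_segment_subset) (use z r in auto)
        then show ?thesis using x(1) by (metis subsetD)
      qed
      then obtain e c where e: "e \<in> E" "v \<in> e" "dist v c = r" "A e \<inter> cball v r = closed_segment v c" "x \<in> closed_segment v c"
        using near_vertex[OF v(1) x(3) _ x(2)] by metis
      obtain s where s: "x = (1 - s) *\<^sub>R v + s *\<^sub>R z" "0 \<le> s" using x(1) unfolding in_segment by metis
      obtain t where t: "x = (1 - t) *\<^sub>R v + t *\<^sub>R c" "0 \<le> t" "t \<le> 1" using e(5) unfolding in_segment by metis
      have xs: "x - v = s *\<^sub>R (z - v)" unfolding s(1) by (simp add: algebra_simps)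
      have xt: "x - v = t *\<^sub>R (c - v)" unfolding t(1) by (simp add: algebra_simps)
      have "s \<noteq> 0" using xs x(2) by auto
      then have zc: "z - v = (t / s) *\<^sub>R (c - v)" using xs xt by (metis divideR_right divide_inverse_commute scaleR_scaleR)
      have "norm (z - v) = (t / s) * r" unfolding zc norm_scaleR using e(3) s(2) t(2) by (simp add: dist_norm norm_minus_commute)
      then have "(t / s) * r < r" using z(2) by (simp add: dist_norm norm_minus_commute)
      then have "t / s \<le> 1" using r by (metis less_eq_real_def linorder_not_le mult_le_cancel_right1 not_less_iff_gr_or_eq mult_less_cancel_right1)
      moreover have "0 \<le> t / s" using s(2) t(2) by simp
      moreover have "z = (1 - t / s) *\<^sub>R v + (t / s) *\<^sub>R c" using zc by (simp add: algebra_simps)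
      ultimately have "z \<in> closed_segment v c" unfolding in_segment by metis
      then have "z \<in> K" using e(1,4) AK by (metis IntD1 subsetD)
      then show False using zK by simp
    qed
    then show ?thesis unfolding D_def by (metis DiffE IntE equals0I insertI1)
  qed
  have "D \<subseteq> F"
  proof (rule components_maximal[OF F Dc])
    show "D \<subseteq> - K" using DK by blast
    have "z \<in> D" unfolding D_eq by simp
    then show "F \<inter> D \<noteq> {}" using z(1) by blast
  qed
  then show ?thesis using that[OF z(1)] unfolding D_def by blast
qed

lemma face_path:
  assumes F: "F \<in> components (- K)" and a: "a \<in> V" "a \<in> closure F" and m: "m \<in> F"
  obtains g where "path g" "pathstart g = a" "pathfinish g = m" "path_image g \<subseteq> insert a F"
proof -
  obtain z where z: "z \<in> F" "closed_segment a z \<subseteq> insert a F" by (rule accessible[OF F a])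
  obtain h where h: "path h" "path_image h \<subseteq> F" "pathstart h = z" "pathfinish h = m"
    using face_props(3)[OF F] z(1) m unfolding path_connected_def by metis
  show ?thesis
    by (rule that[of "linepath a z +++ h"]) (use z h in \<open>auto simp: path_image_join\<close>)
qed

lemma face_arc:
  assumes F: "F \<in> components (- K)" and a: "a \<in> V" "a \<in> closure F" and b: "b \<in> V" "b \<in> closure F" and "a \<noteq> b"
  obtains S where "is_arc S a b" "S \<subseteq> {a, b} \<union> F" "S \<inter> K = {a, b}"
proof -
  obtain m where m: "m \<in> F" using face_props(5)[OF F] by auto
  obtain g where g: "path g" "pathstart g = a" "pathfinish g = m" "path_image g \<subseteq> insert a F" by (rule face_path[OF F a m])
  obtain h where h: "path h" "pathstart h = b" "pathfinish h = m" "path_image h \<subseteq> insert b F" by (rule face_path[OF F b m])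
  have "path (g +++ reversepath h)" "pathstart (g +++ reversepath h) = a" "pathfinish (g +++ reversepath h) = b"
    using g h by auto
  then obtain S where S: "is_arc S a b" "S \<subseteq> path_image (g +++ reversepath h)"
    by (rule path_contains_is_arc[OF _ _ _ \<open>a \<noteq> b\<close>])
  have "path_image (g +++ reversepath h) = path_image g \<union> path_image h"
    using g h by (simp add: path_image_join)
  then have sub: "S \<subseteq> {a, b} \<union> F" using S(2) g(4) h(4) by blast
  have "a \<in> S" "b \<in> S" using is_arc_ends[OF S(1)] by simp_all
  then have "S \<inter> K = {a, b}" using sub face_props(4)[OF F] VK a(1) b(1) by blast
  then show ?thesis using that S(1) sub by metis
qed

lemma add_edge_in_face:
  assumes F: "F \<in> components (- K)" and a: "a \<in> V" "a \<in> closure F" and b: "b \<in> V" "b \<in> closure F" and "a \<noteq> b"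
  shows "\<exists>A'. plane_graph V (insert {a, b} E) A'"
proof (cases "{a, b} \<in> E")
  case True
  then show ?thesis using plane_graph_axioms by (metis insert_absorb)
next
  case False
  obtain S where "is_arc S a b" "S \<subseteq> {a, b} \<union> F" "S \<inter> K = {a, b}" by (rule face_arc[OF assms])
  then show ?thesis using add_arc[OF False a(1) b(1)] by metis
qed

text \<open>Join \<open>a\<close> and \<open>b\<close> by an arc \<open>S\<close> through the face
  and walk inside the face from \<open>c\<close> until \<open>S\<close> is first met. The meeting
  point becomes \<open>w\<close>; the two halves of \<open>S\<close> and the walk are its three
  edges.\<close>

lemma add_vertex_in_face:
  assumes F: "F \<in> components (- K)" and a: "a \<in> V" "a \<in> closure F" and b: "b \<in> V" "b \<in> closure F"
    and c: "c \<in> V" "c \<in> closure F" and d: "distinct [a, b, c]"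
  shows "\<exists>w A'. w \<notin> V \<and> plane_graph (insert w V) (E \<union> {{w, a}, {w, b}, {w, c}}) A'"
proof -
  have "a \<noteq> b" using d by simp
  then obtain S where S: "is_arc S a b" "S \<subseteq> {a, b} \<union> F" "S \<inter> K = {a, b}" by (rule face_arc[OF F a b])
  obtain m where m: "m \<in> S - {a, b}" using is_arc_interior(2)[OF S(1)] by auto
  then have mF: "m \<in> F" using S(2) by blast
  have cF: "c \<notin> F" and cK: "c \<in> K" using face_props(4)[OF F] VK c(1) by blast+
  have cS: "c \<notin> S" using S(3) cK d by auto
  have "m \<noteq> c" using mF cF by metis
  obtain h where h: "path h" "pathstart h = c" "pathfinish h = m" "path_image h \<subseteq> insert c F" by (rule face_path[OF F c mF])
  obtain R where R: "is_arc R c m" "R \<subseteq> path_image h"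
    by (rule path_contains_is_arc[OF h(1-3)]) (use \<open>m \<noteq> c\<close> in auto)
  have "m \<in> S" using m by simp
  then obtain P w where P: "is_arc P c w" "P \<subseteq> R" "P \<inter> S = {w}"
    by (rule is_arc_first_hit[OF R(1) is_arc_topology(2)[OF S(1)] cS])
  have w: "w \<in> P" "w \<in> S" "w \<noteq> c" using P(3) cS by blast+
  have PF: "P \<subseteq> insert c F" using P(2) R(2) h(4) by (metis subset_trans)
  then have wF: "w \<in> F" using w by (metis insertE subsetD)
  have wK: "w \<notin> K" using face_props(4)[OF F] wF by (metis IntI emptyE)
  have wab: "w \<noteq> a" "w \<noteq> b" using wK VK a(1) b(1) by blast+
  obtain Sa Sb where Sab: "is_arc Sa a w" "is_arc Sb w b" "S = Sa \<union> Sb" "Sa \<inter> Sb = {w}"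
    by (rule is_arc_split[OF S(1) w(2) wab])
  note ends = is_arc_ends[OF Sab(1)] is_arc_ends[OF Sab(2)] is_arc_ends[OF P(1)]
  have wV: "w \<notin> V" using wK VK by blast
  interpret G0: plane_graph "insert w V" E A by (rule add_point[OF wK])
  have K0: "G0.K = insert w K" unfolding G0.K_def K_def by simp
  have "c \<in> P" using ends by simp
  have PK: "P \<inter> K = {c}" using PF face_props(4)[OF F] cK \<open>c \<in> P\<close> by blast
  have ab: "a \<in> K" "b \<in> K" using VK a(1) b(1) by blast+
  have aSb: "a \<notin> Sb" "b \<notin> Sa" using Sab(4) ends wab by (metis IntI singletonD)+
  have "Sa \<inter> K = S \<inter> K \<inter> Sa" unfolding Sab(3) by blast
  then have SaK: "Sa \<inter> K = {a}" unfolding S(3) using aSb ends by simp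
  have "Sb \<inter> K = S \<inter> K \<inter> Sb" unfolding Sab(3) by blast
  then have SbK: "Sb \<inter> K = {b}" unfolding S(3) using aSb ends by simp
  have newE: "{w, x} \<notin> E" for x using wV edge_sub by blast
  have 1: "plane_graph (insert w V) (insert {w, a} E) (A({w, a} := Sa))"
  proof (rule G0.add_arc[OF newE])
    show "is_arc Sa w a" by (rule is_arc_sym[OF Sab(1)])
    show "Sa \<inter> G0.K = {w, a}" unfolding K0 using SaK ends by (simp add: Int_insert_right)
  qed (use a in auto)
  interpret G1: plane_graph "insert w V" "insert {w, a} E" "A({w, a} := Sa)" by (rule 1)
  have K1: "G1.K = insert w K \<union> Sa" unfolding G1.K_def K_def using newE[of a] by (auto split: if_splits)
  have wneq: "{w, b} \<noteq> {w, a}" "{w, c} \<noteq> {w, a}" "{w, c} \<noteq> {w, b}" using d by (auto simp: doubleton_eq_iff)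
  have 2: "plane_graph (insert w V) (insert {w, b} (insert {w, a} E)) (A({w, a} := Sa, {w, b} := Sb))"
  proof (rule G1.add_arc)
    show "{w, b} \<notin> insert {w, a} E" using newE wneq by simp
    show "is_arc Sb w b" by (rule Sab(2))
    have "Sb \<inter> (insert w K \<union> Sa) = insert w (Sb \<inter> K) \<union> (Sa \<inter> Sb)" using ends by blast
    then show "Sb \<inter> G1.K = {w, b}" unfolding K1 SbK Sab(4) by auto
  qed (use b in auto)
  interpret G2: plane_graph "insert w V" "insert {w, b} (insert {w, a} E)" "A({w, a} := Sa, {w, b} := Sb)" by (rule 2)
  have K2: "G2.K = insert w K \<union> Sa \<union> Sb"
    unfolding G2.K_def K_def using newE[of a] newE[of b] wneq by (auto split: if_splits)
  have "\<exists>A'. plane_graph (insert w V) (insert {w, c} (insert {w, b} (insert {w, a} E))) A'"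
  proof (rule exI, rule G2.add_arc)
    show "{w, c} \<notin> insert {w, b} (insert {w, a} E)" using newE wneq by simp
    show "is_arc P w c" by (rule is_arc_sym[OF P(1)])
    have "P \<inter> (insert w K \<union> Sa \<union> Sb) = insert w (P \<inter> K) \<union> (P \<inter> S)" using w(1) unfolding Sab(3) by blast
    then show "P \<inter> G2.K = {w, c}" unfolding K2 PK P(3) by auto
  qed (use c in auto)
  moreover have "insert {w, c} (insert {w, b} (insert {w, a} E)) = E \<union> {{w, a}, {w, b}, {w, c}}" by auto
  ultimately show ?thesis using wV by metis
qed

lemma touches_end:
  assumes F: "F \<in> components (- K)" and e: "e \<in> E" and x: "x \<in> closure F" "x \<in> A e" "x \<notin> e"
  shows "e \<subseteq> closure F"
  using face_touches_whole_edge[OF assms] ends_in_arc[OF e] by (rule subset_trans[rotated])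

text \<open>The segment between nearest points of the two parts of the drawing lies in a face touching both.\<close>

lemma join_components:
  assumes V: "V = V1 \<union> V2" "V1 \<inter> V2 = {}" "V1 \<noteq> {}" "V2 \<noteq> {}" and E: "\<And>e. e \<in> E \<Longrightarrow> e \<subseteq> V1 \<or> e \<subseteq> V2"
  shows "\<exists>a\<in>V1. \<exists>b\<in>V2. \<exists>A'. plane_graph V (insert {a, b} E) A'"
proof -
  define J where "J W = W \<union> (\<Union>e\<in>{e \<in> E. e \<subseteq> W}. A e)" for W
  have Jc: "compact (J W)" if "W \<subseteq> V" for W
  proof -
    have "compact (A e)" if "e \<in> E" for e using edge[OF that] is_arc_topology(1) by metis
    moreover have "finite W" using finite_subset[OF \<open>W \<subseteq> V\<close> fin] .
    ultimately show ?thesis unfolding J_def using fin_E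
      by (intro compact_Un[OF finite_imp_compact compact_UN]) auto
  qed
  have "E = {e \<in> E. e \<subseteq> V1} \<union> {e \<in> E. e \<subseteq> V2}" using E by blast
  then have "(\<Union>e\<in>E. A e) = (\<Union>e\<in>{e \<in> E. e \<subseteq> V1}. A e) \<union> (\<Union>e\<in>{e \<in> E. e \<subseteq> V2}. A e)"
    by (metis UN_Un)
  moreover have "K = (V1 \<union> V2) \<union> (\<Union>e\<in>E. A e)" unfolding K_def using V(1) by (rule arg_cong)
  ultimately have KJ: "K = J V1 \<union> J V2" unfolding J_def by (simp only: Un_ac)
  have dis: "J V1 \<inter> J V2 = {}"
  proof -
    have e0: "\<not> e \<subseteq> {}" if "e \<in> E" for e using edge[OF that] by auto
    have p1: "A e \<inter> V2 = {}" if "e \<in> E" "e \<subseteq> V1" for e using vert[OF that(1)] that(2) V by blast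
    have p2: "A e \<inter> V1 = {}" if "e \<in> E" "e \<subseteq> V2" for e using vert[OF that(1)] that(2) V by blast
    have p3: "A e \<inter> A f = {}" if "e \<in> E" "e \<subseteq> V1" "f \<in> E" "f \<subseteq> V2" for e f
    proof -
      have "e \<inter> f = {}" using that V(2) by blast
      moreover have "e \<noteq> f" using calculation e0[OF that(1)] by auto
      ultimately show ?thesis using cross[OF that(1,3)] by metis
    qed
    have JD: "x \<in> W \<or> (\<exists>e. e \<in> E \<and> e \<subseteq> W \<and> x \<in> A e)" if "x \<in> J W" for x W
      using that unfolding J_def by fast
    have False if "x \<in> J V1" "x \<in> J V2" for x
      using JD[OF that(1)] JD[OF that(2)] p1 p2 p3 V(2) by (metis IntI emptyE)
    then show ?thesis by (metis IntE equals0I)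
  qed
  have Jn: "J V1 \<noteq> {}" "J V2 \<noteq> {}" unfolding J_def using V(3,4) by simp_all
  have sub: "V1 \<subseteq> V" "V2 \<subseteq> V" unfolding V(1) by simp_all
  obtain x y where xy: "x \<in> J V1" "y \<in> J V2" "dist x y = setdist (J V1) (J V2)"
    using setdist_compact_closed[OF Jc[OF sub(1)] compact_imp_closed[OF Jc[OF sub(2)]] Jn] by (elim bexE)
  have "x \<noteq> y" using xy dis by (metis IntI emptyE)
  have seg: "open_segment x y \<subseteq> - K"
  proof
    fix z assume z: "z \<in> open_segment x y"
    have "dist z y < dist x y" "dist x z < dist x y"
      using dist_in_open_segment[OF z] by (metis dist_commute)+
    then have "z \<notin> J V1" "z \<notin> J V2" using setdist_le_dist[of z "J V1" y "J V2"] setdist_le_dist[of x "J V1" z "J V2"] xy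
      by linarith+
    then show "z \<in> - K" unfolding KJ by simp
  qed
  have "open_segment x y \<noteq> {}" using \<open>x \<noteq> y\<close> by simp
  then obtain F where F: "F \<in> components (- K)" "open_segment x y \<subseteq> F"
    using exists_component_superset[OF seg] by (metis ComplI UNIV_I convex_connected[OF convex_open_segment] seg subset_empty)
  have "closure (open_segment x y) = closed_segment x y" using \<open>x \<noteq> y\<close> by simp
  then have cl: "x \<in> closure F" "y \<in> closure F" using closure_mono[OF F(2)] by auto
  have end_in: "\<exists>a\<in>W. a \<in> closure F" if W: "x \<in> J W" "x \<in> closure F" "W \<subseteq> V" for W x
  proof (cases "x \<in> W")
    case False
    then obtain e where e: "e \<in> E" "e \<subseteq> W" "x \<in> A e" using W(1) unfolding J_def by fast
    then have "x \<notin> e" using False by auto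
    then have "e \<subseteq> closure F" using touches_end[OF F(1) e(1) W(2) e(3)] by simp
    then show ?thesis using edge[OF e(1)] e(2) by (metis insertI1 subsetD)
  qed (use W(2) in auto)
  obtain a where a: "a \<in> V1" "a \<in> closure F" using end_in[OF xy(1) cl(1) sub(1)] by (elim bexE)
  obtain b where b: "b \<in> V2" "b \<in> closure F" using end_in[OF xy(2) cl(2) sub(2)] by (elim bexE)
  have "a \<in> V" "b \<in> V" using a(1) b(1) sub by (simp_all add: subsetD)
  moreover have "a \<noteq> b" using a(1) b(1) V(2) by (metis IntI emptyE)
  ultimately have "\<exists>A'. plane_graph V (insert {a, b} E) A'"
    using add_edge_in_face[OF F(1) _ a(2) _ b(2)] by metis
  then show ?thesis using a b by metis
qed

section \<open>The rotation at a vertex\<close>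

text \<open>Sort the neighbours by the angles of their spokes. An open sector between consecutive
  spokes avoids the drawing, so it lies in a face \<open>F\<close>. Its closure contains inner
  points of both spokes, and \<open>touches_end\<close> then brings the neighbours themselves into
  \<open>closure F\<close>.\<close>

lemma rotation:
  assumes v: "v \<in> V"
  shows "\<exists>xs. distinct xs \<and> set xs = {a. {v, a} \<in> E} \<and>
    (\<forall>i<length xs. \<exists>F\<in>components (- K). {v, xs ! i, xs ! (Suc i mod length xs)} \<subseteq> closure F)"
proof -
  define N where "N = {a. {v, a} \<in> E}"
  have "N \<subseteq> V" unfolding N_def using edge_in by auto
  then have finN: "finite N" using fin finite_subset by metis
  have "\<exists>c. dist v c = r \<and> A {v, a} \<inter> cball v r = closed_segment v c" if "a \<in> N" for a
    using spoke[of "{v, a}" v] that unfolding N_def by simp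
  then obtain c where c: "\<And>a. a \<in> N \<Longrightarrow> dist v (c a) = r"
    "\<And>a. a \<in> N \<Longrightarrow> A {v, a} \<inter> cball v r = closed_segment v (c a)" by metis
  define \<theta> where "\<theta> a = Arg2pi (c a - v)" for a
  have th: "0 \<le> \<theta> a" "\<theta> a < 2 * pi" for a unfolding \<theta>_def by (simp_all add: Arg2pi_ge_0 Arg2pi_lt_2pi)
  have ct: "c a = v + of_real r * cis (\<theta> a)" if "a \<in> N" for a
  proof -
    have "norm (c a - v) = r" using c(1)[OF that] by (simp add: dist_norm norm_minus_commute)
    then have "c a - v = of_real r * exp (\<i> * of_real (\<theta> a))" unfolding \<theta>_def using Arg2pi_eq by metis
    then show ?thesis by (simp add: cis_conv_exp algebra_simps)
  qed
  have inj: "inj_on \<theta> N"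
  proof (rule inj_onI)
    fix a b assume ab: "a \<in> N" "b \<in> N" "\<theta> a = \<theta> b"
    then have cc: "c a = c b" using ct by simp
    have "c a \<in> A {v, a}" "c b \<in> A {v, b}" using c(2)[OF ab(1)] c(2)[OF ab(2)] by (metis IntD1 ends_in_segment(2))+
    show "a = b"
    proof (rule ccontr)
      assume "a \<noteq> b"
      then have ne: "{v, a} \<noteq> {v, b}" by (auto simp: doubleton_eq_iff)
      have e: "{v, a} \<in> E" "{v, b} \<in> E" using ab unfolding N_def by auto
      have "c a \<in> {v, a} \<inter> {v, b}" using cross[OF e ne] \<open>c a \<in> A {v, a}\<close> \<open>c b \<in> A {v, b}\<close> cc by (metis IntI)
      then have "c a = v" using \<open>a \<noteq> b\<close> by auto
      then show False using c(1)[OF ab(1)] r by simp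
    qed
  qed
  obtain ys where ys: "set ys = N" "distinct ys" using finite_distinct_list[OF finN] by metis
  define xs where "xs = sort_key \<theta> ys"
  have xs: "set xs = N" "distinct xs" "sorted (map \<theta> xs)" unfolding xs_def using ys by simp_all
  have "distinct (map \<theta> xs)" using xs inj by (simp add: distinct_map)
  then have strict: "\<theta> (xs ! i) < \<theta> (xs ! j)" if "i < j" "j < length xs" for i j
    using sorted_wrt_nth_less[of "(<)" "map \<theta> xs" i j] xs(3) that by (simp add: strict_sorted_iff)
  have mono: "\<theta> (xs ! i) \<le> \<theta> (xs ! j)" if "i \<le> j" "j < length xs" for i j
    using strict[of i j] that by (cases "i = j") auto
  have "\<exists>F\<in>components (- K). {v, xs ! i, xs ! (Suc i mod length xs)} \<subseteq> closure F" if i: "i < length xs" for i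
  proof -
    define n where "n = length xs"
    define \<alpha> where "\<alpha> = \<theta> (xs ! i)"
    define b where "b = xs ! (Suc i mod n)"
    \<comment> \<open>After the last neighbour comes the first one, a full turn further; with a
      single neighbour the sector is a full turn.\<close>
    define \<beta> where "\<beta> = (if Suc i < n then \<theta> b else \<theta> b + 2 * pi)"
    have aN: "xs ! i \<in> N" using i xs(1) nth_mem by metis
    have "0 < n" using i unfolding n_def by linarith
    then have "Suc i mod n < n" by (rule mod_less_divisor)
    then have bN: "b \<in> N" unfolding b_def n_def using xs(1) nth_mem by metis
    have ab: "\<alpha> < \<beta>" "0 \<le> \<alpha>" "\<beta> < 4 * pi"
    proof -
      show "\<alpha> < \<beta>"
      proof (cases "Suc i < n")
        case True
        then show ?thesis using strict[of i "Suc i"] unfolding \<alpha>_def \<beta>_def b_def n_def by simp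
      next
        case False
        then show ?thesis unfolding \<alpha>_def \<beta>_def using th(1)[of b] th(2)[of "xs ! i"] by simp
      qed
      show "0 \<le> \<alpha>" unfolding \<alpha>_def by (rule th)
      show "\<beta> < 4 * pi" unfolding \<beta>_def using th(2)[of b] pi_gt_zero by (cases "Suc i < n"; simp only: if_True if_False; linarith)
    qed
    \<comment> \<open>An angle has many representatives modulo a full turn, but as
      \<open>0 \<le> \<alpha>\<close> and \<open>\<beta> < 4 * pi\<close>, only \<open>k = 0\<close>
      and \<open>k = 1\<close> can fall between \<open>\<alpha>\<close> and
      \<open>\<beta>\<close>.\<close>
    have gap: "\<not> (\<alpha> < \<theta> a + 2 * pi * of_int k \<and> \<theta> a + 2 * pi * of_int k < \<beta>)" if a: "a \<in> N" for a k
    proof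
      assume as: "\<alpha> < \<theta> a + 2 * pi * of_int k \<and> \<theta> a + 2 * pi * of_int k < \<beta>"
      obtain j where j: "j < n" "a = xs ! j" using a xs(1) unfolding n_def by (metis in_set_conv_nth)
      have k: "k = 0 \<or> k = 1"
      proof -
        have "0 < \<theta> a + 2 * pi * of_int k" using as ab by linarith
        then have "0 < 2 * pi * (1 + of_int k)" using th(2)[of a] by (simp add: algebra_simps)
        then have "(0::real) < 1 + of_int k" using pi_gt_zero by (simp add: zero_less_mult_iff)
        moreover have "2 * pi * of_int k < 4 * pi" using as ab(3) th(1)[of a] by linarith
        then have "2 * pi * of_int k < 2 * pi * 2" by linarith
        then have "of_int k < (2::real)" using pi_gt_zero by (simp only: mult_less_cancel_left_pos mult_pos_pos zero_less_numeral)
        ultimately show ?thesis by linarith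
      qed
      show False
      proof (cases "Suc i < n")
        case True
        then have bb: "\<beta> = \<theta> (xs ! Suc i)" unfolding \<beta>_def b_def by simp
        have "k = 0"
        proof (rule ccontr)
          assume "k \<noteq> 0"
          then have "k = 1" using k by simp
          then show False using as th(1)[of a] th(2)[of "xs ! Suc i"] unfolding bb by simp
        qed
        then have "\<alpha> < \<theta> a" "\<theta> a < \<beta>" using as by simp_all
        moreover have "j \<le> i \<or> Suc i \<le> j" by linarith
        ultimately show False using mono[of j i] mono[of "Suc i" j] j True i unfolding bb \<alpha>_def n_def by force
      next
        case False
        then have n: "n = Suc i" using i unfolding n_def by simp
        then have bb: "\<beta> = \<theta> (xs ! 0) + 2 * pi" unfolding \<beta>_def b_def by simp
        from k show False
        proof
          assume "k = 0"
          then have "\<theta> (xs ! i) < \<theta> a" using as unfolding \<alpha>_def by simp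
          then show False using mono[of j i] j n i unfolding n_def by simp
        next
          assume "k = 1"
          then have "\<theta> a < \<theta> (xs ! 0)" using as unfolding bb by simp
          then show False using mono[of 0 j] j unfolding n_def by simp
        qed
      qed
    qed
    define f where "f p = v + of_real (fst p) * cis (snd p)" for p :: "real \<times> real"
    define Q where "Q = f ` ({0<..<r} \<times> {\<alpha><..<\<beta>})"
    have contf: "continuous_on X f" for X unfolding f_def
      by (intro continuous_intros continuous_on_cis)
    have Qc: "connected Q" unfolding Q_def
      by (rule connected_continuous_image[OF contf]) (intro connected_Times convex_connected convex_real_interval)
    have QK: "Q \<subseteq> - K"
    proof
      fix x assume "x \<in> Q"
      then obtain \<rho> \<phi> where x: "x = v + of_real \<rho> * cis \<phi>" "0 < \<rho>" "\<rho> < r" "\<alpha> < \<phi>" "\<phi> < \<beta>"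
        unfolding Q_def f_def by auto
      have nx: "norm (x - v) = \<rho>" unfolding x(1) using x(2) by (simp add: norm_mult)
      show "x \<in> - K"
      proof
        assume "x \<in> K"
        moreover have "x \<in> cball v r" using nx x(3) by (simp add: dist_norm norm_minus_commute)
        moreover have "x \<noteq> v" using nx x(2) by auto
        ultimately obtain e d where e: "e \<in> E" "v \<in> e" "dist v d = r" "A e \<inter> cball v r = closed_segment v d" "x \<in> closed_segment v d"
          using near_vertex[OF v] by metis
        obtain a where a: "e = {v, a}" using edge[OF e(1)] e(2) by auto
        then have aN': "a \<in> N" using e(1) unfolding N_def by simp
        have "x \<in> closed_segment v (c a)" using c(2)[OF aN'] e(4,5) unfolding a by metis
        then obtain s where s: "x = (1 - s) *\<^sub>R v + s *\<^sub>R c a" "0 \<le> s" unfolding in_segment by metis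
        have xs': "x - v = of_real (s * r) * cis (\<theta> a)"
          unfolding s(1) ct[OF aN'] by (simp add: algebra_simps scaleR_conv_of_real)
        then have "norm (x - v) = s * r" using s(2) r by (simp add: norm_mult)
        then have "of_real \<rho> * cis \<phi> = of_real \<rho> * cis (\<theta> a)" using nx xs' x(1) by simp
        then have "cis \<phi> = cis (\<theta> a)" using x(2) by simp
        then have "\<exists>k::int. \<i> * complex_of_real \<phi> = \<i> * complex_of_real (\<theta> a) + (of_int (2 * k) * pi) * \<i>"
          unfolding cis_conv_exp exp_eq .
        then obtain k :: int where "\<i> * complex_of_real \<phi> = \<i> * complex_of_real (\<theta> a) + (of_int (2 * k) * pi) * \<i>" ..
        then have "Im (\<i> * complex_of_real \<phi>) = Im (\<i> * complex_of_real (\<theta> a) + (of_int (2 * k) * pi) * \<i>)" by (rule arg_cong)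
        then have "\<phi> = \<theta> a + 2 * pi * of_int k" by (simp add: algebra_simps)
        then show False using gap[OF aN', of k] x(4,5) by simp
      qed
    qed
    have "f (r/2, (\<alpha> + \<beta>)/2) \<in> Q" unfolding Q_def using r ab by (intro imageI) auto
    then have "Q \<noteq> {}" by auto
    then obtain F where F: "F \<in> components (- K)" "Q \<subseteq> F"
      using exists_component_superset[OF QK _ Qc] QK by (metis subset_empty)
    have clQ: "f (\<rho>, \<phi>) \<in> closure F" if "0 \<le> \<rho>" "\<rho> \<le> r" "\<alpha> \<le> \<phi>" "\<phi> \<le> \<beta>" for \<rho> \<phi>
    proof -
      have "closure ({0<..<r} \<times> {\<alpha><..<\<beta>}) = {0..r} \<times> {\<alpha>..\<beta>}"
        using r ab by (simp add: closure_Times)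
      then have "f ` ({0..r} \<times> {\<alpha>..\<beta>}) \<subseteq> closure Q"
        unfolding Q_def using image_closure_subset[OF contf closed_closure closure_subset] by metis
      moreover have "f (\<rho>, \<phi>) \<in> f ` ({0..r} \<times> {\<alpha>..\<beta>})" using that by (intro imageI) simp
      ultimately show ?thesis using closure_mono[OF F(2)] by (meson subsetD)
    qed
    \<comment> \<open>The midpoint of a spoke is no end of its edge, as \<open>touches_end\<close>
      requires.\<close>
    have end_cl: "{v, a} \<subseteq> closure F" if a: "a \<in> N" and p: "f (r/2, \<theta> a) \<in> closure F" for a
    proof -
      define x where "x = f (r/2, \<theta> a)"
      have aE: "{v, a} \<in> E" using a unfolding N_def by simp
      have "x = (1 - 1/2) *\<^sub>R v + (1/2) *\<^sub>R c a"
        unfolding x_def f_def ct[OF a] by (simp add: scaleR_conv_of_real field_simps)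
      then have xs: "x \<in> closed_segment v (c a)" unfolding in_segment by (intro exI[of _ "1/2"]) simp
      then have xA: "x \<in> A {v, a}" "x \<in> cball v r" using c(2)[OF a] by (metis IntD1 IntD2)+
      have "dist v x = r / 2" unfolding x_def f_def using r by (simp add: dist_norm norm_mult)
      then have xv: "x \<noteq> v" using r by auto
      have "x \<noteq> a"
      proof
        assume "x = a"
        then have "x \<in> V" using edge_in[OF aE] by simp
        then have "cball x r \<inter> cball v r = {}" using discs v xv by metis
        moreover have "x \<in> cball x r" using r by simp
        ultimately show False using xA(2) by (metis IntI emptyE)
      qed
      then have "x \<notin> {v, a}" using xv by simp
      then show ?thesis using touches_end[OF F(1) aE _ xA(1)] p unfolding x_def by simp
    qed
    have "{v, xs ! i} \<subseteq> closure F"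
      by (rule end_cl[OF aN]) (use clQ[of "r/2" \<alpha>] r ab in \<open>simp add: \<alpha>_def\<close>)
    moreover have "f (r/2, \<theta> b) = f (r/2, \<beta>)" unfolding f_def \<beta>_def by (simp add: complex_eq_iff)
    then have "{v, b} \<subseteq> closure F"
      by (intro end_cl[OF bN]) (use clQ[of "r/2" \<beta>] r ab in simp)
    ultimately show ?thesis using F(1) unfolding b_def n_def by auto
  qed
  then show ?thesis using xs unfolding N_def by metis
qed

end

section \<open>Abstract planar graphs\<close>

definition sgraph :: "'a set \<Rightarrow> 'a set set \<Rightarrow> bool" where
  "sgraph V E \<longleftrightarrow> finite V \<and> (\<forall>e\<in>E. \<exists>a b. e = {a, b} \<and> a \<in> V \<and> b \<in> V \<and> a \<noteq> b)"

definition drawable :: "'a set \<Rightarrow> 'a set set \<Rightarrow> bool" where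
  "drawable V E \<longleftrightarrow> (\<exists>p A. inj_on p V \<and> plane_graph (p ` V) ((`) p ` E) A)"

definition nb :: "'a set set \<Rightarrow> 'a \<Rightarrow> 'a set" where
  "nb E v = {a. {v, a} \<in> E}"

definition stack :: "'a set set \<Rightarrow> 'a \<Rightarrow> 'a \<Rightarrow> 'a \<Rightarrow> 'a \<Rightarrow> 'a set set" where
  "stack E w a b c = E \<union> {{w, a}, {w, b}, {w, c}}"

lemma sgraph_edge: "sgraph V E \<Longrightarrow> {a, b} \<in> E \<Longrightarrow> a \<in> V \<and> b \<in> V \<and> a \<noteq> b"
  unfolding sgraph_def by (metis doubleton_eq_iff)

lemma sgraph_sub: "sgraph V E \<Longrightarrow> e \<in> E \<Longrightarrow> e \<subseteq> V"
  unfolding sgraph_def by auto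

lemma nb_sub: "sgraph V E \<Longrightarrow> nb E v \<subseteq> V - {v}"
  unfolding nb_def using sgraph_edge by fastforce

lemma finite_nb: "sgraph V E \<Longrightarrow> finite (nb E v)"
  using nb_sub unfolding sgraph_def by (metis finite_Diff finite_subset)

lemma sgraph_insert: "sgraph V E \<Longrightarrow> a \<in> V \<Longrightarrow> b \<in> V \<Longrightarrow> a \<noteq> b \<Longrightarrow> sgraph V (insert {a, b} E)"
  unfolding sgraph_def by auto

lemma sgraph_stack:
  "sgraph V E \<Longrightarrow> w \<notin> V \<Longrightarrow> a \<in> V \<Longrightarrow> b \<in> V \<Longrightarrow> c \<in> V \<Longrightarrow> sgraph (insert w V) (stack E w a b c)"
  unfolding sgraph_def stack_def by fastforce

lemma image_edge_iff:
  assumes "sgraph V E" "inj_on p V" "a \<in> V" "b \<in> V"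
  shows "{p a, p b} \<in> (`) p ` E \<longleftrightarrow> {a, b} \<in> E"
proof
  assume "{p a, p b} \<in> (`) p ` E"
  then obtain e where e: "e \<in> E" "p ` {a, b} = p ` e" by auto
  then have "{a, b} = e" using inj_on_image_eq_iff[OF assms(2)] sgraph_sub[OF assms(1)] assms(3,4)
    by (metis empty_subsetI insert_subset)
  then show "{a, b} \<in> E" using e by simp
next
  assume "{a, b} \<in> E"
  then have "p ` {a, b} \<in> (`) p ` E" by (rule imageI)
  then show "{p a, p b} \<in> (`) p ` E" by simp
qed

lemma drawable_mono:
  assumes "drawable V E" "V' \<subseteq> V" "E' \<subseteq> E" "\<And>e. e \<in> E' \<Longrightarrow> e \<subseteq> V'"
  shows "drawable V' E'"
proof -
  obtain p A where p: "inj_on p V" "plane_graph (p ` V) ((`) p ` E) A" using assms(1) unfolding drawable_def by metis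
  have "plane_graph (p ` V') ((`) p ` E') A"
  proof (rule plane_graph.subgraph_plane[OF p(2)])
    show "p ` V' \<subseteq> p ` V" "(`) p ` E' \<subseteq> (`) p ` E" using assms(2,3) by (simp_all add: image_mono)
    show "e \<subseteq> p ` V'" if "e \<in> (`) p ` E'" for e using that assms(4) by (metis imageE image_mono)
  qed
  then show ?thesis unfolding drawable_def using inj_on_subset[OF p(1) assms(2)] by metis
qed

lemma drawable_suppress:
  assumes "sgraph V E" "drawable V E" "{p, a} \<in> E" "{p, b} \<in> E" "a \<noteq> b"
  shows "drawable (V - {p}) (insert {a, b} {e \<in> E. p \<notin> e})"
proof -
  obtain f A where f: "inj_on f V" "plane_graph (f ` V) ((`) f ` E) A" using assms(2) unfolding drawable_def by metis
  have V: "p \<in> V" "a \<in> V" "b \<in> V" using sgraph_edge[OF assms(1)] assms(3,4) by metis+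
  have im: "{f p, f a} \<in> (`) f ` E" "{f p, f b} \<in> (`) f ` E" using image_edge_iff[OF assms(1) f(1)] V assms(3,4) by simp_all
  have "f a \<noteq> f b" using f(1) V assms(5) by (simp add: inj_on_eq_iff)
  from plane_graph.suppress[OF f(2) im this]
  obtain A' where A': "plane_graph (f ` V - {f p}) (insert {f a, f b} {e \<in> (`) f ` E. f p \<notin> e}) A'" ..
  have 1: "f ` V - {f p} = f ` (V - {p})" using inj_on_image_set_diff[OF f(1), of V "{p}"] V(1) by simp
  have "f p \<in> f ` e \<longleftrightarrow> p \<in> e" if "e \<in> E" for e
    using inj_on_image_mem_iff[OF f(1) V(1) sgraph_sub[OF assms(1) that]] .
  then have 2: "{e \<in> (`) f ` E. f p \<notin> e} = (`) f ` {e \<in> E. p \<notin> e}" by auto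
  have "plane_graph (f ` (V - {p})) ((`) f ` insert {a, b} {e \<in> E. p \<notin> e}) A'" using A' unfolding 1 2 by simp
  moreover have "inj_on f (V - {p})" using f(1) by (rule inj_on_subset) auto
  ultimately show ?thesis unfolding drawable_def by (intro exI conjI)
qed

lemma drawable_no_K5:
  assumes "sgraph V E" "drawable V E" and d: "distinct [a, b, z, s, w]"
    and e: "{a, b} \<in> E" "{a, z} \<in> E" "{z, b} \<in> E" "{a, s} \<in> E" "{s, b} \<in> E"
    "{z, s} \<in> E" "{w, a} \<in> E" "{w, b} \<in> E" "{w, z} \<in> E" "{w, s} \<in> E"
  shows False
proof -
  obtain f A where f: "inj_on f V" "plane_graph (f ` V) ((`) f ` E) A" using assms(2) unfolding drawable_def by metis
  have im: "{f x, f y} \<in> (`) f ` E" if "{x, y} \<in> E" for x y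
    using image_edge_iff[OF assms(1) f(1)] sgraph_edge[OF assms(1) that] that by simp
  have "a \<in> V" "b \<in> V" "z \<in> V" "s \<in> V" "w \<in> V" using sgraph_edge[OF assms(1)] e by metis+
  then have "distinct [f a, f b, f z, f s, f w]" using d f(1) by (auto simp: inj_on_eq_iff)
  then show False by (rule plane_graph.no_K5[OF f(2) _ e[THEN im]])
qed

text \<open>The ends \<open>v\<close>, \<open>a\<close>, \<open>b\<close> of a corner lie on a common face in some drawing.\<close>

definition corner :: "'a set \<Rightarrow> 'a set set \<Rightarrow> 'a \<Rightarrow> 'a \<Rightarrow> 'a \<Rightarrow> bool" where
  "corner V E v a b \<longleftrightarrow> a \<noteq> b \<and> drawable V (insert {a, b} E) \<and> (\<forall>w. w \<notin> V \<longrightarrow> drawable (insert w V) (stack E w v a b))"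

lemma drawable_new_vertex:
  assumes "sgraph V E" "inj_on p V" "w \<notin> V" "v \<in> V" "a \<in> V" "b \<in> V" "w' \<notin> p ` V"
    and "plane_graph (insert w' (p ` V)) ((`) p ` E \<union> {{w', p v}, {w', p a}, {w', p b}}) A"
  shows "drawable (insert w V) (stack E w v a b)"
proof -
  define q where "q = p(w := w')"
  have qp: "q x = p x" if "x \<in> V" for x using that assms(3) unfolding q_def by auto
  have inj: "inj_on q (insert w V)"
    unfolding q_def using assms(2,3,7) by (auto simp: inj_on_def)
  have "q ` V = p ` V" by (rule image_cong[OF refl qp])
  have qw: "q w = w'" by (simp add: q_def)
  have "q ` insert w V = insert w' (p ` V)" unfolding image_insert qw \<open>q ` V = p ` V\<close> ..
  moreover have "q ` e = p ` e" if "e \<in> E" for e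
    using sgraph_sub[OF assms(1) that] qp by (intro image_cong) auto
  then have "(`) q ` E = (`) p ` E" by (rule image_cong[OF refl])
  then have "(`) q ` stack E w v a b = (`) p ` E \<union> {{w', p v}, {w', p a}, {w', p b}}"
    unfolding stack_def image_Un by (simp add: qp assms(4-6) qw)
  ultimately have "plane_graph (q ` insert w V) ((`) q ` stack E w v a b) A" using assms(8) by simp
  then show ?thesis unfolding drawable_def using inj by (intro exI conjI)
qed

text \<open>The inequality excludes a vertex with a single neighbour, which is its own successor in
  the cyclic order.\<close>

lemma drawable_rotation:
  assumes sg: "sgraph V E" and dr: "drawable V E" and v: "v \<in> V"
  obtains xs where "distinct xs" "set xs = nb E v"
    "\<forall>i<length xs. xs ! i \<noteq> xs ! (Suc i mod length xs) \<longrightarrow> corner V E v (xs ! i) (xs ! (Suc i mod length xs))"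
proof -
  obtain p A0 where p: "inj_on p V" "plane_graph (p ` V) ((`) p ` E) A0" using dr unfolding drawable_def by metis
  obtain A r where "spoked_graph (p ` V) ((`) p ` E) A r" by (rule plane_graph.spoked[OF p(2)])
  then interpret spoked_graph "p ` V" "(`) p ` E" A r .
  obtain ys where ys: "distinct ys" "set ys = {c. {p v, c} \<in> (`) p ` E}"
    "\<And>i. i < length ys \<Longrightarrow> \<exists>F\<in>components (- K). {p v, ys ! i, ys ! (Suc i mod length ys)} \<subseteq> closure F"
    using rotation[of "p v"] v by blast
  define q where "q = the_inv_into V p"
  have qp: "q (p x) = x" if "x \<in> V" for x unfolding q_def using the_inv_into_f_f[OF p(1) that] .
  have sub: "set ys \<subseteq> p ` V" unfolding ys(2) using edge_in by blast
  have pq: "p (q c) = c" "q c \<in> V" if "c \<in> set ys" for c using that sub qp by auto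
  define xs where "xs = map q ys"
  have "inj_on q (set ys)" using pq by (metis inj_onI)
  then have dx: "distinct xs" unfolding xs_def using ys(1) by (simp add: distinct_map)
  have sx: "set xs = nb E v"
  proof -
    have "x \<in> nb E v \<longleftrightarrow> x \<in> V \<and> p x \<in> set ys" for x
      unfolding nb_def ys(2) using image_edge_iff[OF sg p(1) v] sgraph_edge[OF sg, of v x] by auto
    moreover have "x \<in> set xs \<longleftrightarrow> x \<in> V \<and> p x \<in> set ys" for x
      unfolding xs_def using pq qp by (auto simp: image_iff) metis
    ultimately show ?thesis by blast
  qed
  have "corner V E v (xs ! i) (xs ! (Suc i mod length xs))"
    if i: "i < length xs" and ne: "xs ! i \<noteq> xs ! (Suc i mod length xs)" for i
  proof -
    define a where "a = xs ! i"
    define b where "b = xs ! (Suc i mod length xs)"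
    have len: "length xs = length ys" unfolding xs_def by simp
    have "0 < length ys" using i len by linarith
    then have i2: "Suc i mod length ys < length ys" by (rule mod_less_divisor)
    have ia: "a = q (ys ! i)" "b = q (ys ! (Suc i mod length ys))"
      unfolding a_def b_def len using i i2 unfolding xs_def by simp_all
    have "ys ! i \<in> set ys" "ys ! (Suc i mod length ys) \<in> set ys" using i i2 len by simp_all
    then have pa: "p a = ys ! i" "p b = ys ! (Suc i mod length ys)" "a \<in> V" "b \<in> V" unfolding ia using pq by simp_all
    obtain F where F: "F \<in> components (- K)" "{p v, p a, p b} \<subseteq> closure F"
      using ys(3)[OF i[unfolded len]] unfolding pa(1,2) by (elim bexE)
    have "a \<in> nb E v" "b \<in> nb E v" using i i2 unfolding a_def b_def sx[symmetric] len by (simp_all add: len)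
    then have va: "v \<noteq> a" "v \<noteq> b" using nb_sub[OF sg] by (metis Diff_iff insertI1 subsetD)+
    have ab: "a \<noteq> b" using ne unfolding a_def b_def .
    then have d: "distinct [p v, p a, p b]" using inj_on_eq_iff[OF p(1)] v pa(3,4) va by simp
    have im: "p a \<in> p ` V" "p b \<in> p ` V" "p v \<in> p ` V" using pa(3,4) v by simp_all
    have cl: "p a \<in> closure F" "p b \<in> closure F" "p v \<in> closure F" using F(2) by simp_all
    have pab: "p a \<noteq> p b" using d by simp
    have "\<exists>A'. plane_graph (p ` V) (insert {p a, p b} ((`) p ` E)) A'"
      by (rule add_edge_in_face[OF F(1) im(1) cl(1) im(2) cl(2) pab])
    then obtain A' where "plane_graph (p ` V) ((`) p ` insert {a, b} E) A'" by auto
    then have "drawable V (insert {a, b} E)" unfolding drawable_def using p(1) by (intro exI conjI)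
    moreover have "drawable (insert w V) (stack E w v a b)" if w: "w \<notin> V" for w
    proof -
      have "\<exists>w' A'. w' \<notin> p ` V \<and> plane_graph (insert w' (p ` V)) ((`) p ` E \<union> {{w', p v}, {w', p a}, {w', p b}}) A'"
        by (rule add_vertex_in_face[OF F(1) im(3) cl(3) im(1) cl(1) im(2) cl(2) d])
      then show ?thesis by (elim exE conjE) (rule drawable_new_vertex[OF sg p(1) w v pa(3,4)])
    qed
    ultimately show ?thesis using ne unfolding corner_def a_def b_def by simp
  qed
  then show ?thesis by (intro that[OF dx sx] allI impI)
qed

text \<open>The cyclic order is unrolled at a chosen neighbour \<open>a\<close> and closed by
  repeating \<open>a\<close>. Thus the two corners beside the edge \<open>va\<close> are found at
  the head and at the last entry of \<open>ys\<close>.\<close>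

lemma drawable_rotation_from:
  assumes sg: "sgraph V E" and dr: "drawable V E" and v: "v \<in> V" and a: "a \<in> nb E v" and n: "2 \<le> card (nb E v)"
  obtains ys where "distinct (a # ys)" "set (a # ys) = nb E v" "successively (corner V E v) (a # ys @ [a])"
proof -
  obtain xs where xs: "distinct xs" "set xs = nb E v"
    "\<forall>i<length xs. xs ! i \<noteq> xs ! (Suc i mod length xs) \<longrightarrow> corner V E v (xs ! i) (xs ! (Suc i mod length xs))"
    by (rule drawable_rotation[OF sg dr v])
  have len: "2 \<le> length xs" using n xs(1,2) by (metis distinct_card)
  have c: "corner V E v (xs ! i) (xs ! (Suc i mod length xs))" if i: "i < length xs" for i
  proof (rule xs(3)[rule_format, OF i])
    have "Suc i mod length xs \<noteq> i" using i len by (cases "Suc i = length xs") auto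
    moreover have "Suc i mod length xs < length xs" using len by (intro mod_less_divisor) linarith
    ultimately show "xs ! i \<noteq> xs ! (Suc i mod length xs)" using xs(1) i by (simp add: nth_eq_iff_index_eq)
  qed
  obtain k where k: "k < length xs" "xs ! k = a" using a xs(2) by (metis in_set_conv_nth)
  define zs where "zs = rotate k xs"
  have "zs ! 0 = a" unfolding zs_def using k len by (subst nth_rotate) auto
  moreover have lz: "length zs = length xs" unfolding zs_def by simp
  ultimately obtain ys where ys: "zs = a # ys" using len by (cases zs) auto
  have cz: "corner V E v (zs ! i) (zs ! (Suc i mod length zs))" if i: "i < length zs" for i
  proof -
    have l0: "0 < length xs" using len by linarith
    have 1: "zs ! i = xs ! ((k + i) mod length xs)" unfolding zs_def using i lz by (simp add: nth_rotate)
    have "Suc i mod length zs < length xs" using l0 lz by simp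
    then have "zs ! (Suc i mod length zs) = xs ! ((k + Suc i mod length xs) mod length xs)"
      unfolding zs_def by (subst nth_rotate) auto
    also have "(k + Suc i mod length xs) mod length xs = Suc ((k + i) mod length xs) mod length xs"
      by (simp add: mod_simps)
    finally show ?thesis unfolding 1 using c[of "(k + i) mod length xs"] l0 by (metis mod_less_divisor)
  qed
  have "successively (corner V E v) (zs @ [a])"
    unfolding successively_conv_nth
  proof (intro allI impI)
    fix i assume i: "Suc i < length (zs @ [a])"
    have "(zs @ [a]) ! Suc i = zs ! (Suc i mod length zs)"
    proof (cases "Suc i < length zs")
      case False
      then have "Suc i = length zs" using i by simp
      then show ?thesis using ys by (simp add: nth_append)
    qed (simp add: nth_append)
    moreover have "(zs @ [a]) ! i = zs ! i" using i by (simp add: nth_append)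
    ultimately show "corner V E v ((zs @ [a]) ! i) ((zs @ [a]) ! Suc i)" using cz[of i] i by simp
  qed
  moreover have "distinct zs" "set zs = nb E v" unfolding zs_def using xs by simp_all
  ultimately show ?thesis using that ys by simp
qed

lemma drawable_join:
  assumes sg: "sgraph V E" and dr: "drawable V E" and V: "V = V1 \<union> V2" "V1 \<inter> V2 = {}" "V1 \<noteq> {}" "V2 \<noteq> {}"
    and E: "\<And>e. e \<in> E \<Longrightarrow> e \<subseteq> V1 \<or> e \<subseteq> V2"
  shows "\<exists>a\<in>V1. \<exists>b\<in>V2. drawable V (insert {a, b} E)"
proof -
  obtain p A0 where p: "inj_on p V" "plane_graph (p ` V) ((`) p ` E) A0" using dr unfolding drawable_def by metis
  obtain A r where "spoked_graph (p ` V) ((`) p ` E) A r" by (rule plane_graph.spoked[OF p(2)])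
  then interpret spoked_graph "p ` V" "(`) p ` E" A r .
  have "\<exists>a\<in>p ` V1. \<exists>b\<in>p ` V2. \<exists>A'. plane_graph (p ` V) (insert {a, b} ((`) p ` E)) A'"
  proof (rule join_components)
    show "p ` V = p ` V1 \<union> p ` V2" unfolding V(1) by (rule image_Un)
    show "p ` V1 \<inter> p ` V2 = {}" using p(1) V(1,2) by (metis Un_upper1 Un_upper2 image_empty inj_on_image_Int)
    show "e \<subseteq> p ` V1 \<or> e \<subseteq> p ` V2" if "e \<in> (`) p ` E" for e using that E by blast
  qed (use V(3,4) in auto)
  then obtain a b A' where ab: "a \<in> V1" "b \<in> V2" "plane_graph (p ` V) (insert {p a, p b} ((`) p ` E)) A'"
    by (elim bexE exE imageE) simp
  then have "plane_graph (p ` V) ((`) p ` insert {a, b} E) A'" by simp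
  then have "drawable V (insert {a, b} E)" unfolding drawable_def using p(1) by (intro exI conjI)
  then show ?thesis using ab by (intro bexI)
qed

section \<open>Maximal planar graphs\<close>

definition mplanar :: "'a set \<Rightarrow> 'a set set \<Rightarrow> bool" where
  "mplanar V E \<longleftrightarrow> sgraph V E \<and> drawable V E \<and>
     (\<forall>u\<in>V. \<forall>v\<in>V. u \<noteq> v \<longrightarrow> {u, v} \<notin> E \<longrightarrow> \<not> drawable V (insert {u, v} E))"

text \<open>This is tied to no particular drawing: different triangles may be faces by virtue of
  different drawings. Stacking needs just one of them at a time.\<close>

definition face :: "'a set \<Rightarrow> 'a set set \<Rightarrow> 'a \<Rightarrow> 'a \<Rightarrow> 'a \<Rightarrow> bool" where
  "face V E a b c \<longleftrightarrow> {a, b} \<in> E \<and> {b, c} \<in> E \<and> {a, c} \<in> E \<and>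
     (\<forall>w. w \<notin> V \<longrightarrow> drawable (insert w V) (stack E w a b c))"

lemma mplanarD: "mplanar V E \<Longrightarrow> sgraph V E" "mplanar V E \<Longrightarrow> drawable V E"
  unfolding mplanar_def by auto

lemma mplanar_edgeI: "mplanar V E \<Longrightarrow> u \<in> V \<Longrightarrow> v \<in> V \<Longrightarrow> u \<noteq> v \<Longrightarrow> drawable V (insert {u, v} E) \<Longrightarrow> {u, v} \<in> E"
  unfolding mplanar_def by auto

lemma face_swap: "face V E a b c \<Longrightarrow> face V E b a c" "face V E a b c \<Longrightarrow> face V E a c b"
  unfolding face_def stack_def by (auto simp: insert_commute)

lemma face_vertices:
  "sgraph V E \<Longrightarrow> face V E a b c \<Longrightarrow> a \<in> V \<and> b \<in> V \<and> c \<in> V \<and> a \<noteq> b \<and> b \<noteq> c \<and> a \<noteq> c"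
  unfolding face_def using sgraph_edge by metis

lemma in_nb: "a \<in> nb E v \<longleftrightarrow> {v, a} \<in> E"
  unfolding nb_def by simp

lemma mplanar_rotation:
  assumes mp: "mplanar V E" and v: "v \<in> V" and a: "a \<in> nb E v" and n: "2 \<le> card (nb E v)"
  obtains ys where "distinct (a # ys)" "set (a # ys) = nb E v" "successively (face V E v) (a # ys @ [a])"
proof -
  note sg = mplanarD(1)[OF mp]
  obtain ys where ys: "distinct (a # ys)" "set (a # ys) = nb E v" "successively (corner V E v) (a # ys @ [a])"
    by (rule drawable_rotation_from[OF sg mplanarD(2)[OF mp] v a n])
  have "successively (face V E v) (a # ys @ [a])"
  proof (rule successively_mono[OF ys(3)])
    fix x y assume xy: "x \<in> set (a # ys @ [a])" "y \<in> set (a # ys @ [a])" and c: "corner V E v x y"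
    have e: "{v, x} \<in> E" "{v, y} \<in> E" using xy ys(2) in_nb by fastforce+
    then have "x \<in> V" "y \<in> V" using sgraph_edge[OF sg] by metis+
    then have "{x, y} \<in> E" using c mplanar_edgeI[OF mp] unfolding corner_def by metis
    then show "face V E v x y" using e c unfolding face_def corner_def by simp
  qed
  then show ?thesis using that ys by metis
qed

text \<open>In a cyclic order of three elements any two are consecutive.\<close>

lemma degree_three:
  assumes mp: "mplanar V E" and v: "v \<in> V" and n: "card (nb E v) = 3" and xy: "x \<in> nb E v" "y \<in> nb E v" "x \<noteq> y"
  shows "face V E v x y"
proof -
  obtain ys where ys: "distinct (x # ys)" "set (x # ys) = nb E v" "successively (face V E v) (x # ys @ [x])"
    by (rule mplanar_rotation[OF mp v xy(1)]) (use n in simp)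
  have "length (x # ys) = 3" using ys(1,2) n by (metis distinct_card)
  then obtain p q where pq: "ys = [p, q]" by (auto simp: length_Suc_conv numeral_3_eq_3)
  have "y = p \<or> y = q" using xy ys(2) pq by auto
  then show ?thesis using ys(3) face_swap unfolding pq by auto
qed

text \<open>Rerouting an additional edge \<open>wb\<close> through \<open>w\<close> shows that \<open>b\<close> is adjacent to \<open>x\<close>, \<open>y\<close> and \<open>z\<close>;
  then \<open>x\<close>, \<open>y\<close>, \<open>z\<close>, \<open>b\<close>, \<open>w\<close> form a \<open>K\<^sub>5\<close>.\<close>

lemma mplanar_stack:
  assumes mp: "mplanar V E" and f: "face V E x y z" and w: "w \<notin> V"
  shows "mplanar (insert w V) (stack E w x y z)"
proof -
  note sg = mplanarD(1)[OF mp]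
  have V: "x \<in> V" "y \<in> V" "z \<in> V" "x \<noteq> y" "y \<noteq> z" "x \<noteq> z" using face_vertices[OF sg f] by auto
  let ?E = "stack E w x y z"
  have sg': "sgraph (insert w V) ?E" using sgraph_stack[OF sg w] V by simp
  have Ew: "w \<notin> e" if "e \<in> E" for e using sgraph_sub[OF sg that] w by auto
  have new: "\<not> drawable (insert w V) (insert {w, b} ?E)" if b: "b \<in> V" "{w, b} \<notin> ?E" for b
  proof
    assume D: "drawable (insert w V) (insert {w, b} ?E)"
    have "w \<noteq> b" using b w by auto
    then have sg2: "sgraph (insert w V) (insert {w, b} ?E)" using sgraph_insert[OF sg'] b by simp
    have bx: "b \<noteq> x" "b \<noteq> y" "b \<noteq> z" using b unfolding stack_def by auto
    have adj: "{c, b} \<in> E" if c: "c \<in> {x, y, z}" for c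
    proof -
      have cb: "c \<noteq> b" "c \<in> V" using c bx V by auto
      have "{w, c} \<in> insert {w, b} ?E" using c unfolding stack_def by auto
      then have "drawable (insert w V - {w}) (insert {c, b} {e \<in> insert {w, b} ?E. w \<notin> e})"
        by (intro drawable_suppress[OF sg2 D]) (use cb in auto)
      then have "drawable V (insert {c, b} E)"
        by (rule drawable_mono) (use w Ew cb b sgraph_sub[OF sg] in \<open>auto simp: stack_def\<close>)
      then show ?thesis using mplanar_edgeI[OF mp cb(2) b(1) cb(1)] by simp
    qed
    have "x \<noteq> w" "y \<noteq> w" "z \<noteq> w" using V w by auto
    then have d: "distinct [x, y, z, b, w]" using V bx \<open>w \<noteq> b\<close> by auto
    have "{x, y} \<in> E" "{x, z} \<in> E" "{z, y} \<in> E" "{x, b} \<in> E" "{b, y} \<in> E" "{z, b} \<in> E"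
      using f adj[of x] adj[of y] adj[of z] unfolding face_def by (simp_all add: insert_commute)
    then show False
      by (intro drawable_no_K5[OF sg2 D d]) (simp_all add: stack_def)
  qed
  have old: "\<not> drawable (insert w V) (insert {u, v} ?E)" if uv: "u \<in> V" "v \<in> V" "u \<noteq> v" "{u, v} \<notin> ?E" for u v
  proof
    assume "drawable (insert w V) (insert {u, v} ?E)"
    then have "drawable V (insert {u, v} E)"
      by (rule drawable_mono) (use uv sgraph_sub[OF sg] in \<open>auto simp: stack_def\<close>)
    then show False using mplanar_edgeI[OF mp uv(1-3)] uv(4) unfolding stack_def by simp
  qed
  have "drawable (insert w V) ?E" using f w unfolding face_def by simp
  moreover have "\<not> drawable (insert w V) (insert {u, v} ?E)"
    if uv: "u \<in> insert w V" "v \<in> insert w V" "u \<noteq> v" "{u, v} \<notin> ?E" for u v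
  proof -
    consider "u \<in> V" "v \<in> V" | "u = w" "v \<in> V" | "v = w" "u \<in> V" using uv(1-3) by auto
    then show ?thesis
    proof cases
      case 1
      then show ?thesis using old uv by simp
    next
      case 2
      then show ?thesis using new[of v] uv(4) by simp
    next
      case 3
      have "{u, v} = {w, u}" using 3 by auto
      then show ?thesis using new[of u] uv(4) 3(2) by simp
    qed
  qed
  ultimately show ?thesis unfolding mplanar_def using sg' by simp
qed

lemma stack_nb:
  assumes "sgraph V E" "w \<notin> V"
  shows "nb (stack E w x y z) w = {x, y, z}"
proof -
  have "{w, a} \<notin> E" for a using sgraph_sub[OF assms(1)] assms(2) by auto
  then show ?thesis unfolding nb_def stack_def by (auto simp: doubleton_eq_iff)
qed

text \<open>The new vertex has degree three, so \<open>degree_three\<close> applies. This lets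
  towers grow.\<close>

lemma stack_face:
  assumes mp: "mplanar V E" and f: "face V E x y z" and w: "w \<notin> V"
  shows "face (insert w V) (stack E w x y z) w x y"
proof -
  have "x \<noteq> y" "y \<noteq> z" "x \<noteq> z" using face_vertices[OF mplanarD(1)[OF mp] f] by auto
  then show ?thesis
    by (intro degree_three[OF mplanar_stack[OF assms]]) (auto simp: stack_nb[OF mplanarD(1)[OF mp] w])
qed

section \<open>Distances\<close>

text \<open>A step may stand still, so this expresses distance at most \<open>k\<close> rather than
  a walk of length exactly \<open>k\<close>.\<close>

fun near :: "'a set set \<Rightarrow> nat \<Rightarrow> 'a \<Rightarrow> 'a \<Rightarrow> bool" where
  "near E 0 u v \<longleftrightarrow> u = v"
| "near E (Suc k) u v \<longleftrightarrow> (\<exists>c. (u = c \<or> {u, c} \<in> E) \<and> near E k c v)"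

lemma near_Suc: "near E k u v \<Longrightarrow> near E (Suc k) u v"
  by auto

lemma near_mono: "near E j u v \<Longrightarrow> j \<le> k \<Longrightarrow> near E k u v"
proof (induction k)
  case (Suc k)
  then show ?case using near_Suc by (cases "j = Suc k") auto
qed simp

lemma near_add: "near E j u v \<Longrightarrow> near E k v w \<Longrightarrow> near E (j + k) u w"
  by (induction j arbitrary: u) auto

lemma near_1: "near E 1 u v \<longleftrightarrow> u = v \<or> {u, v} \<in> E"
  by auto

lemma near_2: "near E 2 u v \<longleftrightarrow> (\<exists>c. near E 1 u c \<and> near E 1 c v)"
  by (auto simp: numeral_2_eq_2)

lemma near_refl: "near E k u u"
  by (induction k) auto

lemma near_sym: "near E k u v \<Longrightarrow> near E k v u"
proof (induction k arbitrary: u)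
  case (Suc k)
  then obtain c where c: "u = c \<or> {u, c} \<in> E" "near E k c v" by auto
  have "near E 1 c u" using c(1) unfolding near_1 by (metis insert_commute)
  then show ?case using near_add[OF Suc.IH[OF c(2)]] by (metis Suc_eq_plus1)
qed simp

lemma near_map:
  "near E k u v \<Longrightarrow> (\<And>a b. {a, b} \<in> E \<Longrightarrow> f a = f b \<or> {f a, f b} \<in> E') \<Longrightarrow> near E' k (f u) (f v)"
proof (induction k arbitrary: u)
  case (Suc k)
  then obtain c where "u = c \<or> {u, c} \<in> E" "near E k c v" by auto
  then show ?case using Suc.IH Suc.prems(2) by (metis near.simps(2))
qed simp

lemma near_subgraph: "near E k u v \<Longrightarrow> E \<subseteq> E' \<Longrightarrow> near E' k u v"
  using near_map[of E k u v "\<lambda>x. x" E'] by auto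

text \<open>Collapse the new vertex to a corner of the triangle.\<close>

lemma near_stack:
  assumes sg: "sgraph V E" and f: "face V E x y z" and w: "w \<notin> V" and uv: "u \<in> V" "v \<in> V"
    and n: "near (stack E w x y z) k u v"
  shows "near E k u v"
proof -
  define g where "g a = (if a = w then x else a)" for a
  have V: "x \<in> V" "y \<in> V" "z \<in> V" using face_vertices[OF sg f] by auto
  have Ew: "w \<notin> e" if "e \<in> E" for e using sgraph_sub[OF sg that] w by auto
  have new: "g w = g b \<or> {g w, g b} \<in> E" if "b \<in> {x, y, z}" for b
    using that f V w unfolding g_def face_def by auto
  have "near E k (g u) (g v)"
  proof (rule near_map[OF n])
    fix a b assume "{a, b} \<in> stack E w x y z"
    then consider "{a, b} \<in> E" | c where "c \<in> {x, y, z}" "{a, b} = {w, c}" unfolding stack_def by auto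
    then show "g a = g b \<or> {g a, g b} \<in> E"
    proof cases
      case 1
      then have "a \<noteq> w" "b \<noteq> w" using Ew[OF 1] by auto
      then show ?thesis using 1 unfolding g_def by simp
    next
      case 2
      then show ?thesis using new[OF 2(1)] by (metis doubleton_eq_iff insert_commute)
    qed
  qed
  moreover have "g u = u" "g v = v" using uv w unfolding g_def by auto
  ultimately show ?thesis by simp
qed

section \<open>Extensions that preserve distances\<close>

definition isometric :: "'a set \<Rightarrow> 'a set set \<Rightarrow> 'a set \<Rightarrow> 'a set set \<Rightarrow> bool" where
  "isometric V E V' E' \<longleftrightarrow> mplanar V' E' \<and> V \<subseteq> V' \<and> E \<subseteq> E' \<and>
     (\<forall>k. \<forall>u\<in>V. \<forall>v\<in>V. near E' k u v \<longrightarrow> near E k u v)"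

lemma isometric_refl: "mplanar V E \<Longrightarrow> isometric V E V E"
  unfolding isometric_def by auto

lemma isometric_trans: "isometric V E V' E' \<Longrightarrow> isometric V' E' V'' E'' \<Longrightarrow> isometric V E V'' E''"
  unfolding isometric_def by (meson order_trans subsetD)

lemma isometric_stack:
  assumes "mplanar V E" "face V E x y z" "w \<notin> V"
  shows "isometric V E (insert w V) (stack E w x y z)"
  unfolding isometric_def using mplanar_stack[OF assms] near_stack[OF mplanarD(1)[OF assms(1)] assms(2,3)]
  by (auto simp: stack_def)

lemma isometric_near: "isometric V E V' E' \<Longrightarrow> u \<in> V \<Longrightarrow> v \<in> V \<Longrightarrow> near E' k u v \<longleftrightarrow> near E k u v"
  unfolding isometric_def using near_subgraph by metis

section \<open>Connectivity and degrees\<close>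

text \<open>Connectedness in the form of cuts: without an edge between the two parts,
  \<open>drawable_join\<close> would supply one that can be added.\<close>

lemma mplanar_cut_edge:
  assumes mp: "mplanar V E" and V: "V = V1 \<union> V2" "V1 \<inter> V2 = {}" "V1 \<noteq> {}" "V2 \<noteq> {}"
  obtains a b where "a \<in> V1" "b \<in> V2" "{a, b} \<in> E"
proof -
  have "\<exists>a\<in>V1. \<exists>b\<in>V2. {a, b} \<in> E"
  proof (rule ccontr)
    assume no: "\<not> ?thesis"
    have "e \<subseteq> V1 \<or> e \<subseteq> V2" if e: "e \<in> E" for e
    proof -
      obtain a b where ab: "e = {a, b}" "a \<in> V" "b \<in> V" using mplanarD(1)[OF mp] e unfolding sgraph_def by metis
      have "\<not> (a \<in> V1 \<and> b \<in> V2)" "\<not> (b \<in> V1 \<and> a \<in> V2)" using no e unfolding ab(1) by (auto simp: insert_commute)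
      then show ?thesis using ab V(1) by auto
    qed
    then obtain a b where ab: "a \<in> V1" "b \<in> V2" "drawable V (insert {a, b} E)"
      using drawable_join[OF mplanarD[OF mp] V] by metis
    then have "a \<in> V" "b \<in> V" "a \<noteq> b" using V by auto
    then have "{a, b} \<in> E" using mplanar_edgeI[OF mp] ab(3) by simp
    then show False using no ab by auto
  qed
  then show ?thesis using that by metis
qed

lemma successively_ends:
  assumes "successively P (a # ys @ [a])" "ys \<noteq> []"
  shows "P a (hd ys)" "P (last ys) a"
  using assms by (auto simp: successively_append_iff successively_Cons)

text \<open>If \<open>v\<close> has at most two neighbours, some edge \<open>ab\<close> leaves its
  closed neighbourhood from a neighbour \<open>a\<close>. The two faces beside the edge
  \<open>av\<close> have third corners adjacent to \<open>v\<close>. If these differ,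
  \<open>v\<close> has degree three. If they coincide, \<open>a\<close> has no neighbours other than
  \<open>v\<close> and that corner, so \<open>b\<close> would be adjacent to
  \<open>v\<close>.\<close>

lemma mplanar_degree:
  assumes mp: "mplanar V E" and n: "4 \<le> card V" and v: "v \<in> V"
  shows "3 \<le> card (nb E v)"
proof (rule ccontr)
  assume small: "\<not> ?thesis"
  note sg = mplanarD(1)[OF mp]
  have fin: "finite V" using sg unfolding sgraph_def by simp
  define V1 where "V1 = insert v (nb E v)"
  have "card V1 \<le> 3" unfolding V1_def using small finite_nb[OF sg, of v] by (simp add: card_insert_if)
  then have ne: "V1 \<noteq> V" using n by auto
  have sub: "V1 \<subseteq> V" unfolding V1_def using nb_sub[OF sg, of v] v by auto
  obtain a b where ab: "a \<in> V1" "b \<in> V - V1" "{a, b} \<in> E"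
    by (rule mplanar_cut_edge[OF mp, of V1 "V - V1"]) (use ne sub in \<open>auto simp: V1_def\<close>)
  have "a \<noteq> v" using ab unfolding V1_def by (auto simp: in_nb)
  then have av: "a \<in> nb E v" using ab unfolding V1_def by auto
  have va: "v \<in> nb E a" "b \<in> nb E a" using av ab(3) unfolding in_nb by (simp_all add: insert_commute)
  have "v \<noteq> b" using ab unfolding V1_def by auto
  have "card {v, b} \<le> card (nb E a)" using va by (intro card_mono finite_nb[OF sg]) auto
  then have n2: "2 \<le> card (nb E a)" using \<open>v \<noteq> b\<close> by simp
  have aV: "a \<in> V" using ab(1) sub by auto
  obtain ys where ys: "distinct (v # ys)" "set (v # ys) = nb E a" "successively (face V E a) (v # ys @ [v])"
    by (rule mplanar_rotation[OF mp aV va(1) n2])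
  have bys: "b \<in> set ys" using ys(2) va(2) \<open>v \<noteq> b\<close> by auto
  then have yne: "ys \<noteq> []" by auto
  have fs: "face V E a v (hd ys)" "face V E a v (last ys)"
    using successively_ends[OF ys(3) yne] face_swap(2) by metis+
  then have hl: "hd ys \<in> nb E v" "last ys \<in> nb E v" "hd ys \<noteq> a" "last ys \<noteq> a"
    using face_vertices[OF sg] unfolding in_nb face_def by metis+
  have "hd ys = last ys"
  proof (rule ccontr)
    assume "hd ys \<noteq> last ys"
    then have "card {a, hd ys, last ys} = 3" using hl by auto
    moreover have "card {a, hd ys, last ys} \<le> card (nb E v)"
      using hl av by (intro card_mono finite_nb[OF sg]) auto
    ultimately show False using small by simp
  qed
  moreover have "distinct ys" using ys(1) by simp
  ultimately have "ys = [hd ys]" using yne by (metis distinct.simps(2) hd_Cons_tl last.simps last_in_set)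
  then have "b = hd ys" using bys by (metis empty_iff empty_set set_ConsD)
  then show False using hl(1) ab(2) unfolding V1_def by simp
qed

text \<open>With four vertices, a missing edge at \<open>u\<close> leaves it with degree at most
  two. With fewer, connectedness leaves only a path from \<open>u\<close> over \<open>b\<close> to
  \<open>v\<close>, and the face at \<open>b\<close> supplies its closing edge.\<close>

lemma mplanar_small_complete:
  assumes mp: "mplanar V E" and n: "card V \<le> 4" and uv: "u \<in> V" "v \<in> V" "u \<noteq> v"
  shows "{u, v} \<in> E"
proof (rule ccontr)
  assume no: "{u, v} \<notin> E"
  note sg = mplanarD(1)[OF mp]
  have fin: "finite V" using sg unfolding sgraph_def by simp
  have sub: "nb E u \<subseteq> V - {u, v}" using nb_sub[OF sg, of u] no unfolding in_nb[symmetric] by auto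
  have cV: "card (V - {u, v}) = card V - 2" using uv fin by (simp add: card_Diff_subset)
  have le: "card (nb E u) \<le> card V - 2" using card_mono[OF _ sub] fin cV by simp
  have "card V \<noteq> 4" using mplanar_degree[OF mp _ uv(1)] le by auto
  then have c3: "card V \<le> 3" using n by simp
  obtain a b where ab: "a \<in> {u}" "b \<in> V - {u}" "{a, b} \<in> E"
    by (rule mplanar_cut_edge[OF mp, of "{u}" "V - {u}"]) (use uv in auto)
  then have b: "b \<in> V - {u, v}" using no by auto
  have "card (V - {u, v}) \<le> 1" using cV c3 by simp
  moreover have "finite (V - {u, v})" using fin by simp
  ultimately have "\<forall>x\<in>V - {u, v}. \<forall>y\<in>V - {u, v}. x = y" using card_le_Suc0_iff_eq by (metis One_nat_def)
  then have Vb: "V - {u, v} = {b}" using b by blast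
  obtain c d where cd: "c \<in> {v}" "d \<in> V - {v}" "{c, d} \<in> E"
    by (rule mplanar_cut_edge[OF mp, of "{v}" "V - {v}"]) (use uv in auto)
  have "d \<noteq> u" using cd no by (auto simp: insert_commute)
  then have "d = b" using Vb cd by auto
  then have vb: "v \<in> nb E b" "u \<in> nb E b" using cd ab unfolding in_nb by (auto simp: insert_commute)
  have "nb E b \<subseteq> {u, v}" using nb_sub[OF sg, of b] Vb by auto
  then have nbb: "nb E b = {u, v}" using vb by auto
  obtain ys where ys: "distinct (u # ys)" "set (u # ys) = nb E b" "successively (face V E b) (u # ys @ [u])"
    by (rule mplanar_rotation[OF mp _ vb(2)]) (use b nbb uv in auto)
  have "set ys = set (u # ys) - {u}" using ys(1) by simp
  then have sy: "set ys = {v}" unfolding ys(2) nbb using uv(3) by auto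
  then have yn: "ys \<noteq> []" by (cases ys) simp_all
  then have "hd ys = v" using sy hd_in_set[of ys] by simp
  then have "face V E b u v" using successively_ends(1)[OF ys(3) yn] by simp
  then show False using no unfolding face_def by simp
qed

section \<open>Graphs with a unique dominating vertex\<close>

abbreviation walk :: "'a set set \<Rightarrow> 'a list \<Rightarrow> bool" where
  "walk E \<equiv> successively (\<lambda>x y. {x, y} \<in> E)"

lemma walk_infix: "walk E (xs @ ys @ zs) \<Longrightarrow> walk E ys"
  by (cases "ys = []") (auto simp: successively_append_iff)

text \<open>Hub \<open>v\<close>, rim \<open>a A b B c C d D\<close>, chords \<open>ac\<close> and \<open>bd\<close>: a subdivision of \<open>K\<^sub>5\<close>.\<close>

definition crossed_wheel where
  "crossed_wheel V E v a A b B c C d D \<longleftrightarrow> sgraph V E \<and> drawable V E \<and>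
     distinct (v # a # A @ b # B @ c # C @ d # D) \<and>
     walk E (a # A @ [b]) \<and> walk E (b # B @ [c]) \<and> walk E (c # C @ [d]) \<and> walk E (d # D @ [a]) \<and>
     {a, c} \<in> E \<and> {b, d} \<in> E \<and> {v, a} \<in> E \<and> {v, b} \<in> E \<and> {v, c} \<in> E \<and> {v, d} \<in> E"

lemma walk_mono:
  assumes "walk E xs" "p \<notin> set xs"
  shows "walk (insert f {e \<in> E. p \<notin> e}) xs"
  using assms by (intro successively_mono[OF assms(1)]) auto

text \<open>Suppress the inner vertices of the first rim segment one at a time. Each suppressed
  vertex lies off the chords, the spokes and the other segments, so these survive.\<close>

lemma crossed_wheel_shrink:
  "crossed_wheel V E v a A b B c C d D \<Longrightarrow> \<exists>V' E'. crossed_wheel V' E' v a [] b B c C d D"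
proof (induction A arbitrary: V E)
  case (Cons p A)
  note w = Cons.prems[unfolded crossed_wheel_def]
  define q where "q = hd (A @ [b])"
  have sg: "sgraph V E" and dr: "drawable V E" using w by simp_all
  have d: "distinct (v # a # p # A @ b # B @ c # C @ d # D)" using w by simp
  have aq: "A @ [b] = q # tl (A @ [b])" unfolding q_def by (cases A) simp_all
  have "q \<in> set (A @ [b])" unfolding q_def by (cases A) simp_all
  then have qn: "q \<noteq> p" "a \<noteq> q" using d by auto
  have "walk E (a # p # A @ [b])" using w by simp
  then have pe: "{a, p} \<in> E" "{p, q} \<in> E" "walk E (A @ [b])"
    using aq by (auto simp: successively_Cons q_def)
  have pa: "{p, a} \<in> E" using pe(1) by (simp add: insert_commute)
  have V: "a \<in> V" "q \<in> V" using sgraph_edge[OF sg] pe by metis+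
  let ?E = "insert {a, q} {e \<in> E. p \<notin> e}"
  have wb: "walk E (b # B @ [c])" and wc: "walk E (c # C @ [d])" and wd: "walk E (d # D @ [a])" using w by simp_all
  have "drawable (V - {p}) ?E" by (rule drawable_suppress[OF sg dr pa pe(2) qn(2)])
  moreover have "sgraph (V - {p}) ?E"
  proof -
    have "sgraph (V - {p}) {e \<in> E. p \<notin> e}" using sg unfolding sgraph_def by fastforce
    then show ?thesis by (rule sgraph_insert) (use V qn d in auto)
  qed
  moreover have "walk ?E (a # A @ [b])"
  proof -
    have "walk ?E (A @ [b])" by (rule walk_mono[OF pe(3)]) (use d in auto)
    then show ?thesis using aq by (simp add: successively_Cons q_def)
  qed
  moreover have "walk ?E (b # B @ [c])" by (rule walk_mono[OF wb]) (use d in auto)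
  moreover have "walk ?E (c # C @ [d])" by (rule walk_mono[OF wc]) (use d in auto)
  moreover have "walk ?E (d # D @ [a])" by (rule walk_mono[OF wd]) (use d in auto)
  moreover have "distinct (v # a # A @ b # B @ c # C @ d # D)" using d by auto
  moreover have "{a, c} \<in> E" "{b, d} \<in> E" "{v, a} \<in> E" "{v, b} \<in> E" "{v, c} \<in> E" "{v, d} \<in> E" using w by simp_all
  then have "{a, c} \<in> ?E" "{b, d} \<in> ?E" "{v, a} \<in> ?E" "{v, b} \<in> ?E" "{v, c} \<in> ?E" "{v, d} \<in> ?E"
    using d by auto
  ultimately have "crossed_wheel (V - {p}) ?E v a A b B c C d D"
    unfolding crossed_wheel_def by (intro conjI)
  then show ?case by (rule Cons.IH)
qed auto

lemma crossed_wheel_rotate: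
  "crossed_wheel V E v a A b B c C d D \<Longrightarrow> crossed_wheel V E v b B c C d D a A"
  unfolding crossed_wheel_def by (auto simp: insert_commute)

text \<open>Shrinking and rotating four times empties all rim segments; four rim edges, two chords
  and four spokes are the ten edges of \<open>K\<^sub>5\<close>.\<close>

lemma no_crossed_wheel: "\<not> crossed_wheel V E v a A b B c C d D"
proof
  assume "crossed_wheel V E v a A b B c C d D"
  then obtain V1 E1 where "crossed_wheel V1 E1 v a [] b B c C d D" using crossed_wheel_shrink by metis
  then have "crossed_wheel V1 E1 v b B c C d D a []" by (rule crossed_wheel_rotate)
  then obtain V2 E2 where "crossed_wheel V2 E2 v b [] c C d D a []" using crossed_wheel_shrink by metis
  then have "crossed_wheel V2 E2 v c C d D a [] b []" by (rule crossed_wheel_rotate)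
  then obtain V3 E3 where "crossed_wheel V3 E3 v c [] d D a [] b []" using crossed_wheel_shrink by metis
  then have "crossed_wheel V3 E3 v d D a [] b [] c []" by (rule crossed_wheel_rotate)
  then obtain V4 E4 where w: "crossed_wheel V4 E4 v d [] a [] b [] c []" using crossed_wheel_shrink by metis
  then have "sgraph V4 E4" "drawable V4 E4" "distinct [d, a, b, c, v]" unfolding crossed_wheel_def by auto
  then show False
    by (rule drawable_no_K5) (use w in \<open>auto simp: crossed_wheel_def insert_commute\<close>)
qed

lemma nth_drop_split:
  assumes "i < j" "j < length cs"
  shows "drop i cs = cs ! i # take (j - Suc i) (drop (Suc i) cs) @ drop j cs"
proof -
  have "drop i cs = cs ! i # drop (Suc i) cs" using assms by (simp add: Cons_nth_drop_Suc)
  moreover have "drop (Suc i) cs = take (j - Suc i) (drop (Suc i) cs) @ drop (j - Suc i) (drop (Suc i) cs)"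
    by (rule append_take_drop_id[symmetric])
  moreover have "drop (j - Suc i) (drop (Suc i) cs) = drop j cs" using assms by simp
  ultimately show ?thesis by metis
qed

text \<open>Discrete connectedness: a list that exhausts two nonempty sets passes somewhere from one
  to the other. The alternative \<open>x = y\<close> accounts for sets that overlap.\<close>

lemma successively_cross:
  assumes "successively P ys" "set ys = J1 \<union> J2" "J1 \<noteq> {}" "J2 \<noteq> {}"
  shows "\<exists>x\<in>J1. \<exists>y\<in>J2. P x y \<or> P y x \<or> x = y"
  using assms
proof (induction ys arbitrary: J1 J2)
  case (Cons a ys)
  show ?case
  proof (cases "ys = []")
    case True
    obtain x y where xy: "x \<in> J1" "y \<in> J2" using Cons.prems(3,4) by auto
    have "J1 \<union> J2 = {a}" using Cons.prems(2) True by simp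
    then have "x = a" "y = a" using xy by blast+
    then show ?thesis using xy by metis
  next
    case False
    then have s: "P a (hd ys)" "successively P ys" using Cons.prems(1) by (auto simp: successively_Cons)
    have U: "insert a (set ys) = J1 \<union> J2" using Cons.prems(2) by simp
    then have sub: "J1 \<subseteq> insert a (set ys)" "J2 \<subseteq> insert a (set ys)" by (metis Un_upper1, metis Un_upper2)
    have hs: "hd ys \<in> set ys" using False by simp
    then have h: "hd ys \<in> J1 \<union> J2" "a \<in> J1 \<union> J2" using U by (metis insertI2, metis insertI1)
    consider "J1 \<inter> set ys = {}" | "J2 \<inter> set ys = {}" | "J1 \<inter> set ys \<noteq> {}" "J2 \<inter> set ys \<noteq> {}" by blast
    then show ?thesis
    proof cases
      case 1
      then have "J1 \<subseteq> {a}" using sub(1) by blast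
      then have "J1 = {a}" using Cons.prems(3) by (simp add: subset_singleton_iff)
      moreover have "hd ys \<in> J2" using 1 h(1) hs by blast
      ultimately show ?thesis using s(1) by blast
    next
      case 2
      then have "J2 \<subseteq> {a}" using sub(2) by blast
      then have "J2 = {a}" using Cons.prems(4) by (simp add: subset_singleton_iff)
      moreover have "hd ys \<in> J1" using 2 h(1) hs by blast
      ultimately show ?thesis using s(1) by blast
    next
      case 3
      have "set ys = (J1 \<inter> set ys) \<union> (J2 \<inter> set ys)" using U by blast
      then show ?thesis using Cons.IH[OF s(2) _ 3] by blast
    qed
  qed
qed simp

text \<open>\<open>cs\<close> lists the neighbours of the hub \<open>v\<close> in their cyclic order in a drawing.\<close>

locale wheel =
  fixes V :: "'a set" and E and v and cs
  assumes mp: "mplanar V E" and v: "v \<in> V" and d: "distinct cs" and cs: "set cs = V - {v}"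
    and hub: "x \<in> V - {v} \<Longrightarrow> {v, x} \<in> E" and len: "4 \<le> length cs"
    and rim: "Suc i < length cs \<Longrightarrow> {cs ! i, cs ! Suc i} \<in> E"
    and close: "{cs ! 0, cs ! (length cs - 1)} \<in> E"
begin

lemma in_cs: "i < length cs \<Longrightarrow> cs ! i \<in> V - {v}"
  using cs nth_mem by auto

lemma rim_walk: "walk E cs"
  unfolding successively_conv_nth using rim by auto

text \<open>The rim with these two chords is a crossed wheel. Its last segment runs through the end
  of the list and, across the closing edge, on through the beginning; hence
  \<open>D @ P\<close>.\<close>

lemma no_crossing:
  assumes "i < j" "j < k" "k < l" "l < length cs" and e: "{cs ! i, cs ! k} \<in> E" "{cs ! j, cs ! l} \<in> E"
  shows False
proof -
  define P A B C D where "P = take i cs" and "A = take (j - Suc i) (drop (Suc i) cs)"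
    and "B = take (k - Suc j) (drop (Suc j) cs)" and "C = take (l - Suc k) (drop (Suc k) cs)" and "D = drop (Suc l) cs"
  let ?a = "cs ! i" and ?b = "cs ! j" and ?c = "cs ! k" and ?d = "cs ! l"
  have "cs = P @ drop i cs" unfolding P_def by simp
  also have "drop i cs = ?a # A @ drop j cs" unfolding A_def by (rule nth_drop_split) (use assms in auto)
  also have "drop j cs = ?b # B @ drop k cs" unfolding B_def by (rule nth_drop_split) (use assms in auto)
  also have "drop k cs = ?c # C @ drop l cs" unfolding C_def by (rule nth_drop_split) (use assms in auto)
  also have "drop l cs = ?d # D" unfolding D_def using assms by (simp add: Cons_nth_drop_Suc)
  finally have eq: "cs = P @ ?a # A @ ?b # B @ ?c # C @ ?d # D" .
  have w: "walk E (P @ ?a # A @ ?b # B @ ?c # C @ ?d # D)" using rim_walk eq by simp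
  have cl: "{hd cs, last cs} \<in> E"
    using close len by (metis hd_conv_nth last_conv_nth list.size(3) not_numeral_le_zero)
  have wDP: "walk E (?d # (D @ P) @ [?a])"
  proof -
    have 1: "walk E (?d # D)" "walk E (P @ [?a])"
      using walk_infix[of E "P @ ?a # A @ ?b # B @ ?c # C" "?d # D" "[]"]
        walk_infix[of E "[]" "P @ [?a]" "A @ ?b # B @ ?c # C @ ?d # D"] w by simp_all
    have "last (?d # D) = last cs" by (subst (2) eq) simp
    moreover have "hd (P @ [?a]) = hd cs" by (subst (2) eq) (cases P; simp)
    ultimately have "{last (?d # D), hd (P @ [?a])} \<in> E" using cl by (simp add: insert_commute)
    then have "walk E ((?d # D) @ (P @ [?a]))" using 1 by (simp only: successively_append_iff) simp
    then show ?thesis by simp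
  qed
  have ws: "walk E (?a # A @ [?b])" "walk E (?b # B @ [?c])" "walk E (?c # C @ [?d])"
    using walk_infix[of E P "?a # A @ [?b]" "B @ ?c # C @ ?d # D"] walk_infix[of E "P @ ?a # A" "?b # B @ [?c]" "C @ ?d # D"]
      walk_infix[of E "P @ ?a # A @ ?b # B" "?c # C @ [?d]" D] w by simp_all
  have hubs: "{v, ?a} \<in> E" "{v, ?b} \<in> E" "{v, ?c} \<in> E" "{v, ?d} \<in> E"
    using hub in_cs assms(1-4) by auto
  have "distinct (P @ ?a # A @ ?b # B @ ?c # C @ ?d # D)" using d eq by simp
  moreover have "v \<notin> set (P @ ?a # A @ ?b # B @ ?c # C @ ?d # D)" using cs eq by (metis Diff_iff insertI1)
  ultimately have dd: "distinct (v # ?a # A @ ?b # B @ ?c # C @ ?d # D @ P)" by auto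
  have "crossed_wheel V E v ?a A ?b B ?c C ?d (D @ P)"
    unfolding crossed_wheel_def using dd ws wDP e hubs mplanarD[OF mp] by simp
  then show False using no_crossed_wheel by metis
qed

text \<open>Unrolling the cyclic order at \<open>cs ! i\<close> at the hub leaves a list of its rim
  neighbours, which must pass between those in \<open>J1\<close> (up to \<open>j\<close>) and those
  in \<open>J2\<close> (from \<open>k\<close> on, or before \<open>i\<close>). This yields a face
  \<open>?x p q\<close> with an edge \<open>pq\<close> from \<open>J1\<close> to \<open>J2\<close>.
  Unless \<open>p\<close> is \<open>cs ! j\<close>, that edge crosses the chord from
  \<open>i\<close> to \<open>j\<close>; then, unless \<open>q\<close> is \<open>cs ! k\<close>, it
  crosses the chord from \<open>i\<close> to \<open>k\<close>.\<close>

lemma apex: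
  assumes ijk: "i < j" "j < k" "k < length cs" and e: "{cs ! i, cs ! j} \<in> E" "{cs ! i, cs ! k} \<in> E"
    and none: "\<And>l. j < l \<Longrightarrow> l < k \<Longrightarrow> {cs ! i, cs ! l} \<notin> E"
  shows "face V E (cs ! i) (cs ! j) (cs ! k)"
proof -
  note sg = mplanarD(1)[OF mp]
  let ?x = "cs ! i"
  have x: "?x \<in> V" "?x \<noteq> v" using in_cs[of i] ijk by auto
  have vx: "v \<in> nb E ?x" using hub[of ?x] x unfolding in_nb by (simp add: insert_commute)
  have "cs ! j \<in> nb E ?x" "cs ! j \<noteq> v" using e(1) in_cs[of j] ijk unfolding in_nb by auto
  then have "card {v, cs ! j} \<le> card (nb E ?x)" using vx by (intro card_mono finite_nb[OF sg]) auto
  then have n2: "2 \<le> card (nb E ?x)" using \<open>cs ! j \<noteq> v\<close> by simp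
  obtain ys where ys: "distinct (v # ys)" "set (v # ys) = nb E ?x" "successively (face V E ?x) (v # ys @ [v])"
    by (rule mplanar_rotation[OF mp x(1) vx n2])
  define J1 where "J1 = {cs ! l | l. i < l \<and> l \<le> j \<and> {?x, cs ! l} \<in> E}"
  define J2 where "J2 = {cs ! l | l. l < length cs \<and> (k \<le> l \<or> l < i) \<and> {?x, cs ! l} \<in> E}"
  have sy: "set ys = nb E ?x - {v}" using ys(1,2) by auto
  have "set ys = J1 \<union> J2"
  proof (intro equalityI subsetI)
    fix y assume "y \<in> set ys"
    then have y: "{?x, y} \<in> E" "y \<noteq> v" by (simp_all add: sy in_nb)
    then have "y \<in> set cs" "y \<noteq> ?x" using sgraph_edge[OF sg y(1)] cs by auto
    then obtain l where l: "l < length cs" "y = cs ! l" by (metis in_set_conv_nth)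
    have "l \<noteq> i" using \<open>y \<noteq> ?x\<close> l by auto
    moreover have "\<not> (j < l \<and> l < k)" using none[of l] y l by auto
    ultimately consider "i < l" "l \<le> j" | "k \<le> l \<or> l < i" by linarith
    then show "y \<in> J1 \<union> J2" unfolding J1_def J2_def using l y by cases blast+
  next
    fix y assume "y \<in> J1 \<union> J2"
    then have "\<exists>l. (l \<le> j \<or> l < length cs) \<and> y = cs ! l \<and> {?x, y} \<in> E" unfolding J1_def J2_def by blast
    then obtain l where "l \<le> j \<or> l < length cs" "y = cs ! l" "{?x, y} \<in> E" by metis
    moreover from this have "l < length cs" using ijk by linarith
    ultimately show "y \<in> set ys" using in_cs[of l] by (simp add: sy in_nb)
  qed
  moreover have "successively (face V E ?x) ys" using ys(3) by (auto simp: successively_Cons successively_append_iff)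
  moreover have "J1 \<noteq> {}" "J2 \<noteq> {}" unfolding J1_def J2_def using ijk e by blast+
  ultimately obtain p q where pq: "p \<in> J1" "q \<in> J2" "face V E ?x p q \<or> face V E ?x q p \<or> p = q"
    using successively_cross by metis
  obtain s where s: "p = cs ! s" "i < s" "s \<le> j" using pq(1) unfolding J1_def by auto
  obtain t where t: "q = cs ! t" "t < length cs" "k \<le> t \<or> t < i" using pq(2) unfolding J2_def by auto
  have "s \<noteq> t" using s t ijk by auto
  then have "p \<noteq> q" using s t ijk d by (simp add: nth_eq_iff_index_eq)
  then have f: "face V E ?x p q" using pq(3) face_swap(2) by metis
  then have st: "{cs ! s, cs ! t} \<in> E" "{cs ! t, cs ! s} \<in> E" unfolding face_def s t by (simp_all add: insert_commute)
  have "s = j"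
  proof (rule ccontr)
    assume "s \<noteq> j"
    then have "s < j" using s by simp
    from t(3) show False
    proof
      assume "k \<le> t"
      then show False using no_crossing[of i s j t] s t ijk \<open>s < j\<close> e st by simp
    next
      assume "t < i"
      then show False using no_crossing[of t i s j] s t ijk \<open>s < j\<close> e st by simp
    qed
  qed
  moreover have "t = k"
  proof (rule ccontr)
    assume "t \<noteq> k"
    then consider "k < t" | "t < i" using t(3) by linarith
    then show False
    proof cases
      case 1
      then show False using no_crossing[of i j k t] t ijk e st \<open>s = j\<close> by simp
    next
      case 2
      then show False using no_crossing[of t i j k] t ijk e st \<open>s = j\<close> by simp
    qed
  qed
  ultimately show ?thesis using f s t by simp
qed

text \<open>Take for \<open>j\<close> the last neighbour of \<open>cs ! i\<close> before
  \<open>k\<close>; the rim edge to \<open>Suc i\<close> shows that there is one.\<close>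

lemma chord_triangle:
  assumes "Suc i < k" "k < length cs" "{cs ! i, cs ! k} \<in> E"
  obtains j where "i < j" "j < k" "face V E (cs ! i) (cs ! j) (cs ! k)"
proof -
  define S where "S = {l. i < l \<and> l < k \<and> {cs ! i, cs ! l} \<in> E}"
  have mem_S: "l \<in> S \<longleftrightarrow> i < l \<and> l < k \<and> {cs ! i, cs ! l} \<in> E" for l unfolding S_def by simp
  have fin: "finite S" unfolding S_def by simp
  have "Suc i \<in> S" unfolding S_def using assms rim[of i] by simp
  then have m: "Max S \<in> S" using Max_in[OF fin] by auto
  have "face V E (cs ! i) (cs ! Max S) (cs ! k)"
  proof (rule apex)
    show "{cs ! i, cs ! l} \<notin> E" if "Max S < l" "l < k" for l
    proof
      assume "{cs ! i, cs ! l} \<in> E"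
      then have "l \<in> S" using that m unfolding mem_S by linarith
      then show False using Max_ge[OF fin, of l] that(1) by simp
    qed
  qed (use m assms mem_S in auto)
  then show ?thesis using that m unfolding mem_S by auto
qed

text \<open>Centroid argument: the third vertex on the shortest chord spanning at least four rim edges leaves
  at most two rim vertices on each side of the triangle.\<close>

lemma dominating_face:
  assumes len7: "length cs \<le> 7"
  obtains a b c where "face V E a b c" "v \<notin> {a, b, c}" "\<And>x. x \<in> V \<Longrightarrow> \<exists>p\<in>{a, b, c}. near E 1 x p"
proof -
  let ?m = "length cs"
  define S where "S = {(p, q). p < q \<and> q < ?m \<and> {cs ! p, cs ! q} \<in> E \<and> (4 \<le> q - p \<or> (p = 0 \<and> q = ?m - 1))}"
  define g where "g = (\<lambda>pq. snd pq - fst pq :: nat)"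
  have S0: "(0, ?m - 1) \<in> S" unfolding S_def using len close by auto
  obtain pq where pq: "pq \<in> S" "\<And>rs. rs \<in> S \<Longrightarrow> g pq \<le> g rs"
    using ex_has_least_nat[of "\<lambda>x. x \<in> S" "(0, ?m - 1)" g] S0 by blast
  obtain i k where ik: "pq = (i, k)" by (cases pq)
  have k: "i < k" "k < ?m" "{cs ! i, cs ! k} \<in> E" "4 \<le> k - i \<or> (i = 0 \<and> k = ?m - 1)"
    using pq(1) unfolding ik S_def by auto
  have short: "q - p \<le> 3" if "p < q" "q < ?m" "{cs ! p, cs ! q} \<in> E" "q - p < k - i" for p q
  proof (rule ccontr)
    assume "\<not> q - p \<le> 3"
    then have "(p, q) \<in> S" unfolding S_def using that by auto
    then show False using pq(2)[of "(p, q)"] that(4) unfolding ik g_def by simp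
  qed
  have "Suc i < k" using k len by linarith
  then obtain j where j: "i < j" "j < k" "face V E (cs ! i) (cs ! j) (cs ! k)"
    by (rule chord_triangle[OF _ k(2,3)])
  have e: "{cs ! i, cs ! j} \<in> E" "{cs ! j, cs ! k} \<in> E" using j(3) unfolding face_def by auto
  \<comment> \<open>The two other sides have a smaller span, so they are not in \<open>S\<close>. A
    span of at most three leaves at most two inner vertices, each next to a corner.\<close>
  have gaps: "j - i \<le> 3" "k - j \<le> 3" using short[of i j] short[of j k] e j k by auto
  \<comment> \<open>At most 7 - 1 - 4 rim vertices lie beyond a chord of span at least four, and
    none beyond the closing edge.\<close>
  have out: "i + (?m - 1 - k) \<le> 2" using k(4) len len7 k(1,2) by linarith
  have rim': "{cs ! l, cs ! Suc l} \<in> E" "{cs ! Suc l, cs ! l} \<in> E" if "Suc l < ?m" for l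
    using rim[OF that] by (simp_all add: insert_commute)
  have close': "{cs ! 0, cs ! (?m - 1)} \<in> E" "{cs ! (?m - 1), cs ! 0} \<in> E" using close by (simp_all add: insert_commute)
  have dom: "\<exists>p\<in>{i, j, k}. cs ! l = cs ! p \<or> {cs ! l, cs ! p} \<in> E" if l: "l < ?m" for l
  proof -
    have step: ?thesis if "p \<in> {i, j, k}" "l = p \<or> l = Suc p \<or> p = Suc l \<or> (l = 0 \<and> p = ?m - 1) \<or> (p = 0 \<and> l = ?m - 1)" for p
      using that(2)
    proof (elim disjE)
      assume "l = Suc p"
      then show ?thesis using that(1) rim'(2)[of p] l by blast
    next
      assume "p = Suc l"
      moreover have "p < ?m" using that(1) j k by auto
      ultimately show ?thesis using that(1) rim'(1)[of l] by blast
    qed (use that(1) close' in blast)+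
    consider "l = i \<or> l = j \<or> l = k" | "i < l" "l < j" | "j < l" "l < k" | "l < i" | "k < l" by linarith
    then show ?thesis
    proof cases
      case 1
      then show ?thesis using step by blast
    next
      case 2
      then have "l = Suc i \<or> j = Suc l" using gaps by linarith
      then show ?thesis using step[of i] step[of j] by blast
    next
      case 3
      then have "l = Suc j \<or> k = Suc l" using gaps by linarith
      then show ?thesis using step[of j] step[of k] by blast
    next
      case 4
      then have "i = Suc l \<or> (l = 0 \<and> k = ?m - 1)" using out k(2) by linarith
      then show ?thesis using step[of i] step[of k] by blast
    next
      case 5
      then have "l = Suc k \<or> (i = 0 \<and> l = ?m - 1)" using out l by linarith
      then show ?thesis using step[of i] step[of k] by blast
    qed
  qed
  have "\<exists>p\<in>{cs ! i, cs ! j, cs ! k}. near E 1 x p" if x: "x \<in> V" for x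
  proof (cases "x = v")
    case True
    then show ?thesis using hub in_cs[of i] k unfolding near_1 by auto
  next
    case False
    then have "x \<in> set cs" using x cs by auto
    then obtain l where "l < ?m" "x = cs ! l" by (metis in_set_conv_nth)
    then show ?thesis using dom[of l] unfolding near_1 by auto
  qed
  moreover have "v \<notin> {cs ! i, cs ! j, cs ! k}" using in_cs[of i] in_cs[of j] in_cs[of k] j k by auto
  ultimately show ?thesis using that j(3) by blast
qed

end

declare near.simps [simp del]

section \<open>Graphs of diameter two\<close>

text \<open>Eccentricities are at most \<open>r\<close> on \<open>V\<close> and at least
  \<open>r\<close> on all of \<open>V'\<close>, which puts \<open>V\<close> into the centre. The
  case \<open>r = 0\<close> is for graphs with at most one vertex, where the truncated
  \<open>r - 1\<close> would demand a second vertex.\<close>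

definition centrally_embeddable :: "'a set \<Rightarrow> 'a set set \<Rightarrow> bool" where
  "centrally_embeddable V E \<longleftrightarrow> (\<exists>V' E' r. mplanar V' E' \<and> V \<subseteq> V' \<and> E \<subseteq> E' \<and>
     (\<forall>h\<in>V. \<forall>y\<in>V'. near E' r h y) \<and> (\<forall>y\<in>V'. r = 0 \<or> (\<exists>z\<in>V'. \<not> near E' (r - 1) y z)))"

lemma centrally_embeddableI:
  assumes "isometric V E V' E'" "\<And>h y. h \<in> V \<Longrightarrow> y \<in> V' \<Longrightarrow> near E' (Suc r) h y"
    "\<And>y. y \<in> V' \<Longrightarrow> \<exists>z\<in>V'. \<not> near E' r y z"
  shows "centrally_embeddable V E"
  unfolding centrally_embeddable_def
  by (intro exI[of _ V'] exI[of _ E'] exI[of _ "Suc r"]) (use assms in \<open>auto simp: isometric_def\<close>)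

text \<open>The invariant of stacking for radius two. It bounds eccentricities from below only on
  the new vertices; for the vertices of \<open>V\<close> this is achieved one by one and assembled
  in \<open>extends2_final\<close>.\<close>

definition extends2 :: "'a set \<Rightarrow> 'a set set \<Rightarrow> 'a set \<Rightarrow> 'a set set \<Rightarrow> bool" where
  "extends2 V E V' E' \<longleftrightarrow> isometric V E V' E' \<and> (\<forall>h\<in>V. \<forall>y\<in>V'. near E' 2 h y) \<and>
     (\<forall>y\<in>V' - V. \<exists>z\<in>V'. \<not> near E' 1 y z)"

lemma stack_not_near:
  assumes "sgraph V E" "w \<notin> V" "x \<in> V" "x \<notin> {a, b, c}"
  shows "\<not> near (stack E w a b c) 1 x w"
proof
  assume "near (stack E w a b c) 1 x w"
  then have "{w, x} \<in> stack E w a b c" using assms(2,3) unfolding near_1 by (auto simp: insert_commute)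
  then have "x \<in> nb (stack E w a b c) w" unfolding in_nb .
  then show False using assms(4) unfolding stack_nb[OF assms(1,2)] by simp
qed

text \<open>Over a face that dominates \<open>V\<close>, the vertex \<open>w\<close> is within two
  of all of \<open>V\<close>. It has three neighbours, so it misses one of at least four vertices.
  Earlier non-adjacent pairs stay so, as stacking preserves distances.\<close>

lemma extends2_stack:
  assumes ext: "extends2 V E V' E'" and f: "face V' E' a b c" and w: "w \<notin> V'"
    and dom: "\<And>h. h \<in> V \<Longrightarrow> \<exists>p\<in>{a, b, c}. near E' 1 h p" and n: "4 \<le> card V"
  shows "extends2 V E (insert w V') (stack E' w a b c)"
proof -
  let ?E = "stack E' w a b c"
  have iso: "isometric V E V' E'" using ext unfolding extends2_def by simp
  then have mp: "mplanar V' E'" and VV: "V \<subseteq> V'" unfolding isometric_def by auto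
  have iso2: "isometric V' E' (insert w V') ?E" by (rule isometric_stack[OF mp f w])
  have sub: "E' \<subseteq> ?E" unfolding stack_def by auto
  have "near ?E 2 h y" if h: "h \<in> V" and y: "y \<in> insert w V'" for h y
  proof (cases "y = w")
    case True
    obtain p where p: "p \<in> {a, b, c}" "near E' 1 h p" using dom[OF h] by auto
    have "{w, p} \<in> ?E" using p(1) unfolding stack_def by auto
    then have "near ?E 1 p w" unfolding near_1 by (simp add: insert_commute)
    then show ?thesis using near_subgraph[OF p(2) sub] True unfolding near_2 by metis
  next
    case False
    then show ?thesis using ext h y near_subgraph[OF _ sub] unfolding extends2_def by auto
  qed
  moreover have "\<exists>z\<in>insert w V'. \<not> near ?E 1 y z" if y: "y \<in> insert w V' - V" for y
  proof (cases "y = w")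
    case True
    have "card {a, b, c} \<le> 3" by (simp add: card_insert_le_m1)
    then have "\<not> V \<subseteq> {a, b, c}" using n card_mono[of "{a, b, c}" V] by auto
    then obtain z where z: "z \<in> V" "z \<notin> {a, b, c}" by auto
    have "z \<in> V'" using z(1) VV by auto
    then have "\<not> near ?E 1 z w" using stack_not_near[OF mplanarD(1)[OF mp] w] z by simp
    then have "\<not> near ?E 1 w z" using near_sym by metis
    then show ?thesis using True \<open>z \<in> V'\<close> by blast
  next
    case False
    then obtain z where z: "z \<in> V'" "\<not> near E' 1 y z" using ext y unfolding extends2_def by blast
    then have "\<not> near ?E 1 y z" using isometric_near[OF iso2, of y z 1] y False by simp
    then show ?thesis using z(1) by blast
  qed
  ultimately show ?thesis unfolding extends2_def using isometric_trans[OF iso iso2] by blast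
qed

lemma extends2_final:
  assumes ext: "extends2 V E V' E'" and x: "\<And>x. x \<in> V \<Longrightarrow> \<exists>z\<in>V'. \<not> near E' 1 x z"
  shows "centrally_embeddable V E"
proof (rule centrally_embeddableI[of V E V' E' 1])
  show "isometric V E V' E'" using ext unfolding extends2_def by simp
  show "near E' (Suc 1) h y" if "h \<in> V" "y \<in> V'" for h y
    using ext that unfolding extends2_def Suc_1 by blast
  show "\<exists>z\<in>V'. \<not> near E' 1 y z" if "y \<in> V'" for y
    using ext x that unfolding extends2_def by blast
qed

lemma fresh_vertex: "mplanar V E \<Longrightarrow> \<exists>w. (w::nat) \<notin> V"
  using mplanarD(1) ex_new_if_finite[OF infinite_UNIV_nat] unfolding sgraph_def by metis

lemma extends2_refl:
  assumes "mplanar V E" "d \<in> V" "\<And>y. y \<in> V \<Longrightarrow> near E 1 d y"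
  shows "extends2 V E V E"
proof -
  have "near E 2 h y" if "h \<in> V" "y \<in> V" for h y
    using near_sym[OF assms(3)[OF that(1)]] assms(3)[OF that(2)] unfolding near_2 by (intro exI conjI)
  then show ?thesis unfolding extends2_def using isometric_refl[OF assms(1)] by simp
qed

text \<open>For each \<open>x\<close>, one of the two dominating vertices, \<open>v\<close>, differs
  from \<open>x\<close>. Unroll the cyclic order at \<open>v\<close> from its neighbour
  \<open>x\<close>: the next two neighbours form with \<open>v\<close> a face that avoids
  \<open>x\<close> and dominates \<open>V\<close> through \<open>v\<close>. The vertex stacked there
  is not adjacent to \<open>x\<close>.\<close>

lemma two_dominating:
  fixes V :: "nat set"
  assumes mp: "mplanar V E" and n: "5 \<le> card V"
    and d: "d1 \<in> V" "d2 \<in> V" "d1 \<noteq> d2" "\<And>y. y \<in> V \<Longrightarrow> near E 1 d1 y" "\<And>y. y \<in> V \<Longrightarrow> near E 1 d2 y"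
  shows "centrally_embeddable V E"
proof -
  have finV: "finite V" using mplanarD(1)[OF mp] unfolding sgraph_def by simp
  have "\<exists>V' E'. extends2 V E V' E' \<and> (\<forall>x\<in>X. \<exists>z\<in>V'. \<not> near E' 1 x z)" if "finite X" "X \<subseteq> V" for X
    using that
  proof (induction X rule: finite_induct)
    case empty
    show ?case using extends2_refl[OF mp d(1,4)] by blast
  next
    case (insert x X)
    then obtain V' E' where ext: "extends2 V E V' E'" and X: "\<forall>x\<in>X. \<exists>z\<in>V'. \<not> near E' 1 x z" by auto
    have iso: "isometric V E V' E'" using ext unfolding extends2_def by simp
    then have mp': "mplanar V' E'" and VV: "V \<subseteq> V'" "E \<subseteq> E'" unfolding isometric_def by auto
    obtain v where v: "v \<in> V" "v \<noteq> x" "\<And>y. y \<in> V \<Longrightarrow> near E 1 v y" using d by metis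
    have sub: "V - {v} \<subseteq> nb E' v"
    proof
      fix y assume "y \<in> V - {v}"
      then show "y \<in> nb E' v" using v(3)[of y] VV(2) unfolding near_1 in_nb by auto
    qed
    have "card (V - {v}) \<le> card (nb E' v)" by (rule card_mono[OF finite_nb[OF mplanarD(1)[OF mp']] sub])
    then have c4: "4 \<le> card (nb E' v)" using n v(1) finV by simp
    have xv: "x \<in> nb E' v" using sub insert.prems v(2) by auto
    obtain ys where ys: "distinct (x # ys)" "set (x # ys) = nb E' v" "successively (face V' E' v) (x # ys @ [x])"
      by (rule mplanar_rotation[OF mp' _ xv]) (use c4 v(1) VV(1) in auto)
    have "4 \<le> length (x # ys)" using ys(1,2) c4 by (metis distinct_card)
    then obtain y1 y2 zs where y: "ys = y1 # y2 # zs" by (cases ys; cases "tl ys") auto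
    have f: "face V' E' v y1 y2" using ys(3) unfolding y by simp
    have xn: "x \<notin> {v, y1, y2}" using ys(1) v(2) unfolding y by auto
    obtain w where w: "w \<notin> V'" using fresh_vertex[OF mp'] by auto
    have dom: "\<exists>p\<in>{v, y1, y2}. near E' 1 h p" if "h \<in> V" for h
      using near_subgraph[OF near_sym[OF v(3)[OF that]] VV(2)] by blast
    have "extends2 V E (insert w V') (stack E' w v y1 y2)"
      by (rule extends2_stack[OF ext f w dom]) (use n in auto)
    moreover have "\<exists>z\<in>insert w V'. \<not> near (stack E' w v y1 y2) 1 x' z" if x': "x' \<in> insert x X" for x'
    proof (cases "x' = x")
      case True
      have "x \<in> V'" using insert.prems VV by auto
      then show ?thesis using stack_not_near[OF mplanarD(1)[OF mp'] w _ xn] True by blast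
    next
      case False
      then obtain z where z: "z \<in> V'" "\<not> near E' 1 x' z" using X x' by auto
      have "x' \<in> V'" using x' insert.prems VV by auto
      then show ?thesis using isometric_near[OF isometric_stack[OF mp' f w] _ z(1), of x' 1] z by blast
    qed
    ultimately show ?case by blast
  qed
  from this[OF finV order_refl] show ?thesis using extends2_final by metis
qed

text \<open>Every vertex except \<open>v\<close> already has a non-neighbour and keeps it, so one
  stack on a dominating face without \<open>v\<close> suffices.\<close>

lemma one_dominating:
  fixes V :: "nat set"
  assumes mp: "mplanar V E" and n: "5 \<le> card V" "card V \<le> 8"
    and dv: "v \<in> V" "\<And>y. y \<in> V \<Longrightarrow> near E 1 v y" and only: "\<And>x. x \<in> V \<Longrightarrow> x \<noteq> v \<Longrightarrow> \<exists>y\<in>V. \<not> near E 1 x y"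
  shows "centrally_embeddable V E"
proof -
  note sg = mplanarD(1)[OF mp]
  have finV: "finite V" using sg unfolding sgraph_def by simp
  have hub: "{v, x} \<in> E" if "x \<in> V - {v}" for x using dv(2)[of x] that unfolding near_1 by auto
  have nbv: "nb E v = V - {v}" using nb_sub[OF sg, of v] hub unfolding in_nb[symmetric] by auto
  have cn: "card (nb E v) = card V - 1" unfolding nbv using dv(1) finV by simp
  then have "nb E v \<noteq> {}" using n by auto
  then obtain a where a: "a \<in> nb E v" by auto
  obtain ys where ys: "distinct (a # ys)" "set (a # ys) = nb E v" "successively (face V E v) (a # ys @ [a])"
    by (rule mplanar_rotation[OF mp dv(1) a]) (use cn n in simp)
  have leny: "length (a # ys) = card V - 1" using ys(1,2) cn by (metis distinct_card)
  then have yne: "ys \<noteq> []" using n by auto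
  interpret wheel V E v "a # ys"
  proof
    show "mplanar V E" "v \<in> V" "distinct (a # ys)" "set (a # ys) = V - {v}" using mp dv(1) ys nbv by auto
    show "{v, x} \<in> E" if "x \<in> V - {v}" for x using hub[OF that] .
    show "4 \<le> length (a # ys)" using leny n by simp
    have s: "successively (face V E v) (a # ys)" 
      using ys(3) by (metis append_Cons successively_append_iff)
    show "{(a # ys) ! i, (a # ys) ! Suc i} \<in> E" if "Suc i < length (a # ys)" for i
      using s that unfolding successively_conv_nth face_def by blast
    have "{last ys, a} \<in> E" using successively_ends(2)[OF ys(3) yne] unfolding face_def by simp
    moreover have "(a # ys) ! (length (a # ys) - 1) = last ys" using yne by (simp add: last_conv_nth)
    ultimately show "{(a # ys) ! 0, (a # ys) ! (length (a # ys) - 1)} \<in> E" by (simp add: insert_commute)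
  qed
  have n4: "4 \<le> card V" using n by linarith
  have len7: "length (a # ys) \<le> 7" using leny n by linarith
  obtain p q s where f: "face V E p q s" "v \<notin> {p, q, s}" "\<And>x. x \<in> V \<Longrightarrow> \<exists>y\<in>{p, q, s}. near E 1 x y"
    using dominating_face[OF len7] by blast
  obtain w where w: "w \<notin> V" using fresh_vertex[OF mp] by auto
  have ext: "extends2 V E (insert w V) (stack E w p q s)"
    by (rule extends2_stack[OF extends2_refl[OF mp dv] f(1) w f(3) n4])
  show ?thesis
  proof (rule extends2_final[OF ext])
    fix x assume x: "x \<in> V"
    show "\<exists>z\<in>insert w V. \<not> near (stack E w p q s) 1 x z"
    proof (cases "x = v")
      case True
      then show ?thesis using stack_not_near[OF sg w dv(1) f(2)] by blast
    next
      case False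
      then obtain y where y: "y \<in> V" "\<not> near E 1 x y" using only[OF x] by auto
      then show ?thesis using isometric_near[OF isometric_stack[OF mp f(1) w] x y(1), of 1] by blast
    qed
  qed
qed

section \<open>Graphs of diameter at least three\<close>

text \<open>If one neighbour of a vertex \<open>u\<close> of degree three has a neighbour beyond
  \<open>u\<close> and its triangle, then all three do. Around \<open>a0\<close> one sees
  \<open>u\<close>, then \<open>y1\<close>, then a nonempty stretch \<open>mid\<close> of outside
  vertices, then \<open>y2\<close>, where \<open>y1\<close>, \<open>y2\<close> are the other
  neighbours of \<open>u\<close>. The faces at both ends of \<open>mid\<close> join
  \<open>y1\<close> and \<open>y2\<close> to outside vertices.\<close>

lemma third_neighbour:
  assumes mp: "mplanar V E" and c3: "card (nb E u) = 3" and a0: "a0 \<in> nb E u"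
    and b0: "{a0, b0} \<in> E" "b0 \<noteq> u" "b0 \<notin> nb E u" and a: "a \<in> nb E u"
  shows "\<exists>b. {a, b} \<in> E \<and> b \<noteq> u \<and> b \<notin> nb E u"
proof (cases "a = a0")
  case True
  then show ?thesis using b0 by blast
next
  case False
  note sg = mplanarD(1)[OF mp]
  have ua0: "u \<in> nb E a0" "b0 \<in> nb E a0" using a0 b0(1) unfolding in_nb by (simp_all add: insert_commute)
  have "card {u, b0} \<le> card (nb E a0)" using ua0 by (intro card_mono finite_nb[OF sg]) auto
  then have n2: "2 \<le> card (nb E a0)" using b0(2) by simp
  have aV: "a0 \<in> V" using nb_sub[OF sg] a0 by auto
  obtain ys where ys: "distinct (u # ys)" "set (u # ys) = nb E a0" "successively (face V E a0) (u # ys @ [u])"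
    by (rule mplanar_rotation[OF mp aV ua0(1) n2])
  have bys: "b0 \<in> set ys" using ys(2) ua0(2) b0(2) by auto
  then have yne: "ys \<noteq> []" by auto
  have "face V E a0 u (hd ys)" "face V E a0 u (last ys)"
    using successively_ends[OF ys(3) yne] face_swap(2) by metis+
  then have hl: "hd ys \<in> nb E u" "last ys \<in> nb E u" unfolding in_nb face_def by auto
  have ha: "hd ys \<noteq> a0" "last ys \<noteq> a0"
    using nb_sub[OF sg, of a0] ys(2) yne hd_in_set[OF yne] last_in_set[OF yne] by auto
  obtain y1 zs where y1: "ys = y1 # zs" using yne by (cases ys) auto
  have "b0 \<noteq> y1" using hl(1) b0(3) unfolding y1 by auto
  then have "zs \<noteq> []" using bys unfolding y1 by auto
  then obtain mid y2 where y2: "zs = mid @ [y2]" by (cases zs rule: rev_cases) auto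
  have ysm: "ys = y1 # mid @ [y2]" using y1 y2 by simp
  have y12: "y1 \<in> nb E u" "y2 \<in> nb E u" "y1 \<noteq> a0" "y2 \<noteq> a0" "y1 \<noteq> y2" using hl ha ys(1) unfolding ysm by auto
  have "b0 \<noteq> y2" using y12 b0(3) by auto
  then have mne: "mid \<noteq> []" using bys \<open>b0 \<noteq> y1\<close> unfolding ysm by auto
  have "card {a0, y1, y2} = 3" using y12 by auto
  moreover have "{a0, y1, y2} \<subseteq> nb E u" using y12 a0 by auto
  ultimately have nbu: "nb E u = {a0, y1, y2}" using c3 finite_nb[OF sg] by (metis card_subset_eq)
  have mid: "b \<noteq> u \<and> b \<notin> nb E u" if "b \<in> set mid" for b
  proof -
    have "b \<noteq> a0" using that ys(2) nb_sub[OF sg, of a0] unfolding ysm by auto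
    moreover have "b \<noteq> y1" "b \<noteq> y2" "b \<noteq> u" using that ys(1) unfolding ysm by auto
    ultimately show ?thesis unfolding nbu by auto
  qed
  have fs: "face V E a0 y1 (hd mid)" "face V E a0 (last mid) y2"
    using ys(3) mne unfolding ysm by (auto simp: successively_append_iff successively_Cons)
  have "a = y1 \<or> a = y2" using a False unfolding nbu by auto
  then show ?thesis
  proof
    assume "a = y1"
    then show ?thesis using fs(1) mid[OF hd_in_set[OF mne]] unfolding face_def by blast
  next
    assume "a = y2"
    then show ?thesis using fs(2) mid[OF last_in_set[OF mne]] unfolding face_def by (metis insert_commute)
  qed
qed

text \<open>Unlike in \<open>extends2\<close>, lower bounds for new vertices are not part of the
  invariant; in \<open>diameter_three\<close> they come from the pair \<open>z1\<close>,
  \<open>z2\<close>.\<close>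

definition extends3 :: "'a set \<Rightarrow> 'a set set \<Rightarrow> 'a set \<Rightarrow> 'a set set \<Rightarrow> bool" where
  "extends3 V E V' E' \<longleftrightarrow> isometric V E V' E' \<and> (\<forall>h\<in>V. \<forall>y\<in>V'. near E' 3 h y)"

text \<open>A tower of four stacked vertices on a face; its top \<open>z\<close> has distance two from the face.\<close>

lemma tower:
  fixes V :: "nat set"
  assumes ext: "extends3 V E V' E'" and f: "face V' E' a b q" and ab: "a \<in> V" "b \<in> V"
    and dom: "\<And>h. h \<in> V \<Longrightarrow> near E' 1 h a \<or> near E' 1 h b"
  obtains V4 E4 z where "extends3 V E V4 E4" "isometric V' E' V4 E4" "z \<in> V4"
    "\<And>c. c \<in> V' \<Longrightarrow> c \<notin> {a, b, q} \<Longrightarrow> \<not> near E4 2 c z" "\<And>c. c \<in> V' \<Longrightarrow> \<not> near E4 1 c z"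
    "\<And>y x. y \<in> V4 - V' \<Longrightarrow> x \<in> V' \<Longrightarrow> \<not> near E' 1 a x \<Longrightarrow> \<not> near E' 1 b x \<Longrightarrow> \<not> near E' 1 q x \<Longrightarrow> \<not> near E4 2 y x"
proof -
  have iso: "isometric V E V' E'" using ext unfolding extends3_def by simp
  then have mp: "mplanar V' E'" and VV: "V \<subseteq> V'" unfolding isometric_def by auto
  note sg = mplanarD(1)[OF mp]
  \<comment> \<open>The corners \<open>q\<close>, \<open>b\<close>, \<open>a\<close> drop out one
    after the other while \<open>w1\<close> stays in every later face. So the last face consists of
    new vertices, and \<open>w1\<close> is adjacent to all the others.\<close>
  obtain w1 where w1: "w1 \<notin> V'" using fresh_vertex[OF mp] by auto
  define V1 E1 where "V1 = insert w1 V'" and "E1 = stack E' w1 a b q"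
  have i1: "isometric V' E' V1 E1" unfolding V1_def E1_def by (rule isometric_stack[OF mp f w1])
  have f1: "face V1 E1 w1 a b" unfolding V1_def E1_def by (rule stack_face[OF mp f w1])
  have mp1: "mplanar V1 E1" using i1 unfolding isometric_def by simp
  obtain w2 where w2: "w2 \<notin> V1" using fresh_vertex[OF mp1] by auto
  define V2 E2 where "V2 = insert w2 V1" and "E2 = stack E1 w2 w1 a b"
  have i2: "isometric V1 E1 V2 E2" unfolding V2_def E2_def by (rule isometric_stack[OF mp1 f1 w2])
  have f2: "face V2 E2 w2 w1 a" unfolding V2_def E2_def by (rule stack_face[OF mp1 f1 w2])
  have mp2: "mplanar V2 E2" using i2 unfolding isometric_def by simp
  obtain w3 where w3: "w3 \<notin> V2" using fresh_vertex[OF mp2] by auto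
  define V3 E3 where "V3 = insert w3 V2" and "E3 = stack E2 w3 w2 w1 a"
  have i3: "isometric V2 E2 V3 E3" unfolding V3_def E3_def by (rule isometric_stack[OF mp2 f2 w3])
  have f3: "face V3 E3 w3 w2 w1" unfolding V3_def E3_def by (rule stack_face[OF mp2 f2 w3])
  have mp3: "mplanar V3 E3" using i3 unfolding isometric_def by simp
  obtain w4 where w4: "w4 \<notin> V3" using fresh_vertex[OF mp3] by auto
  define V4 E4 where "V4 = insert w4 V3" and "E4 = stack E3 w4 w3 w2 w1"
  have i4: "isometric V3 E3 V4 E4" unfolding V4_def E4_def by (rule isometric_stack[OF mp3 f3 w4])
  have isoG: "isometric V' E' V4 E4" using isometric_trans i1 i2 i3 i4 by metis
  have abq: "a \<in> V'" "b \<in> V'" "q \<in> V'" using face_vertices[OF sg f] by auto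
  have V4: "V4 = V' \<union> {w1, w2, w3, w4}" unfolding V4_def V3_def V2_def V1_def by auto
  have wn: "w1 \<notin> V'" "w2 \<notin> V'" "w3 \<notin> V'" "w4 \<notin> V'" "distinct [w1, w2, w3, w4]"
    using w1 w2 w3 w4 unfolding V3_def V2_def V1_def by auto
  have E4: "E4 = E' \<union> {{w1, a}, {w1, b}, {w1, q}, {w2, w1}, {w2, a}, {w2, b}, {w3, w2}, {w3, w1}, {w3, a},
      {w4, w3}, {w4, w2}, {w4, w1}}"
    unfolding E4_def E3_def E2_def E1_def stack_def by auto
  have oldE: "{y, c} \<notin> E'" if "y \<notin> V'" for y c using sgraph_sub[OF sg] that by auto
  have link: "c \<in> {a, b, q}" if y: "y \<in> {w1, w2, w3, w4}" and c: "c \<in> V'" and e: "{y, c} \<in> E4" for y c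
  proof -
    have "y \<notin> V'" using y wn by auto
    then have "{y, c} \<in> {{w1, a}, {w1, b}, {w1, q}, {w2, w1}, {w2, a}, {w2, b}, {w3, w2}, {w3, w1}, {w3, a},
      {w4, w3}, {w4, w2}, {w4, w1}}" using e oldE unfolding E4 by auto
    moreover have "c \<noteq> w1" "c \<noteq> w2" "c \<noteq> w3" "c \<noteq> w4" using c wn by auto
    ultimately show ?thesis by (auto simp: doubleton_eq_iff)
  qed
  have top: "{w4, c} \<notin> E4" if c: "c \<in> V'" for c
  proof
    assume "{w4, c} \<in> E4"
    then have "{w4, c} \<in> {{w1, a}, {w1, b}, {w1, q}, {w2, w1}, {w2, a}, {w2, b}, {w3, w2}, {w3, w1}, {w3, a},
      {w4, w3}, {w4, w2}, {w4, w1}}" using oldE wn unfolding E4 by auto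
    moreover have "c \<noteq> w1" "c \<noteq> w2" "c \<noteq> w3" "c \<noteq> w4" "w4 \<noteq> a" "w4 \<noteq> b" "w4 \<noteq> q" using c wn abq by auto
    ultimately show False using wn(5) by (auto simp: doubleton_eq_iff)
  qed
  have n1: "\<not> near E4 1 c w4" if "c \<in> V'" for c
    using top[OF that] that wn(4) unfolding near_1 by (auto simp: insert_commute)
  have subE: "E' \<subseteq> E4" unfolding E4 by auto
  have near3: "near E4 3 h y" if h: "h \<in> V" and y: "y \<in> V4" for h y
  proof (cases "y \<in> V'")
    case True
    then show ?thesis using ext h near_subgraph[OF _ subE] unfolding extends3_def by blast
  next
    case False
    have "near E4 1 h a \<or> near E4 1 h b" using dom[OF h] near_subgraph[OF _ subE] by blast
    then obtain p where p: "near E4 1 h p" "p = a \<or> p = b" by blast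
    have "{w1, a} \<in> E4" "{w1, b} \<in> E4" "{w2, w1} \<in> E4" "{w3, w1} \<in> E4" "{w4, w1} \<in> E4" unfolding E4 by simp_all
    then have e: "{a, w1} \<in> E4" "{b, w1} \<in> E4" "{w1, w2} \<in> E4" "{w1, w3} \<in> E4" "{w1, w4} \<in> E4"
      by (simp_all add: insert_commute)
    have "{p, w1} \<in> E4" using p(2) e(1,2) by metis
    then have "near E4 1 p w1" unfolding near_1 ..
    moreover have "y = w1 \<or> y = w2 \<or> y = w3 \<or> y = w4" using False y unfolding V4 by blast
    then have "near E4 1 w1 y" unfolding near_1 using e(3-5) by metis
    ultimately have "near E4 2 p y" unfolding near_2 by (intro exI conjI)
    then have "near E4 (1 + 2) h y" by (rule near_add[OF p(1)])
    then show ?thesis by (simp add: numeral_3_eq_3)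
  qed
  have mp4: "mplanar V4 E4" using isoG unfolding isometric_def by simp
  have closed: "y \<in> V4" if "near E4 1 x y" "x \<in> V4" for x y
    using that sgraph_edge[OF mplanarD(1)[OF mp4]] unfolding near_1 by metis
  have subV: "V' \<subseteq> V4" unfolding V4 by (rule Un_upper1)
  have far4: "\<not> near E4 2 c w4" if c: "c \<in> V'" "c \<notin> {a, b, q}" for c
  proof
    assume "near E4 2 c w4"
    then obtain d where d: "near E4 1 c d" "near E4 1 d w4" unfolding near_2 by blast
    have "d \<in> V4" using closed[OF d(1)] c(1) subV by (simp add: subsetD)
    moreover have "d \<notin> V'" using n1 d(2) by blast
    ultimately have dw: "d \<in> {w1, w2, w3, w4}" unfolding V4 by blast
    have "c \<noteq> d" using \<open>d \<notin> V'\<close> c(1) by metis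
    then have "{d, c} \<in> E4" using d(1) unfolding near_1 by (simp add: insert_commute)
    then show False using link[OF dw c(1)] c(2) by blast
  qed
  \<comment> \<open>Consider the middle vertex \<open>d\<close> of a connection with two steps. If
    it is old, it is a corner of the face within one of \<open>x\<close>; if it is new, then
    \<open>x\<close> is itself a corner.\<close>
  have far_new: "\<not> near E4 2 y x" if y: "y \<in> V4 - V'" and x: "x \<in> V'"
    and nx: "\<not> near E' 1 a x" "\<not> near E' 1 b x" "\<not> near E' 1 q x" for y x
  proof
    assume "near E4 2 y x"
    then obtain d where d: "near E4 1 y d" "near E4 1 d x" unfolding near_2 by blast
    have yw: "y \<in> {w1, w2, w3, w4}" using y unfolding V4 by blast
    have xF: "x \<notin> {a, b, q}" using nx near_refl[of E' 1 x] by (metis empty_iff insert_iff)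
    show False
    proof (cases "d \<in> V'")
      case True
      then have "y \<noteq> d" using y by blast
      then have "{y, d} \<in> E4" using d(1) unfolding near_1 by blast
      then have "d \<in> {a, b, q}" using link[OF yw True] by blast
      moreover have "near E' 1 d x" using d(2) isometric_near[OF isoG True x] by blast
      ultimately show False using nx by blast
    next
      case False
      have "d \<in> V4" using closed[OF d(1)] y by simp
      then have dw: "d \<in> {w1, w2, w3, w4}" using False unfolding V4 by blast
      have "d \<noteq> x" using False x by blast
      then have "{d, x} \<in> E4" using d(2) unfolding near_1 by blast
      then show False using link[OF dw x] xF by blast
    qed
  qed
  have "extends3 V E V4 E4" unfolding extends3_def using isometric_trans[OF iso isoG] near3 by blast
  then show ?thesis using that[of V4 E4 w4] isoG far4 n1 far_new unfolding V4 by blast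
qed

text \<open>Two towers come first; their tops \<open>z1\<close> and \<open>z2\<close> have no
  neighbours in \<open>V\<close> and are more than two apart. Then each vertex \<open>c\<close>
  present so far, including those of the two towers, receives a tower over a face that avoids
  \<open>c\<close>, whose top is more than two away from \<open>c\<close>. All vertices of these
  later towers are too far from \<open>z1\<close> or from \<open>z2\<close>.\<close>

lemma diameter_three:
  fixes V :: "nat set"
  assumes mp: "mplanar V E" and n: "card V \<le> 8" and ut: "u \<in> V" "t \<in> V" and far: "\<not> near E 2 u t"
  shows "centrally_embeddable V E"
proof -
  note sg = mplanarD(1)[OF mp]
  have finV: "finite V" using sg unfolding sgraph_def by simp
  have nut: "u \<noteq> t" "{u, t} \<notin> E"
    using far near_refl near_mono[of E 1 u t 2] unfolding near_1 by auto
  have n4: "4 \<le> card V" using mplanar_small_complete[OF mp _ ut nut(1)] nut(2) by (meson nle_le)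
  define A where "A = nb E u"
  define B where "B = nb E t"
  have tA: "t \<notin> A" and uB: "u \<notin> B" unfolding A_def B_def in_nb using nut(2) by (auto simp: insert_commute)
  have dis: "A \<inter> B = {}"
  proof -
    have False if "x \<in> A" "x \<in> B" for x
    proof -
      have "near E 1 u x" "near E 1 x t" using that unfolding A_def B_def in_nb near_1 by (auto simp: insert_commute)
      then show False using far unfolding near_2 by blast
    qed
    then show ?thesis by blast
  qed
  have subAB: "A \<union> B \<subseteq> V - {u, t}" using nb_sub[OF sg, of u] nb_sub[OF sg, of t] tA uB unfolding A_def B_def by auto
  have fin: "finite A" "finite B" unfolding A_def B_def by (rule finite_nb[OF sg])+
  have c3: "3 \<le> card A" "3 \<le> card B" unfolding A_def B_def using mplanar_degree[OF mp n4] ut by auto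
  have "card (A \<union> B) = card A + card B" using card_Un_disjoint fin dis by metis
  moreover have "card (V - {u, t}) = card V - 2" using ut nut(1) finV by (simp add: card_Diff_subset)
  moreover have "card (A \<union> B) \<le> card (V - {u, t})" by (rule card_mono[OF _ subAB]) (use finV in simp)
  \<comment> \<open>\<open>V - {u, t}\<close> has at most six elements and contains two disjoint
    sets of at least three, so all these inequalities are equalities.\<close>
  ultimately have cA: "card A = 3" and cB: "card B = 3" and "card (A \<union> B) = card (V - {u, t})" using c3 n by auto
  then have AB: "A \<union> B = V - {u, t}" using card_subset_eq[OF _ subAB] finV by simp
  have inV: "a \<in> V" if "a \<in> A \<union> B" for a using that unfolding AB by simp
  have clique: "near E 1 x y" if "x \<in> A \<and> y \<in> A \<or> x \<in> B \<and> y \<in> B" for x y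
  proof (cases "x = y")
    case False
    then have "face V E u x y \<or> face V E t x y"
      using that degree_three[OF mp ut(1) cA[unfolded A_def]] degree_three[OF mp ut(2) cB[unfolded B_def]]
      unfolding A_def B_def by blast
    then show ?thesis unfolding face_def near_1 by blast
  qed (simp add: near_refl)
  have V_cases: "h = u \<or> h = t \<or> h \<in> A \<or> h \<in> B" if "h \<in> V" for h using that AB by blast
  obtain a0 b0 where ab0: "a0 \<in> insert u A" "b0 \<in> insert t B" "{a0, b0} \<in> E"
    by (rule mplanar_cut_edge[OF mp, of "insert u A" "insert t B"]) (use AB ut nut(1) tA uB dis in auto)
  have "a0 \<noteq> u"
  proof
    assume "a0 = u"
    then have "b0 \<in> A" using ab0(3) unfolding A_def in_nb by simp
    then show False using ab0(2) tA dis by blast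
  qed
  then have a0A: "a0 \<in> A" using ab0(1) by simp
  have "b0 \<noteq> t"
  proof
    assume "b0 = t"
    then have "a0 \<in> B" using ab0(3) unfolding B_def in_nb by (simp add: insert_commute)
    then show False using a0A dis by blast
  qed
  then have b0B: "b0 \<in> B" using ab0(2) by simp
  have A_to_B: "\<exists>b\<in>B. {a, b} \<in> E" if a: "a \<in> A" for a
  proof -
    have "b0 \<noteq> u" "b0 \<notin> A" using b0B uB dis by auto
    then obtain b where b: "{a, b} \<in> E" "b \<noteq> u" "b \<notin> A"
      using third_neighbour[OF mp cA[unfolded A_def] a0A[unfolded A_def] ab0(3) _ _ a[unfolded A_def]] unfolding A_def by blast
    have "b \<noteq> t"
    proof
      assume "b = t"
      then have "a \<in> B" using b(1) unfolding B_def in_nb by (simp add: insert_commute)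
      then show False using a dis by blast
    qed
    then show ?thesis using b V_cases[of b] sgraph_edge[OF sg b(1)] by blast
  qed
  have B_to_A: "\<exists>a\<in>A. {a, b} \<in> E" if b: "b \<in> B" for b
  proof -
    have "a0 \<noteq> t" "a0 \<notin> B" using a0A tA dis by auto
    moreover have "{b0, a0} \<in> E" using ab0(3) by (simp add: insert_commute)
    ultimately obtain a where a: "{b, a} \<in> E" "a \<noteq> t" "a \<notin> B"
      using third_neighbour[OF mp cB[unfolded B_def] b0B[unfolded B_def] _ _ _ b[unfolded B_def]] unfolding B_def by blast
    have "a \<noteq> u"
    proof
      assume "a = u"
      then have "b \<in> A" using a(1) unfolding A_def in_nb by (simp add: insert_commute)
      then show False using b dis by blast
    qed
    then have "a \<in> A" using a V_cases[of a] sgraph_edge[OF sg a(1)] by blast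
    then show ?thesis using a(1) by (metis insert_commute)
  qed
  have dom: "near E 1 h a \<or> near E 1 h b" if "h \<in> V" "a \<in> A" "b \<in> B" for h a b
    using V_cases[OF that(1)] that(2,3) clique[of h a] clique[of h b] unfolding A_def B_def in_nb near_1 by blast
  have near3: "near E 3 h y" if h: "h \<in> V" and y: "y \<in> V" for h y
  proof -
    obtain b where b: "b \<in> B" "{a0, b} \<in> E" using A_to_B[OF a0A] by blast
    have ha: "near E 1 h a0 \<or> near E 1 h b" "near E 1 y a0 \<or> near E 1 y b" using dom[OF _ a0A b(1)] h y by blast+
    have ab: "near E 1 a0 b" using b(2) unfolding near_1 by blast
    have pp: "near E 1 p p'" if "p \<in> {a0, b}" "p' \<in> {a0, b}" for p p'
      using that ab near_sym[OF ab] near_refl by (metis empty_iff insert_iff)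
    obtain p where p: "p \<in> {a0, b}" "near E 1 h p" using ha(1) by blast
    obtain p' where p': "p' \<in> {a0, b}" "near E 1 y p'" using ha(2) by blast
    from p(2) pp[OF p(1) p'(1)] near_sym[OF p'(2)]
    have "near E (1 + (1 + 1)) h y" by (intro near_add)
    then show ?thesis by (simp add: numeral_3_eq_3)
  qed
  have pick: "\<exists>a\<in>A. \<exists>b\<in>B. {a, b} \<in> E \<and> c \<noteq> a \<and> c \<noteq> b" for c
  proof (cases "c \<in> B")
    case True
    have "card (B - {c}) \<noteq> 0" using cB fin True by simp
    then obtain b where b: "b \<in> B" "b \<noteq> c" using fin by (metis DiffE card.empty equals0I singletonI)
    obtain a where "a \<in> A" "{a, b} \<in> E" using B_to_A[OF b(1)] by blast
    then show ?thesis using b True dis by blast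
  next
    case False
    have "1 < card A" using cA by simp
    then have "\<not> A \<subseteq> {c}" using card_mono[of "{c}" A] by auto
    then obtain a where a: "a \<in> A" "a \<noteq> c" by blast
    obtain b where "b \<in> B" "{a, b} \<in> E" using A_to_B[OF a(1)] by blast
    then show ?thesis using a False by blast
  qed
  define remote where "remote V' E' z \<longleftrightarrow> z \<in> V' \<and> (\<forall>h\<in>V. \<not> near E' 1 h z)" for V' E' z
  have step: "\<exists>V4 E4 z. extends3 V E V4 E4 \<and> isometric V' E' V4 E4 \<and> remote V4 E4 z \<and> (c \<in> V' \<longrightarrow> \<not> near E4 2 c z) \<and>
      (\<forall>z1 z2. remote V' E' z1 \<longrightarrow> remote V' E' z2 \<longrightarrow> \<not> near E' 2 z1 z2 \<longrightarrow>
         (\<forall>y\<in>V4 - V'. \<not> near E4 2 y z1 \<or> \<not> near E4 2 y z2))"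
    if ext: "extends3 V E V' E'" for V' E' c
  proof -
    have iso: "isometric V E V' E'" using ext unfolding extends3_def by simp
    then have mp': "mplanar V' E'" and VV: "V \<subseteq> V'" "E \<subseteq> E'" unfolding isometric_def by auto
    note sg' = mplanarD(1)[OF mp']
    obtain a b where ab: "a \<in> A" "b \<in> B" "{a, b} \<in> E" "c \<noteq> a" "c \<noteq> b" using pick by blast
    have abV: "a \<in> V" "b \<in> V" using inV ab by blast+
    have "nb E a \<subseteq> nb E' a" using VV(2) unfolding nb_def by blast
    then have "3 \<le> card (nb E' a)" using mplanar_degree[OF mp n4 abV(1)] card_mono[OF finite_nb[OF sg'], of "nb E a" a] by linarith
    have ba: "b \<in> nb E' a" using ab(3) VV(2) unfolding in_nb by blast
    have aV': "a \<in> V'" using abV VV by blast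
    have "2 \<le> card (nb E' a)" using \<open>3 \<le> card (nb E' a)\<close> by linarith
    then obtain ys where ys: "distinct (b # ys)" "set (b # ys) = nb E' a" "successively (face V' E' a) (b # ys @ [b])"
      by (rule mplanar_rotation[OF mp' aV' ba])
    have len: "3 \<le> length (b # ys)" using ys(1,2) \<open>3 \<le> card (nb E' a)\<close> by (metis distinct_card)
    then have yne: "ys \<noteq> []" by auto
    \<comment> \<open>The edge \<open>ab\<close> lies on two faces, and their third corners differ
      because \<open>a\<close> has degree at least three. So one of the two corners is not
      \<open>c\<close>.\<close>
    have "hd ys \<noteq> last ys"
      using len ys(1) by (cases ys; cases "tl ys") auto
    then obtain q where q: "q = hd ys \<or> q = last ys" "q \<noteq> c" by blast
    have f: "face V' E' a b q"
      using q(1) successively_ends(1)[OF ys(3) yne] face_swap(2)[OF successively_ends(2)[OF ys(3) yne]] by metis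
    have dom': "near E' 1 h a \<or> near E' 1 h b" if "h \<in> V" for h
      using dom[OF that ab(1,2)] near_subgraph[OF _ VV(2)] by blast
    obtain V4 E4 z where T: "extends3 V E V4 E4" "isometric V' E' V4 E4" "z \<in> V4"
      "\<And>c. c \<in> V' \<Longrightarrow> c \<notin> {a, b, q} \<Longrightarrow> \<not> near E4 2 c z" "\<And>c. c \<in> V' \<Longrightarrow> \<not> near E4 1 c z"
      "\<And>y x. y \<in> V4 - V' \<Longrightarrow> x \<in> V' \<Longrightarrow> \<not> near E' 1 a x \<Longrightarrow> \<not> near E' 1 b x \<Longrightarrow> \<not> near E' 1 q x \<Longrightarrow> \<not> near E4 2 y x"
      using tower[OF ext f abV dom'] by blast
    have "remote V4 E4 z" unfolding remote_def using T(3,5) VV(1) by blast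
    moreover have "c \<in> V' \<longrightarrow> \<not> near E4 2 c z" using T(4)[of c] ab(4,5) q(2) by blast
    moreover have "\<not> near E4 2 y z1 \<or> \<not> near E4 2 y z2"
      if z: "remote V' E' z1" "remote V' E' z2" "\<not> near E' 2 z1 z2" and y: "y \<in> V4 - V'" for z1 z2 y
    proof -
      \<comment> \<open>A tower vertex within two of a remote vertex must reach it through
        \<open>q\<close>, since \<open>a\<close> and \<open>b\<close> lie in \<open>V\<close>. Being
        so close to both \<open>z1\<close> and \<open>z2\<close> would put these within two of each
        other.\<close>
      have "\<not> (near E' 1 q z1 \<and> near E' 1 q z2)" using z(3) near_sym[of E' 1 q z1] unfolding near_2 by metis
      moreover have "z1 \<in> V'" "z2 \<in> V'" "\<not> near E' 1 a z1" "\<not> near E' 1 b z1" "\<not> near E' 1 a z2" "\<not> near E' 1 b z2"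
        using z(1,2) abV unfolding remote_def by blast+
      ultimately show ?thesis using T(6)[OF y] by blast
    qed
    ultimately show ?thesis using T(1,2) by blast
  qed
  have mpD: "V \<subseteq> V'" if "extends3 V E V' E'" for V' E' using that unfolding extends3_def isometric_def by blast
  have remote_mono: "remote V'' E'' z" if "isometric V' E' V'' E''" "extends3 V E V' E'" "remote V' E' z" for V' E' V'' E'' z
    using that(3) isometric_near[OF that(1)] mpD[OF that(2)] that(1) unfolding remote_def isometric_def by blast
  have ext0: "extends3 V E V E" unfolding extends3_def using isometric_refl[OF mp] near3 by blast
  obtain V1 E1 z1 where s1: "extends3 V E V1 E1" "remote V1 E1 z1"
    using step[OF ext0] by blast
  \<comment> \<open>The second tower stands on a face that avoids \<open>z1\<close>, which keeps its
    top more than two away from \<open>z1\<close>.\<close>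
  obtain V2 E2 z2 where s2: "extends3 V E V2 E2" "isometric V1 E1 V2 E2" "remote V2 E2 z2" "\<not> near E2 2 z1 z2"
    using step[OF s1(1), of z1] s1(2) unfolding remote_def by blast
  have z1: "remote V2 E2 z1" by (rule remote_mono[OF s2(2) s1])
  have mp2: "mplanar V2 E2" using s2(2) unfolding isometric_def by blast
  have finV2: "finite V2" using mplanarD(1)[OF mp2] unfolding sgraph_def by simp
  \<comment> \<open>The vertices to be served are those of \<open>V2\<close>, not only those of
    \<open>V\<close>; vertices added during the induction are covered by \<open>z1\<close> and
    \<open>z2\<close>.\<close>
  have "\<exists>V' E'. extends3 V E V' E' \<and> isometric V2 E2 V' E' \<and> (\<forall>y\<in>(V' - V2) \<union> X. \<exists>z\<in>V'. \<not> near E' 2 y z)"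
    if "finite X" "X \<subseteq> V2" for X
    using that
  proof (induction X rule: finite_induct)
    case empty
    show ?case using s2(1) isometric_refl[OF mp2] by blast
  next
    case (insert c X)
    then obtain V' E' where I: "extends3 V E V' E'" "isometric V2 E2 V' E'"
      "\<And>y. y \<in> (V' - V2) \<union> X \<Longrightarrow> \<exists>z\<in>V'. \<not> near E' 2 y z" by blast
    obtain V4 E4 z where s: "extends3 V E V4 E4" "isometric V' E' V4 E4" "remote V4 E4 z" "c \<in> V' \<longrightarrow> \<not> near E4 2 c z"
      "\<And>z1 z2 y. remote V' E' z1 \<Longrightarrow> remote V' E' z2 \<Longrightarrow> \<not> near E' 2 z1 z2 \<Longrightarrow> y \<in> V4 - V' \<Longrightarrow>
         \<not> near E4 2 y z1 \<or> \<not> near E4 2 y z2"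
      using step[OF I(1), of c] by blast
    have V2V': "V2 \<subseteq> V'" and V'V4: "V' \<subseteq> V4" using I(2) s(2) unfolding isometric_def by blast+
    have p: "remote V' E' z1" "remote V' E' z2" using remote_mono[OF I(2) s2(1)] z1 s2(3) by blast+
    have z12: "z1 \<in> V2" "z2 \<in> V2" using z1 s2(3) unfolding remote_def by blast+
    have nz: "\<not> near E' 2 z1 z2" using isometric_near[OF I(2) z12] s2(4) by blast
    have "\<exists>z\<in>V4. \<not> near E4 2 y z" if y: "y \<in> (V4 - V2) \<union> insert c X" for y
    proof -
      consider "y = c" | "y \<in> (V' - V2) \<union> X" | "y \<in> V4 - V'" using y by blast
      then show ?thesis
      proof cases
        case 1
        then show ?thesis using s(3,4) insert.prems V2V' unfolding remote_def by blast
      next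
        case 2
        then obtain x where x: "x \<in> V'" "\<not> near E' 2 y x" using I(3) by blast
        have "y \<in> V'" using 2 insert.prems V2V' by blast
        then show ?thesis using isometric_near[OF s(2) _ x(1)] x V'V4 by blast
      next
        case 3
        then show ?thesis using s(5)[OF p nz] z12 V2V' V'V4 by blast
      qed
    qed
    then show ?case using s(1) isometric_trans[OF I(2) s(2)] by blast
  qed
  from this[OF finV2 order_refl]
  obtain V' E' where F: "extends3 V E V' E'" "isometric V2 E2 V' E'" "\<forall>y\<in>(V' - V2) \<union> V2. \<exists>z\<in>V'. \<not> near E' 2 y z" by blast
  show ?thesis
  proof (rule centrally_embeddableI[of V E V' E' 2])
    show "isometric V E V' E'" using F(1) unfolding extends3_def by simp
    have "Suc 2 = (3::nat)" by simp
    then show "near E' (Suc 2) h y" if "h \<in> V" "y \<in> V'" for h y using F(1) that unfolding extends3_def by metis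
    show "\<exists>z\<in>V'. \<not> near E' 2 y z" if "y \<in> V'" for y using F(3) that by blast
  qed
qed

lemma small_centrally_embeddable:
  fixes V :: "nat set"
  assumes mp: "mplanar V E" and n: "card V \<le> 8"
  shows "centrally_embeddable V E"
proof (cases "\<exists>u\<in>V. \<exists>t\<in>V. \<not> near E 2 u t")
  case True
  then show ?thesis using diameter_three[OF mp n] by blast
next
  case False
  then have all2: "near E 2 u t" if "u \<in> V" "t \<in> V" for u t using that by blast
  define D where "D = {v \<in> V. \<forall>y\<in>V. near E 1 v y}"
  have finV: "finite V" using mplanarD(1)[OF mp] unfolding sgraph_def by simp
  \<comment> \<open>\<open>D\<close> collects the dominating vertices. The radius of the host graph
    is 0 for at most one vertex, 1 for the other complete graphs and 2 in the remaining
    cases.\<close>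
  consider "D = V" "card V \<le> 1" | "D = V" "2 \<le> card V" | "D = {}" "V \<noteq> {}" | v where "D = {v}" "D \<noteq> V"
    | d1 d2 where "d1 \<in> D" "d2 \<in> D" "d1 \<noteq> d2" "D \<noteq> V"
  proof -
    consider "D = {}" | v where "D = {v}" | d1 d2 where "d1 \<in> D" "d2 \<in> D" "d1 \<noteq> d2" by blast
    moreover have "D = V \<Longrightarrow> card V \<le> 1 \<or> 2 \<le> card V" by linarith
    ultimately show ?thesis using that by (metis card.empty le0)
  qed
  then show ?thesis
  proof cases
    case 1
    have "x = y" if "x \<in> V" "y \<in> V" for x y using that 1(2) finV card_le_Suc0_iff_eq by (metis One_nat_def)
    then show ?thesis unfolding centrally_embeddable_def
      by (intro exI[of _ V] exI[of _ E] exI[of _ 0]) (use mp \<open>\<And>x y. x \<in> V \<Longrightarrow> y \<in> V \<Longrightarrow> x = y\<close> in \<open>auto simp: near.simps\<close>)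
  next
    case 2
    show ?thesis
    proof (rule centrally_embeddableI[OF isometric_refl[OF mp], of 0])
      show "near E (Suc 0) h y" if "h \<in> V" "y \<in> V" for h y
        using that 2(1) unfolding D_def One_nat_def by blast
      show "\<exists>z\<in>V. \<not> near E 0 y z" if "y \<in> V" for y
      proof -
        have "\<not> V \<subseteq> {y}" using 2(2) card_mono[of "{y}" V] by auto
        then show ?thesis by (auto simp: near.simps)
      qed
    qed
  next
    case 3
    show ?thesis
    proof (rule centrally_embeddableI[OF isometric_refl[OF mp], of 1])
      show "near E (Suc 1) h y" if "h \<in> V" "y \<in> V" for h y using all2[OF that] unfolding Suc_1 .
      show "\<exists>z\<in>V. \<not> near E 1 y z" if "y \<in> V" for y using that 3(1) unfolding D_def by blast
    qed
  next
    case 4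
    then have v: "v \<in> V" "\<And>y. y \<in> V \<Longrightarrow> near E 1 v y" unfolding D_def by blast+
    have only: "\<exists>y\<in>V. \<not> near E 1 x y" if "x \<in> V" "x \<noteq> v" for x using that 4(1) unfolding D_def by blast
    \<comment> \<open>Graphs with at most four vertices are complete, which would give
      \<open>D = V\<close>.\<close>
    have "5 \<le> card V"
    proof (rule ccontr)
      assume "\<not> 5 \<le> card V"
      then have "near E 1 x y" if "x \<in> V" "y \<in> V" for x y
        using mplanar_small_complete[OF mp _ that] near_refl unfolding near_1 by fastforce
      then show False using 4(2) unfolding D_def by blast
    qed
    then show ?thesis using one_dominating[OF mp _ n v only] by blast
  next
    case 5
    then have d: "d1 \<in> V" "d2 \<in> V" "d1 \<noteq> d2" "\<And>y. y \<in> V \<Longrightarrow> near E 1 d1 y" "\<And>y. y \<in> V \<Longrightarrow> near E 1 d2 y"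
      unfolding D_def by blast+
    have "5 \<le> card V"
    proof (rule ccontr)
      assume "\<not> 5 \<le> card V"
      then have "near E 1 x y" if "x \<in> V" "y \<in> V" for x y
        using mplanar_small_complete[OF mp _ that] near_refl unfolding near_1 by fastforce
      then show False using 5(4) unfolding D_def by blast
    qed
    then show ?thesis using two_dominating[OF mp _ d] by blast
  qed
qed

section \<open>Transfer to pair graphs\<close>

lemma pair_graph_sgraph:
  assumes "pair_graph G"
  shows "sgraph (pverts G) (edges G)"
proof -
  interpret pair_graph G by fact
  show ?thesis unfolding sgraph_def edges_def
    using pair_finite_verts in_arcsD1 in_arcsD2 pair_no_loops by fastforce
qed

lemma pair_graph_edge_iff:
  assumes "pair_graph G"
  shows "{u, v} \<in> edges G \<longleftrightarrow> (u, v) \<in> parcs G"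
proof -
  interpret pair_graph G by fact
  have "(b, a) \<in> parcs G" if "(a, b) \<in> parcs G" for a b
    using pair_sym_arcs that unfolding symmetric_def by (auto dest: symD)
  then show ?thesis unfolding edges_def by (auto simp: doubleton_eq_iff)
qed

text \<open>\<open>plane_drawing\<close> labels arcs by edges of \<open>G\<close>, while
  \<open>plane_graph\<close> labels them by pairs of points. As \<open>p\<close> is injective on the
  vertices, the labels can be exchanged.\<close>

lemma planar_iff_drawable:
  assumes sg: "sgraph (pverts G) (edges G)"
  shows "planar G \<longleftrightarrow> drawable (pverts G) (edges G)"
proof
  assume "planar G"
  then obtain p \<gamma> where pd: "plane_drawing G p \<gamma>" unfolding planar_def by auto
  then have inj: "inj_on p (pverts G)"
    and e1: "\<And>e. e \<in> edges G \<Longrightarrow> arc (\<gamma> e) \<and> {pathstart (\<gamma> e), pathfinish (\<gamma> e)} = p ` e \<and>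
        path_image (\<gamma> e) \<inter> p ` pverts G = p ` e"
    and e2: "\<And>e f. e \<in> edges G \<Longrightarrow> f \<in> edges G \<Longrightarrow> e \<noteq> f \<Longrightarrow> path_image (\<gamma> e) \<inter> path_image (\<gamma> f) = p ` (e \<inter> f)"
    unfolding plane_drawing_def by auto
  define A where "A f = path_image (\<gamma> (the_inv_into (pverts G) p ` f))" for f
  have A: "A (p ` e) = path_image (\<gamma> e)" if "e \<in> edges G" for e
  proof -
    have "the_inv_into (pverts G) p ` p ` e = e"
      using sgraph_sub[OF sg that] the_inv_into_f_f[OF inj] by force
    then show ?thesis unfolding A_def by simp
  qed
  have "plane_graph (p ` pverts G) ((`) p ` edges G) A"
  proof
    show "finite (p ` pverts G)" using sg unfolding sgraph_def by simp
    fix e' assume "e' \<in> (`) p ` edges G"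
    then obtain e where e: "e \<in> edges G" "e' = p ` e" by auto
    obtain a b where ab: "e = {a, b}" "a \<in> pverts G" "b \<in> pverts G" using sg e(1) unfolding sgraph_def by metis
    have "is_arc (A e') (pathstart (\<gamma> e)) (pathfinish (\<gamma> e))"
      unfolding is_arc_def e(2) A[OF e(1)] using e1[OF e(1)] by blast
    moreover have "{pathstart (\<gamma> e), pathfinish (\<gamma> e)} = {p a, p b}" using e1[OF e(1)] unfolding ab(1) by simp
    ultimately have "is_arc (A e') (p a) (p b)" using is_arc_sym by (metis doubleton_eq_iff)
    then show "\<exists>a b. e' = {a, b} \<and> a \<in> p ` pverts G \<and> b \<in> p ` pverts G \<and> is_arc (A e') a b"
      using ab e(2) by (intro exI[of _ "p a"] exI[of _ "p b"]) simp
    show "A e' \<inter> p ` pverts G = e'" unfolding e(2) A[OF e(1)] using e1[OF e(1)] by simp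
    fix f' assume "f' \<in> (`) p ` edges G" "e' \<noteq> f'"
    then obtain f where f: "f \<in> edges G" "f' = p ` f" by auto
    then have "e \<noteq> f" using \<open>e' \<noteq> f'\<close> e(2) by auto
    then have "A e' \<inter> A f' = p ` (e \<inter> f)" unfolding e(2) f(2) A[OF e(1)] A[OF f(1)] using e2 e(1) f(1) by simp
    also have "\<dots> = p ` e \<inter> p ` f"
      by (rule inj_on_image_Int[OF inj sgraph_sub[OF sg e(1)] sgraph_sub[OF sg f(1)]])
    finally show "A e' \<inter> A f' = e' \<inter> f'" unfolding e(2) f(2) .
  qed
  then show "drawable (pverts G) (edges G)" unfolding drawable_def using inj by (intro exI conjI)
next
  assume "drawable (pverts G) (edges G)"
  then obtain p A where inj: "inj_on p (pverts G)" and pg: "plane_graph (p ` pverts G) ((`) p ` edges G) A"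
    unfolding drawable_def by metis
  interpret plane_graph "p ` pverts G" "(`) p ` edges G" A by (rule pg)
  have "\<exists>g. arc g \<and> {pathstart g, pathfinish g} = p ` e \<and> path_image g = A (p ` e)" if e: "e \<in> edges G" for e
  proof -
    obtain a b where "p ` e = {a, b}" "is_arc (A (p ` e)) a b" using edge[OF imageI[OF e]] by metis
    then show ?thesis unfolding is_arc_def by metis
  qed
  then obtain \<gamma> where g: "\<And>e. e \<in> edges G \<Longrightarrow> arc (\<gamma> e) \<and> {pathstart (\<gamma> e), pathfinish (\<gamma> e)} = p ` e \<and>
    path_image (\<gamma> e) = A (p ` e)" by metis
  have "path_image (\<gamma> e) \<inter> path_image (\<gamma> f) = p ` (e \<inter> f)"
    if e: "e \<in> edges G" and f: "f \<in> edges G" and ne: "e \<noteq> f" for e f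
  proof -
    note sub = sgraph_sub[OF sg e] sgraph_sub[OF sg f]
    have "p ` e \<noteq> p ` f" using inj_on_image_eq_iff[OF inj sub] ne by simp
    then have "A (p ` e) \<inter> A (p ` f) = p ` e \<inter> p ` f" using cross imageI[OF e] imageI[OF f] by metis
    then show ?thesis using g[OF e] g[OF f] inj_on_image_Int[OF inj sub] by simp
  qed
  moreover have "path_image (\<gamma> e) \<inter> p ` pverts G = p ` e" if e: "e \<in> edges G" for e
    using g[OF e] vert[OF imageI[OF e]] by simp
  ultimately have "plane_drawing G p \<gamma>" unfolding plane_drawing_def using inj g by simp
  then show "planar G" unfolding planar_def by (intro exI)
qed

lemma edges_add_edge: "edges (add_edge G u v) = insert {u, v} (edges G)"
  unfolding edges_def add_edge_def by (auto simp: insert_commute)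

lemma pverts_add_edge: "pverts (add_edge G u v) = pverts G"
  unfolding add_edge_def by simp

lemma maximal_planar_iff:
  "maximal_planar G \<longleftrightarrow> pair_graph G \<and> mplanar (pverts G) (edges G)"
proof (cases "pair_graph G")
  case True
  note sg = pair_graph_sgraph[OF True]
  have "planar (add_edge G u v) \<longleftrightarrow> drawable (pverts G) (insert {u, v} (edges G))"
    if "u \<in> pverts G" "v \<in> pverts G" "u \<noteq> v" for u v
    using planar_iff_drawable[of "add_edge G u v"] sgraph_insert[OF sg that]
    unfolding edges_add_edge pverts_add_edge by simp
  then show ?thesis
    unfolding maximal_planar_def mplanar_def using True sg planar_iff_drawable[OF sg] pair_graph_edge_iff[OF True]
    by auto
qed (simp add: maximal_planar_def)

section \<open>Invariance under renaming of vertices\<close>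

lemma drawable_rename:
  assumes sg: "sgraph V E" and inj: "inj_on f V"
  shows "drawable (f ` V) ((`) f ` E) \<longleftrightarrow> drawable V E"
proof
  assume "drawable (f ` V) ((`) f ` E)"
  then obtain p A where p: "inj_on p (f ` V)" "plane_graph (p ` f ` V) ((`) p ` (`) f ` E) A" unfolding drawable_def by metis
  have "inj_on (p \<circ> f) V" using comp_inj_on[OF inj p(1)] .
  moreover have "(p \<circ> f) ` V = p ` f ` V" "(`) (p \<circ> f) ` E = (`) p ` (`) f ` E" by (simp_all add: image_comp comp_def image_image)
  ultimately show "drawable V E" unfolding drawable_def using p(2) by metis
next
  assume "drawable V E"
  then obtain p A where p: "inj_on p V" "plane_graph (p ` V) ((`) p ` E) A" unfolding drawable_def by metis
  define q where "q = p \<circ> the_inv_into V f"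
  have q: "q (f x) = p x" if "x \<in> V" for x unfolding q_def using the_inv_into_f_f[OF inj that] by simp
  have "inj_on q (f ` V)" using p(1) q by (auto simp: inj_on_def)
  moreover have "q ` f ` V = p ` V" using q by (force simp: image_image)
  moreover have "q ` f ` e = p ` e" if "e \<in> E" for e using sgraph_sub[OF sg that] q by (force simp: image_image)
  then have "(`) q ` (`) f ` E = (`) p ` E" by (force simp: image_image)
  ultimately show "drawable (f ` V) ((`) f ` E)" unfolding drawable_def using p(2) by metis
qed

lemma mplanar_rename:
  assumes mp: "mplanar V E" and inj: "inj_on f V"
  shows "mplanar (f ` V) ((`) f ` E)"
proof -
  note sg = mplanarD(1)[OF mp]
  have sg': "sgraph (f ` V) ((`) f ` E)"
    unfolding sgraph_def
  proof (intro conjI ballI)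
    show "finite (f ` V)" using sg unfolding sgraph_def by simp
    fix e assume "e \<in> (`) f ` E"
    then obtain e' where e': "e' \<in> E" "e = f ` e'" by auto
    then obtain a b where "e' = {a, b}" "a \<in> V" "b \<in> V" "a \<noteq> b" using sg unfolding sgraph_def by metis
    then show "\<exists>a b. e = {a, b} \<and> a \<in> f ` V \<and> b \<in> f ` V \<and> a \<noteq> b"
      using e'(2) inj_on_eq_iff[OF inj] by (intro exI[of _ "f a"] exI[of _ "f b"]) simp
  qed
  have "\<not> drawable (f ` V) (insert {f a, f b} ((`) f ` E))"
    if ab: "a \<in> V" "b \<in> V" "f a \<noteq> f b" "{f a, f b} \<notin> (`) f ` E" for a b
  proof
    assume D: "drawable (f ` V) (insert {f a, f b} ((`) f ` E))"
    have "a \<noteq> b" using ab(3) by auto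
    have "insert {f a, f b} ((`) f ` E) = (`) f ` insert {a, b} E" by simp
    then have "drawable V (insert {a, b} E)"
      using D drawable_rename[OF sgraph_insert[OF sg ab(1,2) \<open>a \<noteq> b\<close>] inj] by simp
    then have "{a, b} \<in> E" using mplanar_edgeI[OF mp ab(1,2) \<open>a \<noteq> b\<close>] by simp
    then show False using image_edge_iff[OF sg inj ab(1,2)] ab(4) by simp
  qed
  then show ?thesis unfolding mplanar_def using sg' drawable_rename[OF sg inj] mplanarD(2)[OF mp] by auto
qed

definition graph_of :: "'a set \<Rightarrow> 'a set set \<Rightarrow> 'a pair_pre_digraph" where
  "graph_of V E = \<lparr>pverts = V, parcs = {(a, b). {a, b} \<in> E}\<rparr>"

lemma graph_of_simps [simp]: "pverts (graph_of V E) = V" "parcs (graph_of V E) = {(a, b). {a, b} \<in> E}"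
  unfolding graph_of_def by simp_all

lemma pair_graph_of:
  assumes sg: "sgraph V E"
  shows "pair_graph (graph_of V E)"
proof
  have fin: "finite V" using sg unfolding sgraph_def by simp
  show "fst e \<in> pverts (graph_of V E)" "snd e \<in> pverts (graph_of V E)" "fst e \<noteq> snd e"
    if "e \<in> parcs (graph_of V E)" for e
    using that sgraph_edge[OF sg] by auto
  show "finite (pverts (graph_of V E))" using fin by simp
  have "parcs (graph_of V E) \<subseteq> V \<times> V" using sgraph_edge[OF sg] by auto
  then show "finite (parcs (graph_of V E))" by (rule finite_subset) (simp add: fin)
  show "symmetric (with_proj (graph_of V E))"
    unfolding symmetric_def by (auto simp: sym_def insert_commute)
qed

lemma edges_graph_of: "sgraph V E \<Longrightarrow> edges (graph_of V E) = E"
  unfolding edges_def sgraph_def by fastforce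

section \<open>Shortest walks of pair graphs\<close>

lemma (in wf_digraph) awalk_cost_unit: "awalk_cost (\<lambda>_. 1) p = real (length p)"
  by (induction p) auto

lemma graph_dist_le_iff:
  assumes sg: "sgraph V E" and u: "u \<in> V" and v: "v \<in> V"
  shows "graph_dist (graph_of V E) u v \<le> ereal (real k) \<longleftrightarrow> near E k u v"
proof -
  interpret pair_graph "graph_of V E" by (rule pair_graph_of[OF sg])
  have walk_near: "near E (length p) x v" if "awalk x p v" for p x
    using that
  proof (induction p arbitrary: x)
    case Nil
    then show ?case by (simp add: awalk_Nil_iff near.simps)
  next
    case (Cons e p)
    then have "e \<in> parcs (graph_of V E)" "fst e = x" "awalk (snd e) p v" by (auto simp: awalk_Cons_iff)
    then have "{x, snd e} \<in> E" "near E (length p) (snd e) v" using Cons.IH by auto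
    then show ?case by (auto simp: near.simps)
  qed
  have near_walk: "\<exists>p. awalk x p v \<and> length p \<le> k" if "near E k x v" "x \<in> V" for x k
    using that
  proof (induction k arbitrary: x)
    case 0
    then show ?case using v by (intro exI[of _ "[]"]) (simp add: awalk_Nil_iff near.simps)
  next
    case (Suc k)
    then obtain c where c: "x = c \<or> {x, c} \<in> E" "near E k c v" by (auto simp: near.simps)
    then have "c \<in> V" using Suc.prems(2) sgraph_edge[OF sg] by metis
    then obtain p where p: "awalk c p v" "length p \<le> k" using Suc.IH c(2) by metis
    show ?case
    proof (cases "x = c")
      case True
      then show ?thesis using p by (intro exI[of _ p]) simp
    next
      case False
      then have "(x, c) \<in> parcs (graph_of V E)" using c(1) by simp
      then have "awalk x ((x, c) # p) v" using p(1) Suc.prems(2) by (simp add: awalk_Cons_iff)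
      then show ?thesis using p(2) by (intro exI[of _ "(x, c) # p"]) simp
    qed
  qed
  have gd: "graph_dist (graph_of V E) u v = (INF p\<in>{p. awalk u p v}. ereal (real (length p)))"
    unfolding graph_dist_def \<mu>_def awalk_cost_unit ..
  show ?thesis
  proof
    assume le: "graph_dist (graph_of V E) u v \<le> ereal (real k)"
    \<comment> \<open>The strict comparison with \<open>Suc k\<close> extracts an actual walk from
      the infimum; its length is an integer, hence at most \<open>k\<close>.\<close>
    have "(INF p\<in>{p. awalk u p v}. ereal (real (length p))) < ereal (real (Suc k))"
      using le unfolding gd[symmetric] by (rule order_le_less_trans) simp
    then obtain p where "awalk u p v" "length p < Suc k" unfolding INF_less_iff by auto
    then show "near E k u v" using walk_near near_mono by (metis less_Suc_eq_le)
  next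
    assume "near E k u v"
    then obtain p where p: "awalk u p v" "length p \<le> k" using near_walk u by blast
    have "graph_dist (graph_of V E) u v \<le> ereal (real (length p))"
      unfolding gd using p(1) by (intro INF_lower) simp
    also have "\<dots> \<le> ereal (real k)" using p(2) by simp
    finally show "graph_dist (graph_of V E) u v \<le> ereal (real k)" .
  qed
qed

lemma graph_dist_ge:
  assumes sg: "sgraph V E" and u: "u \<in> V" and v: "v \<in> V" and n: "\<not> near E k u v"
  shows "ereal (real (Suc k)) \<le> graph_dist (graph_of V E) u v"
proof -
  interpret pair_graph "graph_of V E" by (rule pair_graph_of[OF sg])
  show ?thesis unfolding graph_dist_def \<mu>_def awalk_cost_unit
  proof (rule INF_greatest)
    fix p assume "p \<in> {p. awalk u p v}"
    then have "graph_dist (graph_of V E) u v \<le> ereal (real (length p))"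
      unfolding graph_dist_def \<mu>_def awalk_cost_unit by (rule INF_lower)
    then have "near E (length p) u v" using graph_dist_le_iff[OF sg u v] by simp
    then have "\<not> length p \<le> k" using n near_mono by metis
    then show "ereal (real (Suc k)) \<le> ereal (real (length p))" by simp
  qed
qed

theorem theorem35:
  fixes H :: "'a pair_pre_digraph"
  assumes "maximal_planar H"
    and "card (pverts H) \<le> 8"
  shows "\<exists>G :: nat pair_pre_digraph. maximal_planar G \<and>
    (\<exists>H'. digraph_iso (with_proj H) H' \<and> subgraph H' (center G))"
proof -
  have pgH: "pair_graph H" and mpH: "mplanar (pverts H) (edges H)" using assms(1) maximal_planar_iff by auto
  have finH: "finite (pverts H)" using mplanarD(1)[OF mpH] unfolding sgraph_def by simp
  \<comment> \<open>The vertex type of \<open>H\<close> may have no room for stacked vertices, so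
    the construction works on a copy of \<open>H\<close> in the natural numbers; \<open>H'\<close>
    below is this copy.\<close>
  obtain f :: "'a \<Rightarrow> nat" where f: "inj_on f (pverts H)" using finite_imp_inj_to_nat_seg[OF finH] by blast
  define V where "V = f ` pverts H"
  define E where "E = (`) f ` edges H"
  have mpV: "mplanar V E" unfolding V_def E_def by (rule mplanar_rename[OF mpH f])
  have "card V \<le> 8" unfolding V_def using assms(2) card_image[OF f] by simp
  then have "centrally_embeddable V E" by (rule small_centrally_embeddable[OF mpV])
  then obtain V' E' r where VE: "mplanar V' E'" "V \<subseteq> V'" "E \<subseteq> E'"
    and near_r: "\<And>h y. h \<in> V \<Longrightarrow> y \<in> V' \<Longrightarrow> near E' r h y"
    and far_r: "\<And>y. y \<in> V' \<Longrightarrow> r = 0 \<or> (\<exists>z\<in>V'. \<not> near E' (r - 1) y z)"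
    unfolding centrally_embeddable_def by metis
  note sg = mplanarD(1)[OF VE(1)]
  have fin: "finite V'" using sg unfolding sgraph_def by simp
  define G where "G = graph_of V' E'"
  have pgG: "pair_graph G" unfolding G_def by (rule pair_graph_of[OF sg])
  have maxG: "maximal_planar G"
    using maximal_planar_iff[of G] pgG VE(1) edges_graph_of[OF sg] unfolding G_def by simp
  have ecc_le: "eccentricity G h \<le> ereal (real r)" if h: "h \<in> V" for h
    unfolding eccentricity_def G_def graph_of_simps
  proof (rule Max.boundedI)
    show "finite (graph_dist (graph_of V' E') h ` V')" using fin by simp
    show "graph_dist (graph_of V' E') h ` V' \<noteq> {}" using h VE(2) by auto
    fix x assume "x \<in> graph_dist (graph_of V' E') h ` V'"
    then obtain y where y: "y \<in> V'" "x = graph_dist (graph_of V' E') h y" by auto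
    have "h \<in> V'" using h VE(2) by auto
    then show "x \<le> ereal (real r)"
      using graph_dist_le_iff[OF sg _ y(1)] near_r[OF h y(1)] unfolding y(2) by blast
  qed
  have ecc_ge: "ereal (real r) \<le> eccentricity G y" if y: "y \<in> V'" for y
  proof -
    have "\<exists>z\<in>V'. ereal (real r) \<le> graph_dist G y z"
    proof (cases "r = 0")
      case True
      have "ereal (real 0) \<le> graph_dist G y y"
      proof -
        interpret pair_graph G by (rule pgG)
        show ?thesis unfolding graph_dist_def \<mu>_def awalk_cost_unit by (auto intro!: INF_greatest)
      qed
      then show ?thesis using True y by blast
    next
      case False
      then obtain z where z: "z \<in> V'" "\<not> near E' (r - 1) y z" using far_r[OF y] by auto
      have "ereal (real (Suc (r - 1))) \<le> graph_dist G y z" unfolding G_def by (rule graph_dist_ge[OF sg y z])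
      then show ?thesis using z(1) False by auto
    qed
    then obtain z where z: "z \<in> V'" "ereal (real r) \<le> graph_dist G y z" by auto
    note z(2)
    also have "graph_dist G y z \<le> eccentricity G y"
      unfolding eccentricity_def by (rule Max_ge) (use fin z(1) in \<open>auto simp: G_def\<close>)
    finally show ?thesis .
  qed
  define C where "C = {u \<in> pverts G. \<forall>v\<in>pverts G. eccentricity G u \<le> eccentricity G v}"
  have VC: "V \<subseteq> C"
  proof
    fix h assume h: "h \<in> V"
    have "eccentricity G h \<le> eccentricity G v" if "v \<in> V'" for v
      using ecc_le[OF h] ecc_ge[OF that] by (rule order_trans)
    then show "h \<in> C" unfolding C_def using h VE(2) by (auto simp: G_def)
  qed
  define \<phi> :: "('a, 'a \<times> 'a, nat, nat \<times> nat) digraph_isomorphism"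
    where "\<phi> = \<lparr>iso_verts = f, iso_arcs = map_prod f f, iso_head = snd, iso_tail = fst\<rparr>"
  define H' where "H' = app_iso \<phi> (with_proj H)"
  interpret HG: pair_graph H by (rule pgH)
  have arcsV: "a \<in> pverts H \<and> b \<in> pverts H" if "(a, b) \<in> parcs H" for a b
    using that HG.in_arcsD1 HG.in_arcsD2 by metis
  have "pre_digraph.digraph_isomorphism (with_proj H) \<phi>"
    unfolding pre_digraph.digraph_isomorphism_def
  proof (intro conjI ballI)
    show "wf_digraph (with_proj H)" by unfold_locales
    show "inj_on (iso_verts \<phi>) (verts (with_proj H))" using f by (simp add: \<phi>_def)
    show "inj_on (iso_arcs \<phi>) (arcs (with_proj H))"
      using f arcsV by (auto simp: \<phi>_def inj_on_def)
    fix a assume "a \<in> arcs (with_proj H)"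
    show "iso_verts \<phi> (tail (with_proj H) a) = iso_tail \<phi> (iso_arcs \<phi> a)"
      "iso_verts \<phi> (head (with_proj H) a) = iso_head \<phi> (iso_arcs \<phi> a)"
      by (simp_all add: \<phi>_def)
  qed
  then have iso: "digraph_iso (with_proj H) H'" unfolding digraph_iso_def H'_def by blast
  have arcs': "(f a, f b) \<in> parcs G" "f a \<in> V" "f b \<in> V" if "(a, b) \<in> parcs H" for a b
  proof -
    have "{a, b} \<in> edges H" using that unfolding edges_def by auto
    then have "f ` {a, b} \<in> E" unfolding E_def by (rule imageI)
    then show "(f a, f b) \<in> parcs G" using VE(3) unfolding G_def by auto
    show "f a \<in> V" "f b \<in> V" using arcsV[OF that] unfolding V_def by auto
  qed
  have vH': "verts H' = V" "arcs H' = map_prod f f ` parcs H" "tail H' = fst" "head H' = snd"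
    unfolding H'_def V_def by (simp_all add: \<phi>_def)
  have "subgraph H' (center G)"
    unfolding subgraph_def
  proof (intro conjI)
    have cG: "center G = with_proj G \<restriction> C" unfolding center_def C_def ..
    show "verts H' \<subseteq> verts (center G)" unfolding vH' cG using VC by simp
    show "arcs H' \<subseteq> arcs (center G)" unfolding vH' cG using arcs' VC by auto
    show "wf_digraph (center G)" unfolding cG by unfold_locales auto
    show "wf_digraph H'" by unfold_locales (use arcs' in \<open>auto simp: vH'\<close>)
    show "compatible (center G) H'" unfolding compatible_def vH' cG by (simp add: induce_subgraph_def)
  qed
  then show ?thesis using maxG iso by blast
qed

end
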